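(* Let $D\subset\mathbb{R}^2$ be a bounded open set with boundary $\partial D$ of class $C^2$, let $\nu>0$, and let $H$, $A$, $B$ be the space and operators of the two-dimensional Navier-Stokes system on $D$ with Dirichlet boundary conditions, as defined in the context. Let $\mathcal{F}\in C(\mathbb{R},H)$ be Poisson stable (under the Bebutov translation dynamical system on $C(\mathbb{R},H)$ with the compact-open topology). Assume that the Navier-Stokes system $$u'+Au+B(u,u)=\mathcal{F}(t)$$ has a solution that is bounded in $H_0^1(D)\cap H$ for $t>0$; that is, there is a solution $v:[0,\infty)\to H$ with $v(t)\in H_0^1(D)^2\cap H$ for all $t>0$ and $\sup_{t>0}\|v(t)\|_{H_0^1(D)^2}<\infty$. Then this Navier-Stokes system has at least one Poisson stable solution in $C(\mathbb{R},H)$; that is, there exists a solution $u\in C(\mathbb{R},H)$ of the equation on all of $\mathbb{R}$ such that the point $(u(0),\mathcal{F})$ is Poisson stable along the skew-product motion $t\mapsto(u(t),\mathcal{F}_t)$, $t\in\mathbb{R}$, in $H\times H(\mathcal{F})$: there are sequences $t_n\to+\infty$ and $s_n\to-\infty$ with $(u(t_n),\mathcal{F}_{t_n})\to(u(0),\mathcal{F})$ and $(u(s_n),\mathcal{F}_{s_n})\to(u(0),\mathcal{F})$ in $H\times C(\mathbb{R},H)$.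
   Context: Functional setting. The equation is the projected form of the system $u'+\sum_{i=1}^2 u_i\partial_i u=\nu\Delta u-\nabla p+F(t)$, $\operatorname{div}u=0$, $u|_{\partial D}=0$, for the velocity field $u=(u_1,u_2)$, with $\mathcal{F}(t)=PF(t)$. $H$ and $V$ are the closures of $\{u\in C_0^\infty(D)^2:\operatorname{div}u=0\}$ in $L^2(D)^2$ and $H_0^1(D)^2$ respectively; $P:L^2(D)^2\to H$ is the orthogonal projection; $A:=-\nu P\Delta$ is the Stokes operator (self-adjoint and positive, with domain dense in $H$ and compact inverse); $B(u,v):=P\left(\sum_{i=1}^2u_i\partial_i v\right)$. Solutions are understood in the standard sense in which the 2D Navier-Stokes initial-value problem with initial data in $H$ is well-posed (weak solutions, continuous in time with values in $H$). A solution $u\in C(\mathbb{R},H)$ on $\mathbb{R}$ is a function whose restriction to every interval $[s,\infty)$ is such a solution with initial value $u(s)$ at time $s$. Bebutov system and hull. $C(\mathbb{R},H)$ is the space of continuous functions $\phi:\mathbb{R}\to H$ with the compact-open topology (uniform convergence on compact subsets of $\mathbb{R}$), which is metrizable. The Bebutov dynamical system is $(C(\mathbb{R},H),\mathbb{R},\sigma)$ with $\sigma(\tau,\phi)=\phi_\tau$, $\phi_\tau(t):=\phi(t+\tau)$. The hull of $\mathcal{F}$ is $H(\mathcal{F}):=\overline{\{\mathcal{F}_\tau:\tau\in\mathbb{R}\}}$, with closure in $C(\mathbb{R},H)$. Poisson stability. For a point $x$ with motion $t\mapsto xt$, $t\in\mathbb{R}$, in a metric space, $\omega_x=\{v:\exists\,t_n\to+\infty,\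 xt_n\to v\}$ and $\alpha_x=\{v:\exists\,t_n\to-\infty,\ xt_n\to v\}$; $x$ is Poisson stable if $x\in\omega_x\cap\alpha_x$. Thus $\mathcal{F}\in C(\mathbb{R},H)$ is Poisson stable if there are $t_n\to+\infty$ and $s_n\to-\infty$ such that $\mathcal{F}_{t_n}\to\mathcal{F}$ and $\mathcal{F}_{s_n}\to\mathcal{F}$ uniformly on compact subsets of $\mathbb{R}$. Skew-product. For $u_0\in H$ and $\tilde{\mathcal{F}}\in H(\mathcal{F})$, let $\varphi(t,u_0,\tilde{\mathcal{F}})$, $t\ge0$, be the solution of $u'+Au+B(u,u)=\tilde{\mathcal{F}}(t)$ with $u(0)=u_0$. The skew-product semiflow on $H\times H(\mathcal{F})$ is $\pi(t,(u_0,\tilde{\mathcal{F}}))=(\varphi(t,u_0,\tilde{\mathcal{F}}),\tilde{\mathcal{F}}_t)$, $t\ge0$. A solution $\varphi(\cdot,u_0,\tilde{\mathcal{F}})$ is called Poisson stable if $(u_0,\tilde{\mathcal{F}})$ is a Poisson stable point of the skew-product system. *)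

theory Defs
  imports "HOL-Analysis.Analysis"
begin

primrec class_C :: "nat \<Rightarrow> ('a::euclidean_space \<Rightarrow> 'b::real_normed_vector) \<Rightarrow> bool" where
  "class_C 0 f \<longleftrightarrow> continuous_on UNIV f"
| "class_C (Suc k) f \<longleftrightarrow> (\<forall>x. f differentiable (at x)) \<and>
     (\<forall>b\<in>Basis. class_C k (\<lambda>x. frechet_derivative f (at x) b))"

text \<open>Locally, after a rotation or reflection of the coordinates, \<open>D\<close> is the part of the plane
  strictly above the graph of a \<open>C\<^sup>2\<close> function.\<close>

definition C2_boundary :: "(real^2) set \<Rightarrow> bool" where
  "C2_boundary D \<longleftrightarrow> (\<forall>p\<in>frontier D. \<exists>r>0. \<exists>T::real^2 \<Rightarrow> real^2. \<exists>\<gamma>::real \<Rightarrow> real.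
     orthogonal_transformation T \<and> class_C 2 \<gamma> \<and>
     D \<inter> ball p r = {x \<in> ball p r. T x $ 2 > \<gamma> (T x $ 1)})"

text \<open>Elements of \<open>L\<^sup>2(D)\<close> and of its subspaces are represented by functions on the whole plane.
  Only the values on \<open>D\<close>, up to null sets, matter: convergence, closures and continuity
  are always taken with respect to the seminorms below, and two representatives of the same
  element are at distance \<open>0\<close>.\<close>

definition L2 :: "(real^2) set \<Rightarrow> (real^2 \<Rightarrow> 'b::euclidean_space) set" where
  "L2 D = {u. u \<in> borel_measurable (lebesgue_on D) \<and>
     integrable (lebesgue_on D) (\<lambda>x. (norm (u x))\<^sup>2)}"

definition L2_inner :: "(real^2) set \<Rightarrow> (real^2 \<Rightarrow> 'b::euclidean_space) \<Rightarrow> (real^2 \<Rightarrow> 'b) \<Rightarrow> real" where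
  "L2_inner D u w = (\<integral>x. u x \<bullet> w x \<partial>lebesgue_on D)"

definition L2_norm :: "(real^2) set \<Rightarrow> (real^2 \<Rightarrow> 'b::euclidean_space) \<Rightarrow> real" where
  "L2_norm D u = sqrt (L2_inner D u u)"

definition test_functions :: "(real^2) set \<Rightarrow> (real^2 \<Rightarrow> 'b::euclidean_space) set" where
  "test_functions D = {f. (\<forall>k. class_C k f) \<and>
     (\<exists>K. compact K \<and> K \<subseteq> D \<and> (\<forall>x. x \<notin> K \<longrightarrow> f x = 0))}"

text \<open>A gradient is matrix-valued, with entry \<open>(i, j)\<close> equal to \<open>\<partial>\<^sub>j u\<^sub>i\<close>, as for
  \<^const>\<open>jacobian\<close>. The inner product of \<open>real^2^2\<close> is the sum of the products of the entries.\<close>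

definition has_weak_gradient ::
    "(real^2) set \<Rightarrow> (real^2 \<Rightarrow> real^2) \<Rightarrow> (real^2 \<Rightarrow> real^2^2) \<Rightarrow> bool" where
  "has_weak_gradient D u G \<longleftrightarrow> G \<in> L2 D \<and>
     (\<forall>\<psi>::real^2 \<Rightarrow> real. \<psi> \<in> test_functions D \<longrightarrow> (\<forall>i j.
        (\<integral>x. u x $ i * frechet_derivative \<psi> (at x) (axis j 1) \<partial>lebesgue_on D) =
        - (\<integral>x. G x $ i $ j * \<psi> x \<partial>lebesgue_on D)))"

definition weak_gradient :: "(real^2) set \<Rightarrow> (real^2 \<Rightarrow> real^2) \<Rightarrow> real^2 \<Rightarrow> real^2^2" where
  "weak_gradient D u = (SOME G. has_weak_gradient D u G)"

definition H1 :: "(real^2) set \<Rightarrow> (real^2 \<Rightarrow> real^2) set" where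
  "H1 D = {u \<in> L2 D. \<exists>G. has_weak_gradient D u G}"

definition H1_norm :: "(real^2) set \<Rightarrow> (real^2 \<Rightarrow> real^2) \<Rightarrow> real" where
  "H1_norm D u = sqrt ((L2_norm D u)\<^sup>2 + (L2_norm D (weak_gradient D u))\<^sup>2)"

definition H10 :: "(real^2) set \<Rightarrow> (real^2 \<Rightarrow> real^2) set" where
  "H10 D = {u \<in> H1 D. \<forall>e>0. \<exists>f\<in>test_functions D. H1_norm D (\<lambda>x. u x - f x) < e}"

definition solenoidal_tests :: "(real^2) set \<Rightarrow> (real^2 \<Rightarrow> real^2) set" where
  "solenoidal_tests D = {f \<in> test_functions D. \<forall>x. trace (jacobian f (at x)) = 0}"

definition H_space :: "(real^2) set \<Rightarrow> (real^2 \<Rightarrow> real^2) set" where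
  "H_space D = {u \<in> L2 D. \<forall>e>0. \<exists>f\<in>solenoidal_tests D. L2_norm D (\<lambda>x. u x - f x) < e}"

definition V_space :: "(real^2) set \<Rightarrow> (real^2 \<Rightarrow> real^2) set" where
  "V_space D = {u \<in> H10 D. \<forall>e>0. \<exists>f\<in>solenoidal_tests D. H1_norm D (\<lambda>x. u x - f x) < e}"

definition C_H :: "real set \<Rightarrow> (real^2) set \<Rightarrow> (real \<Rightarrow> real^2 \<Rightarrow> real^2) set" where
  "C_H S D = {u. (\<forall>t\<in>S. u t \<in> H_space D) \<and>
     (\<forall>t\<in>S. ((\<lambda>r. L2_norm D (\<lambda>x. u r x - u t x)) \<longlongrightarrow> 0) (at t within S))}"

text \<open>A weak solution only has \<open>u(t) \<in> V\<close> for almost every \<open>t\<close>, so \<open>A = -\<nu>P\<Delta>\<close> and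
  \<open>B(u,v) = P(\<Sum>\<^sub>i u\<^sub>i \<partial>\<^sub>i v)\<close> are used through their usual extensions with values in the dual
  of \<open>V\<close>; the last argument \<open>w\<close> is the element of \<open>V\<close> they are paired with. The projection
  \<open>P\<close> disappears because \<open>w\<close> lies in \<open>H\<close>, and the Laplacian is integrated by parts.\<close>

definition stokes_A ::
    "(real^2) set \<Rightarrow> real \<Rightarrow> (real^2 \<Rightarrow> real^2) \<Rightarrow> (real^2 \<Rightarrow> real^2) \<Rightarrow> real" where
  "stokes_A D \<nu> u w = \<nu> * L2_inner D (weak_gradient D u) (weak_gradient D w)"

definition convection_B ::
    "(real^2) set \<Rightarrow> (real^2 \<Rightarrow> real^2) \<Rightarrow> (real^2 \<Rightarrow> real^2) \<Rightarrow> (real^2 \<Rightarrow> real^2) \<Rightarrow> real" where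
  "convection_B D u v w = L2_inner D (\<lambda>x. weak_gradient D v x *v u x) w"

text \<open>Weak solution on \<open>[s, \<infinity>)\<close> with initial value \<open>u s\<close>: it lies in \<open>C([s,\<infinity>), H)\<close> and in
  \<open>L\<^sup>2(s,T; V)\<close> for all \<open>T\<close>, and \<open>d/dt (u,w) + \<langle>Au,w\<rangle> + \<langle>B(u,u),w\<rangle> = (F,w)\<close> holds, integrated
  in time, for all \<open>w \<in> V\<close>. Values of \<open>u\<close> before time \<open>s\<close> are irrelevant.\<close>

definition NS_solution_from ::
    "(real^2) set \<Rightarrow> real \<Rightarrow> (real \<Rightarrow> real^2 \<Rightarrow> real^2) \<Rightarrow> real \<Rightarrow> (real \<Rightarrow> real^2 \<Rightarrow> real^2) \<Rightarrow> bool" where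
  "NS_solution_from D \<nu> F s u \<longleftrightarrow>
     u \<in> C_H {s..} D \<and>
     (AE t in lebesgue_on {s..}. u t \<in> V_space D) \<and>
     (\<forall>T\<ge>s. integrable (lebesgue_on {s..T}) (\<lambda>t. (H1_norm D (u t))\<^sup>2)) \<and>
     (\<forall>w\<in>V_space D. \<forall>a b. s \<le> a \<and> a \<le> b \<longrightarrow>
        has_bochner_integral (lebesgue_on {a..b})
          (\<lambda>t. L2_inner D (F t) w - stokes_A D \<nu> (u t) w - convection_B D (u t) (u t) w)
          (L2_inner D (u b) w - L2_inner D (u a) w))"

definition NS_entire_solution ::
    "(real^2) set \<Rightarrow> real \<Rightarrow> (real \<Rightarrow> real^2 \<Rightarrow> real^2) \<Rightarrow> (real \<Rightarrow> real^2 \<Rightarrow> real^2) \<Rightarrow> bool" where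
  "NS_entire_solution D \<nu> F u \<longleftrightarrow> u \<in> C_H UNIV D \<and> (\<forall>s. NS_solution_from D \<nu> F s u)"

text \<open>Limit sets of a motion \<open>\<gamma>\<close> in a phase space \<open>X\<close>. Because points are represented
  by functions up to null sets, the convergence of sequences in \<open>X\<close> is an explicit parameter.\<close>

definition omega_limit_set ::
    "'x set \<Rightarrow> ((nat \<Rightarrow> 'x) \<Rightarrow> 'x \<Rightarrow> bool) \<Rightarrow> (real \<Rightarrow> 'x) \<Rightarrow> 'x set" where
  "omega_limit_set X conv \<gamma> =
     {y \<in> X. \<exists>t. filterlim t at_top sequentially \<and> conv (\<lambda>n. \<gamma> (t n)) y}"

definition alpha_limit_set ::
    "'x set \<Rightarrow> ((nat \<Rightarrow> 'x) \<Rightarrow> 'x \<Rightarrow> bool) \<Rightarrow> (real \<Rightarrow> 'x) \<Rightarrow> 'x set" where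
  "alpha_limit_set X conv \<gamma> =
     {y \<in> X. \<exists>t. filterlim t at_bot sequentially \<and> conv (\<lambda>n. \<gamma> (t n)) y}"

definition Poisson_stable ::
    "'x set \<Rightarrow> ((nat \<Rightarrow> 'x) \<Rightarrow> 'x \<Rightarrow> bool) \<Rightarrow> (real \<Rightarrow> 'x) \<Rightarrow> bool" where
  "Poisson_stable X conv \<gamma> \<longleftrightarrow> \<gamma> 0 \<in> omega_limit_set X conv \<gamma> \<inter> alpha_limit_set X conv \<gamma>"

definition conv_H ::
    "(real^2) set \<Rightarrow> (nat \<Rightarrow> real^2 \<Rightarrow> real^2) \<Rightarrow> (real^2 \<Rightarrow> real^2) \<Rightarrow> bool" where
  "conv_H D U u \<longleftrightarrow> (\<lambda>n. L2_norm D (\<lambda>x. U n x - u x)) \<longlonglongrightarrow> 0"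

definition conv_compact_open ::
    "(real^2) set \<Rightarrow> (nat \<Rightarrow> real \<Rightarrow> real^2 \<Rightarrow> real^2) \<Rightarrow> (real \<Rightarrow> real^2 \<Rightarrow> real^2) \<Rightarrow> bool" where
  "conv_compact_open D \<Phi> \<phi> \<longleftrightarrow> (\<forall>K e. compact K \<and> e > 0 \<longrightarrow>
     (\<forall>\<^sub>F n in sequentially. \<forall>t\<in>K. L2_norm D (\<lambda>x. \<Phi> n t x - \<phi> t x) < e))"

definition translate :: "real \<Rightarrow> (real \<Rightarrow> 'x) \<Rightarrow> real \<Rightarrow> 'x" where
  "translate \<tau> \<phi> = (\<lambda>t. \<phi> (t + \<tau>))"

text \<open>The compact-open topology is metrizable, so the closure is the sequential closure.\<close>

definition hull_of :: "(real^2) set \<Rightarrow> (real \<Rightarrow> real^2 \<Rightarrow> real^2) \<Rightarrow> (real \<Rightarrow> real^2 \<Rightarrow> real^2) set" where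
  "hull_of D F = {G \<in> C_H UNIV D. \<exists>\<tau>. conv_compact_open D (\<lambda>n. translate (\<tau> n) F) G}"

definition conv_skew ::
    "(real^2) set \<Rightarrow> (nat \<Rightarrow> (real^2 \<Rightarrow> real^2) \<times> (real \<Rightarrow> real^2 \<Rightarrow> real^2)) \<Rightarrow>
     (real^2 \<Rightarrow> real^2) \<times> (real \<Rightarrow> real^2 \<Rightarrow> real^2) \<Rightarrow> bool" where
  "conv_skew D Z z \<longleftrightarrow>
     conv_H D (\<lambda>n. fst (Z n)) (fst z) \<and> conv_compact_open D (\<lambda>n. snd (Z n)) (snd z)"

definition Poisson_stable_forcing :: "(real^2) set \<Rightarrow> (real \<Rightarrow> real^2 \<Rightarrow> real^2) \<Rightarrow> bool" where
  "Poisson_stable_forcing D F \<longleftrightarrow>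
     Poisson_stable (C_H UNIV D) (conv_compact_open D) (\<lambda>\<tau>. translate \<tau> F)"

definition Poisson_stable_solution ::
    "(real^2) set \<Rightarrow> (real \<Rightarrow> real^2 \<Rightarrow> real^2) \<Rightarrow> (real \<Rightarrow> real^2 \<Rightarrow> real^2) \<Rightarrow> bool" where
  "Poisson_stable_solution D F u \<longleftrightarrow>
     Poisson_stable (H_space D \<times> hull_of D F) (conv_skew D) (\<lambda>t. (u t, translate t F))"

end

theory Submission
  imports Defs "HOL-Library.Diagonal_Subsequence" "HOL-Computational_Algebra.Polynomial"
    "HOL-Real_Asymp.Real_Asymp" "HOL-Complex_Analysis.Great_Picard"
begin

text \<open>The solution is found as a point of a minimal set. Let \<open>v\<close> be the given bounded solution and let
\<open>t\<^sub>n\<close> tend to infinity with \<open>F(\<cdot> + t\<^sub>n)\<close> converging to \<open>F\<close>. The translates \<open>v(\<cdot> + t\<^sub>n)\<close> solve the equation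
with forcing \<open>F(\<cdot> + t\<^sub>n)\<close> on half-lines that exhaust the line, and a subsequence converges, locally
uniformly, to a solution on the whole line with forcing \<open>F\<close> and with the same bound \<open>M\<close>
(\<open>bdd_sols_compact\<close>). Let \<open>S\<close> be the set of all solutions of this kind. For \<open>u\<close> in \<open>S\<close> let \<open>P(u)\<close> be
the set of those \<open>w\<close> in \<open>S\<close> for which there are arbitrarily large times \<open>t\<close> such that
\<open>(u(\<cdot> + t), F(\<cdot> + t))\<close> is close to \<open>(w, F)\<close> on long intervals, and let \<open>N(u)\<close> be the set defined in the
same way with \<open>t\<close> tending to \<open>-\<infinity>\<close>. Both sets are closed, and by compactness and the Poisson stability
of \<open>F\<close> they are nonempty. If \<open>w \<in> P(u)\<close>, then \<open>P(w)\<close> and \<open>N(w)\<close> are contained in \<open>P(u)\<close>: a fixed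
translation of a sufficiently late approach of \<open>u\<close> to \<open>w\<close> is again a late approach. The same holds with
\<open>N(u)\<close> in place of \<open>P(u)\<close>. By Zorn's lemma there is a minimal nonempty compact \<open>A \<subseteq> S\<close> that contains
\<open>P(u)\<close> and \<open>N(u)\<close> for all its points. For \<open>u \<in> A\<close> the sets \<open>P(u)\<close> and \<open>N(u)\<close> have the same property as
\<open>A\<close>, so both are equal to \<open>A\<close>, and \<open>u \<in> P(u) \<inter> N(u)\<close>. This is Poisson stability in both directions of
time at once (\<open>ex_point_in_all_returns\<close>, \<open>ex_recurrent_solution\<close>).

The compactness theorem rests on the following estimates. The increment \<open>u(b) - u(a)\<close> lies in \<open>V\<close>, and the weak
equation tested with it gives \<open>\<parallel>u(b) - u(a)\<parallel>\<^sup>2 \<le> c (b - a)\<close>, with a constant that depends only on \<open>M\<close> and on a bound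
of the forcing. With the Rellich theorem (\<open>rellich_V_graph\<close>) this permits the Arzela-Ascoli argument. In the
limit of the equation, the gradients converge weakly and the tensors \<open>w \<otimes> u\<close> converge strongly in
\<open>L\<^sup>2\<close>, because of Ladyzhenskaya's inequality
\<open>\<integral>|u|\<^sup>2|w|\<^sup>2 \<le> 4 \<parallel>u\<parallel> \<parallel>\<nabla>u\<parallel> \<parallel>w\<parallel> \<parallel>\<nabla>w\<parallel>\<close> applied to the difference of two solutions
(\<open>outer_class_bound\<close>, \<open>rhs_tendsto\<close>). Hence \<open>\<langle>B(u,u),w\<rangle> = (\<nabla>u, w \<otimes> u)\<close> passes to the limit.

These arguments only see the closed graph of the gradient on \<open>V\<close> inside the product of two Hilbert spaces;
they are carried out in the locale \<open>navier_stokes_form\<close>. The concrete part builds \<open>L\<^sup>2\<close> as a complete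
inner product space, shows that the graph of the weak gradient is the closure of its restriction to
solenoidal test functions, and proves the inequality and the compactness that the locale asks for. Weak
compactness enters through convex combinations: a bounded sequence in a Hilbert space has
norm-convergent convex combinations of its tails.\<close>

section \<open>Weak limits along closed graphs in Hilbert spaces\<close>

text \<open>Choose nearly norm-minimal points \<open>y n\<close> in the convex hulls \<open>C n\<close> of the tails. The minimal norms \<open>d n\<close>
increase to a limit since the hulls shrink, and the midpoint of \<open>y n\<close> and \<open>y m\<close> has norm at least \<open>d n\<close>
for \<open>n \<le> m\<close>. The parallelogram law then makes \<open>y\<close> a Cauchy sequence. This replaces weak sequential
compactness of balls.\<close>

lemma convex_combinations_converge:
  fixes x :: "nat \<Rightarrow> 'a::{real_inner,complete_space}"
  assumes bd: "\<And>n. norm (x n) \<le> M"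
  shows "\<exists>y l. (\<forall>n. y n \<in> convex hull (x ` {n..})) \<and> y \<longlonglongrightarrow> l"
proof -
  define C where "C n = convex hull (x ` {n..})" for n
  define d where "d n = Inf (norm ` C n)" for n
  have xC: "x n \<in> C n" for n unfolding C_def by (simp add: hull_inc)
  have anti: "C m \<subseteq> C n" if "n \<le> m" for n m
    unfolding C_def by (rule hull_mono) (use that in auto)
  have bb: "bdd_below (norm ` C n)" for n by (rule bdd_belowI[of _ 0]) auto
  have dle: "d n \<le> norm z" if "z \<in> C n" for n z
    unfolding d_def by (rule cInf_lower) (use that bb in auto)
  have d0: "0 \<le> d n" for n
    unfolding d_def by (rule cInf_greatest) (use xC in auto)
  have dM: "d n \<le> M" for n by (rule order_trans[OF dle[OF xC] bd])
  have "incseq d"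
    unfolding incseq_def d_def
    by (intro allI impI cInf_superset_mono image_mono anti bb) (use xC in auto)
  then obtain L where L: "d \<longlonglongrightarrow> L"
    using incseq_convergent[of d M] dM by blast
  have "\<exists>z. z \<in> C n \<and> norm z < d n + 1 / (real n + 1)" for n
  proof -
    have "Inf (norm ` C n) < d n + 1 / (real n + 1)" unfolding d_def by simp
    moreover have "norm ` C n \<noteq> {}" using xC by auto
    ultimately show ?thesis using cInf_lessD[of "norm ` C n" "d n + 1 / (real n + 1)"] by auto
  qed
  then obtain y where y: "\<And>n. y n \<in> C n" "\<And>n. norm (y n) < d n + 1 / (real n + 1)" by metis
  define a where "a n = d n + 1 / (real n + 1)" for n
  have "(\<lambda>n. 1 / (real n + 1)) \<longlonglongrightarrow> 0" by real_asymp
  then have aL: "a \<longlonglongrightarrow> L" unfolding a_def using tendsto_add[OF L] by fastforce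
  \<comment> \<open>The parallelogram law, with the midpoint bounded below by \<open>d n\<close>.\<close>
  have key: "(norm (y n - y m))\<^sup>2 \<le> 2 * (a n)\<^sup>2 + 2 * (a m)\<^sup>2 - 4 * (d n)\<^sup>2" if "n \<le> m" for n m
  proof -
    have "y m \<in> C n" using y(1) anti[OF that] by blast
    then have "(1/2) *\<^sub>R y n + (1/2) *\<^sub>R y m \<in> C n"
      using y(1)[of n] convexD[of "C n" "y n" "y m" "1/2" "1/2"] unfolding C_def by (simp add: convex_convex_hull)
    then have "d n \<le> norm ((1/2) *\<^sub>R (y n + y m))" using dle by (simp add: scaleR_add_right)
    then have "d n * 2 \<le> norm (y n + y m)" by simp
    then have "(d n * 2)\<^sup>2 \<le> (norm (y n + y m))\<^sup>2" using d0 by (intro power_mono) auto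
    then have 1: "4 * (d n)\<^sup>2 \<le> (norm (y n + y m))\<^sup>2" by (simp add: power2_eq_square)
    have 2: "(norm (y k))\<^sup>2 \<le> (a k)\<^sup>2" for k
      using y(2)[of k] unfolding a_def by (intro power_mono) auto
    have "(norm (y n + y m))\<^sup>2 + (norm (y n - y m))\<^sup>2 = 2 * (norm (y n))\<^sup>2 + 2 * (norm (y m))\<^sup>2"
      by (simp add: power2_norm_eq_inner inner_add_left inner_add_right inner_diff_left inner_diff_right)
    then show ?thesis using 1 2[of n] 2[of m] by linarith
  qed
  have "Cauchy y"
  proof (rule metric_CauchyI)
    fix e :: real assume e: "0 < e"
    have "(\<lambda>n. (a n)\<^sup>2) \<longlonglongrightarrow> L\<^sup>2" "(\<lambda>n. (d n)\<^sup>2) \<longlonglongrightarrow> L\<^sup>2" by (intro tendsto_intros aL L)+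
    moreover have "0 < e\<^sup>2 / 10" using e by simp
    ultimately have "\<forall>\<^sub>F n in sequentially. dist ((a n)\<^sup>2) (L\<^sup>2) < e\<^sup>2/10 \<and> dist ((d n)\<^sup>2) (L\<^sup>2) < e\<^sup>2/10"
      by (intro eventually_conj tendstoD) auto
    then obtain N where N: "\<And>n. n \<ge> N \<Longrightarrow> \<bar>(a n)\<^sup>2 - L\<^sup>2\<bar> < e\<^sup>2/10 \<and> \<bar>(d n)\<^sup>2 - L\<^sup>2\<bar> < e\<^sup>2/10"
      unfolding eventually_sequentially dist_real_def by blast
    have *: "dist (y n) (y m) < e" if "n \<ge> N" "n \<le> m" for n m
    proof -
      have "(norm (y n - y m))\<^sup>2 < e\<^sup>2"
        using key[OF that(2)] N[of n] N[of m] that e by (auto simp: abs_if split: if_splits)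
      then show ?thesis using e by (simp add: dist_norm power_less_imp_less_base)
    qed
    show "\<exists>M. \<forall>m\<ge>M. \<forall>n\<ge>M. dist (y m) (y n) < e"
    proof (intro exI allI impI)
      fix m n assume "m \<ge> N" "n \<ge> N"
      then show "dist (y m) (y n) < e"
        using *[of m n] *[of n m] by (cases "m \<le> n") (auto simp: dist_commute)
    qed
  qed
  then obtain l where "y \<longlonglongrightarrow> l" using Cauchy_convergent convergent_def by blast
  then show ?thesis using y(1) unfolding C_def by blast
qed

text \<open>The convex combinations are taken of the pairs \<open>(x n, g n)\<close>. Their first components are averages of late terms of a
convergent sequence and have the same limit \<open>x0\<close>.\<close>

lemma graph_limit_in_hull:
  fixes S :: "('x::{real_inner,complete_space} \<times> 'y::{real_inner,complete_space}) set"
  assumes S: "closed S" "convex S"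
    and xg: "\<And>n. (x n, g n) \<in> S" "\<And>n. norm (g n) \<le> M" "x \<longlonglongrightarrow> x0"
  shows "\<exists>g0. (x0, g0) \<in> S \<and> g0 \<in> closure (convex hull (range g))"
proof -
  define p where "p n = (x n, g n)" for n
  have "bounded (range x)" using convergent_imp_bounded[OF xg(3)] .
  then obtain K where K: "\<And>n. norm (x n) \<le> K" unfolding bounded_iff by auto
  have pb: "norm (p n) \<le> K + M" for n
    using norm_Pair_le[of "x n" "g n"] K[of n] xg(2)[of n] unfolding p_def by linarith
  obtain y l where y: "\<And>n. y n \<in> convex hull (p ` {n..})" and yl: "y \<longlonglongrightarrow> l"
    using convex_combinations_converge[where x=p, OF pb] by blast
  have "y n \<in> S" for n
  proof -
    have "convex hull (p ` {n..}) \<subseteq> S" by (intro hull_minimal S(2)) (simp add: p_def xg(1) image_subset_iff)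
    then show ?thesis using y by (rule subsetD)
  qed
  then have lS: "l \<in> S" using closed_sequentially[OF S(1) _ yl] by blast
  have fst: "fst (y n) \<in> convex hull (x ` {n..})" for n
  proof -
    have "fst ` (convex hull (p ` {n..})) = convex hull (fst ` p ` {n..})"
      by (rule convex_hull_linear_image) (simp add: linear_fst)
    also have "fst ` p ` {n..} = x ` {n..}" by (simp add: image_image p_def)
    finally show ?thesis using y by blast
  qed
  have snd: "snd (y n) \<in> convex hull (range g)" for n
  proof -
    have "snd ` (convex hull (p ` {n..})) = convex hull (snd ` p ` {n..})"
      by (rule convex_hull_linear_image) (simp add: linear_snd)
    also have "snd ` p ` {n..} = g ` {n..}" by (simp add: image_image p_def)
    also have "convex hull (g ` {n..}) \<subseteq> convex hull (range g)" by (rule hull_mono) auto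
    finally show ?thesis using y by blast
  qed
  have "(\<lambda>n. fst (y n)) \<longlonglongrightarrow> x0"
  proof (rule tendstoI)
    fix e :: real assume "0 < e"
    then have "\<forall>\<^sub>F n in sequentially. dist (x n) x0 < e" using tendstoD[OF xg(3)] by blast
    then obtain N where N: "\<And>n. n \<ge> N \<Longrightarrow> dist (x n) x0 < e" unfolding eventually_sequentially by blast
    have "dist (fst (y n)) x0 < e" if "n \<ge> N" for n
    proof -
      have "convex hull (x ` {n..}) \<subseteq> ball x0 e"
        by (rule hull_minimal) (use N that in \<open>auto simp: dist_commute\<close>)
      then show ?thesis using fst[of n] by (auto simp: dist_commute)
    qed
    then show "\<forall>\<^sub>F n in sequentially. dist (fst (y n)) x0 < e" unfolding eventually_sequentially by blast
  qed
  then have "fst l = x0" using tendsto_fst[OF yl] by (rule LIMSEQ_unique[symmetric])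
  moreover have "snd l \<in> closure (convex hull (range g))"
    unfolding closure_sequential using snd tendsto_snd[OF yl] by (intro exI[of _ "\<lambda>n. snd (y n)"]) simp
  ultimately show ?thesis using lS by (metis prod.collapse)
qed

text \<open>If \<open>g n \<bullet> h\<close> stayed above \<open>g0 \<bullet> h + e\<close> along a subsequence, the previous lemma applied to that
subsequence would give a second value of the graph over \<open>x0\<close> in the closed half-space
\<open>{z. g0 \<bullet> h + e \<le> z \<bullet> h}\<close>.\<close>

lemma graph_weak_limit:
  fixes S :: "('x::{real_inner,complete_space} \<times> 'y::{real_inner,complete_space}) set"
  assumes S: "closed S" "convex S"
    and single: "\<And>u a b. (u, a) \<in> S \<Longrightarrow> (u, b) \<in> S \<Longrightarrow> a = b"
    and xg: "\<And>n. (x n, g n) \<in> S" "\<And>n. norm (g n) \<le> M" "x \<longlonglongrightarrow> x0"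
  shows "\<exists>g0. (x0, g0) \<in> S \<and> norm g0 \<le> M \<and> (\<forall>h. (\<lambda>n. g n \<bullet> h) \<longlonglongrightarrow> g0 \<bullet> h)"
proof -
  obtain g0 where g0: "(x0, g0) \<in> S" "g0 \<in> closure (convex hull (range g))"
    using graph_limit_in_hull[OF S xg] by blast
  have half: "closure (convex hull (range g')) \<subseteq> {z. c \<le> z \<bullet> h}"
    if "\<And>n. c \<le> g' n \<bullet> h" for g' :: "nat \<Rightarrow> 'y" and c h
  proof (rule closure_minimal)
    show "convex hull (range g') \<subseteq> {z. c \<le> z \<bullet> h}"
      by (rule hull_minimal) (use that convex_halfspace_ge[of c h] in \<open>auto simp: inner_commute\<close>)
    show "closed {z. c \<le> z \<bullet> h}" by (intro closed_Collect_le continuous_intros)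
  qed
  have "closure (convex hull (range g)) \<subseteq> cball 0 M"
    by (rule closure_minimal, rule hull_minimal) (use xg(2) in auto)
  then have "norm g0 \<le> M" using g0(2) by auto
  moreover have "(\<lambda>n. g n \<bullet> h) \<longlonglongrightarrow> g0 \<bullet> h" for h
  proof -
    have *: "\<forall>\<^sub>F n in sequentially. g n \<bullet> h < g0 \<bullet> h + e" if e: "0 < e" for e h
    proof (rule ccontr)
      assume "\<not> ?thesis"
      then have inf: "infinite {n. g0 \<bullet> h + e \<le> g n \<bullet> h}"
        unfolding eventually_sequentially infinite_nat_iff_unbounded_le by (auto simp: not_less)
      then obtain r :: "nat \<Rightarrow> nat" where r: "strict_mono r" "\<And>n. g0 \<bullet> h + e \<le> g (r n) \<bullet> h"
        using infinite_enumerate[OF inf] by auto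
      have "(\<lambda>n. x (r n)) \<longlonglongrightarrow> x0" using LIMSEQ_subseq_LIMSEQ[OF xg(3) r(1)] by (simp add: o_def)
      then obtain g1 where g1: "(x0, g1) \<in> S" "g1 \<in> closure (convex hull (range (\<lambda>n. g (r n))))"
        using graph_limit_in_hull[OF S, of "\<lambda>n. x (r n)" "\<lambda>n. g (r n)"] xg by blast
      then have "g0 \<bullet> h + e \<le> g1 \<bullet> h" using half[where g'="\<lambda>n. g (r n)", OF r(2)] by blast
      then show False using single[OF g0(1) g1(1)] e by simp
    qed
    show ?thesis
    proof (rule tendstoI)
      fix e :: real assume e: "0 < e"
      show "\<forall>\<^sub>F n in sequentially. dist (g n \<bullet> h) (g0 \<bullet> h) < e"
        using *[OF e, of h] *[OF e, of "- h"] by eventually_elim (auto simp: dist_real_def abs_less_iff)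
    qed
  qed
  ultimately show ?thesis using g0 by blast
qed

section \<open>Minimal sets and locally uniform limits\<close>

text \<open>The topological core. A minimal compact set \<open>A\<close> that is closed under \<open>P\<close> and \<open>N\<close> exists by Zorn's lemma and
compactness. For \<open>z\<close> in \<open>A\<close>, the transitivity hypotheses say that \<open>P z\<close> and \<open>N z\<close> are themselves closed under
\<open>P\<close> and \<open>N\<close>, so minimality forces \<open>P z = A = N z\<close>.\<close>

lemma ex_point_in_all_returns:
  fixes P N :: "'z::t2_space \<Rightarrow> 'z set"
  assumes Z: "compact Z" "Z \<noteq> {}"
    and sub: "\<And>z. z \<in> Z \<Longrightarrow> P z \<subseteq> Z" "\<And>z. z \<in> Z \<Longrightarrow> N z \<subseteq> Z"
    and ne: "\<And>z. z \<in> Z \<Longrightarrow> P z \<noteq> {}" "\<And>z. z \<in> Z \<Longrightarrow> N z \<noteq> {}"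
    and comp: "\<And>z. z \<in> Z \<Longrightarrow> compact (P z)" "\<And>z. z \<in> Z \<Longrightarrow> compact (N z)"
    and P: "\<And>z y. z \<in> Z \<Longrightarrow> y \<in> P z \<Longrightarrow> P y \<union> N y \<subseteq> P z"
    and N: "\<And>z y. z \<in> Z \<Longrightarrow> y \<in> N z \<Longrightarrow> P y \<union> N y \<subseteq> N z"
  shows "\<exists>z\<in>Z. z \<in> P z \<inter> N z"
proof -
  define \<A> where "\<A> = {A. A \<subseteq> Z \<and> A \<noteq> {} \<and> compact A \<and> (\<forall>z\<in>A. P z \<union> N z \<subseteq> A)}"
  have ZA: "Z \<in> \<A>" unfolding \<A>_def using Z sub by auto
  have "\<exists>A\<in>\<A>. \<forall>B\<in>\<A>. B \<subseteq> A \<longrightarrow> B = A"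
  proof -
    \<comment> \<open>Zorn's lemma is stated for maximal sets; complements turn it into a statement on minimal ones.\<close>
    define \<B> where "\<B> = uminus ` \<A>"
    have "\<exists>M\<in>\<B>. \<forall>X\<in>\<B>. M \<subseteq> X \<longrightarrow> X = M"
    proof (rule subset_Zorn)
      fix \<C> assume "subset.chain \<B> \<C>"
      then have C: "\<C> \<subseteq> \<B>" "\<And>X Y. X \<in> \<C> \<Longrightarrow> Y \<in> \<C> \<Longrightarrow> X \<subseteq> Y \<or> Y \<subseteq> X"
        unfolding subset_chain_def by simp_all
      show "\<exists>U\<in>\<B>. \<forall>X\<in>\<C>. X \<subseteq> U"
      proof (cases "\<C> = {}")
        case True then show ?thesis using ZA \<B>_def by auto
      next
        case False
        define \<D> where "\<D> = uminus ` \<C>"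
        have D: "\<D> \<subseteq> \<A>" using C(1) unfolding \<D>_def \<B>_def by auto
        have Dch: "X \<subseteq> Y \<or> Y \<subseteq> X" if "X \<in> \<D>" "Y \<in> \<D>" for X Y
          using C(2)[of "- X" "- Y"] that unfolding \<D>_def by auto
        have Dne: "\<D> \<noteq> {}" using False \<D>_def by auto
        have fin: "\<Inter>F \<in> F" if "finite F" "F \<noteq> {}" "F \<subseteq> \<D>" for F
          using that
        proof (induction rule: finite_ne_induct)
          case (insert X F)
          have FD: "\<Inter>F \<in> \<D>" "X \<in> \<D>" "\<Inter>F \<in> F"
            using insert.IH insert.prems by (auto simp: subset_iff)
          have "X \<subseteq> \<Inter>F \<or> \<Inter>F \<subseteq> X" using Dch[OF FD(2) FD(1)] by simp
          then have "\<Inter>(insert X F) = X \<or> \<Inter>(insert X F) = \<Inter>F" by blast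
          then show ?case using FD(3) by (metis insertI1 insertI2)
        qed simp
        have DA: "X \<subseteq> Z" "closed X" "\<And>z. z \<in> X \<Longrightarrow> P z \<union> N z \<subseteq> X" if "X \<in> \<D>" for X
          using subsetD[OF D that] unfolding \<A>_def by (auto intro: compact_imp_closed)
        obtain X0 where X0: "X0 \<in> \<D>" using Dne by blast
        have "Z \<inter> \<Inter>\<D> \<noteq> {}"
        proof (rule compact_imp_fip[OF Z(1)])
          show "closed T" if "T \<in> \<D>" for T by (rule DA(2)[OF that])
          show "Z \<inter> \<Inter>F' \<noteq> {}" if "finite F'" "F' \<subseteq> \<D>" for F'
          proof (cases "F' = {}")
            case True then show ?thesis using Z by simp
          next
            case False
            have "\<Inter>F' \<in> \<A>" using fin[OF that(1) False that(2)] that(2) D by (meson subsetD)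
            then have "\<Inter>F' \<subseteq> Z" "\<Inter>F' \<noteq> {}" unfolding \<A>_def by simp_all
            then show ?thesis by (simp add: inf.absorb2)
          qed
        qed
        moreover have "\<Inter>\<D> \<subseteq> Z" using X0 DA(1)[OF X0] by (meson Inter_lower order_trans)
        moreover have "compact (\<Inter>\<D>)"
        proof -
          have "closed (\<Inter>\<D>)" by (rule closed_Inter) (use DA(2) in blast)
          then show ?thesis using compact_Int_closed[OF Z(1)] \<open>\<Inter>\<D> \<subseteq> Z\<close> by (metis inf.absorb2)
        qed
        moreover have "\<forall>z\<in>\<Inter>\<D>. P z \<union> N z \<subseteq> \<Inter>\<D>" using DA(3) by (meson InterD Inter_greatest)
        ultimately have "\<Inter>\<D> \<in> \<A>" unfolding \<A>_def by (simp add: inf.absorb2)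
        then have "- \<Inter>\<D> \<in> \<B>" unfolding \<B>_def by blast
        moreover have "\<forall>X\<in>\<C>. X \<subseteq> - \<Inter>\<D>" unfolding \<D>_def by auto
        ultimately show ?thesis by blast
      qed
    qed
    then obtain M where M: "M \<in> \<B>" "\<And>X. X \<in> \<B> \<Longrightarrow> M \<subseteq> X \<Longrightarrow> X = M" by blast
    have "- M \<in> \<A>" using M(1) unfolding \<B>_def by auto
    moreover have "B = - M" if "B \<in> \<A>" "B \<subseteq> - M" for B
      using M(2)[of "- B"] that unfolding \<B>_def by auto
    ultimately show ?thesis by blast
  qed
  then obtain A where A: "A \<in> \<A>" and min: "\<And>B. B \<in> \<A> \<Longrightarrow> B \<subseteq> A \<Longrightarrow> B = A" by blast
  then obtain z where z: "z \<in> A" unfolding \<A>_def by blast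
  have zZ: "z \<in> Z" and PA: "P z \<subseteq> A" and NA: "N z \<subseteq> A" using A z unfolding \<A>_def by auto
  have "P z \<in> \<A>" unfolding \<A>_def using zZ sub ne comp P by auto
  then have "P z = A" using min PA by blast
  moreover have "N z \<in> \<A>" unfolding \<A>_def using zZ sub ne comp N by auto
  then have "N z = A" using min NA by blast
  ultimately show ?thesis using z zZ by blast
qed

text \<open>The last step of the Arzela-Ascoli theorem. Equicontinuity is required only for late members of the
sequence, because a solution on \<open>[s\<^sub>n, \<infinity>)\<close> is controlled on \<open>[-R, R]\<close> only once \<open>s\<^sub>n \<le> -R\<close>.\<close>

lemma locally_uniform_limit_if_pointwise_on_rationals:
  fixes f :: "nat \<Rightarrow> real \<Rightarrow> 'x::complete_space"
  assumes eq: "\<And>R e. 0 < e \<Longrightarrow> \<exists>d>0. \<forall>\<^sub>F n in sequentially.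
      \<forall>s\<in>{-R..R}. \<forall>t\<in>{-R..R}. \<bar>s - t\<bar> < d \<longrightarrow> dist (f n s) (f n t) < e"
    and conv: "\<And>q. q \<in> \<rat> \<Longrightarrow> convergent (\<lambda>n. f n q)"
  shows "\<exists>u. \<forall>R. uniform_limit {-R..R} f u sequentially"
proof -
  have UC: "uniformly_Cauchy_on {-R..R} f" for R
  proof (rule uniformly_Cauchy_onI)
    fix e :: real assume e: "0 < e"
    then have e3: "0 < e / 3" by simp
    obtain d where d: "0 < d" and ev: "\<forall>\<^sub>F n in sequentially.
      \<forall>s\<in>{-(R+1)..R+1}. \<forall>t\<in>{-(R+1)..R+1}. \<bar>s - t\<bar> < d \<longrightarrow> dist (f n s) (f n t) < e/3"
      using eq[OF e3, of "R+1"] by blast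
    define d' where "d' = min d 1"
    have d': "0 < d'" using d d'_def by simp
    have "compact {-R..R}" by simp
    moreover have "{-R..R} \<subseteq> (\<Union>q\<in>\<rat>. ball q d')"
    proof
      fix t assume "t \<in> {-R..R}"
      obtain q where "q \<in> \<rat>" "t - d' < q" "q < t" using Rats_dense_in_real[of "t - d'" t] d' by auto
      then show "t \<in> (\<Union>q\<in>\<rat>. ball q d')" by (auto simp: dist_real_def intro!: bexI[of _ q])
    qed
    ultimately obtain Q where Q: "Q \<subseteq> \<rat>" "finite Q" "{-R..R} \<subseteq> (\<Union>q\<in>Q. ball q d')"
      using compactE_image[of "{-R..R}" \<rat> "\<lambda>q. ball q d'"] by auto
    have "\<forall>q\<in>Q. \<exists>N. \<forall>m\<ge>N. \<forall>n\<ge>N. dist (f m q) (f n q) < e/3"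
      using metric_CauchyD[OF convergent_Cauchy[OF conv] e3] Q(1) by blast
    then obtain N where N: "\<And>q m n. q \<in> Q \<Longrightarrow> m \<ge> N q \<Longrightarrow> n \<ge> N q \<Longrightarrow> dist (f m q) (f n q) < e/3" by metis
    obtain N0 where N0: "\<And>n s t. n \<ge> N0 \<Longrightarrow> s\<in>{-(R+1)..R+1} \<Longrightarrow> t\<in>{-(R+1)..R+1} \<Longrightarrow> \<bar>s - t\<bar> < d \<Longrightarrow> dist (f n s) (f n t) < e/3"
      using ev unfolding eventually_sequentially by blast
    define N1 where "N1 = Max (insert N0 (N ` Q))"
    have N1: "N0 \<le> N1" "\<And>q. q \<in> Q \<Longrightarrow> N q \<le> N1" using Q(2) unfolding N1_def by auto
    have "dist (f m t) (f n t) < e" if t: "t \<in> {-R..R}" and mn: "m \<ge> N1" "n \<ge> N1" for t m n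
    proof -
      obtain q where q: "q \<in> Q" "\<bar>q - t\<bar> < d'" using Q(3) t by (auto simp: dist_real_def)
      have qR: "q \<in> {-(R+1)..R+1}" "t \<in> {-(R+1)..R+1}" using q t unfolding d'_def by auto
      have "dist (f m q) (f m t) < e/3" "dist (f n q) (f n t) < e/3"
        using N0[OF _ qR] mn N1(1) q(2) unfolding d'_def by auto
      moreover have "dist (f m q) (f n q) < e/3" using N[OF q(1)] N1(2)[OF q(1)] mn by auto
      ultimately show ?thesis
        using dist_triangle[of "f m t" "f n t" "f m q"] dist_triangle[of "f m q" "f n t" "f n q"]
        by (simp add: dist_commute)
    qed
    then show "\<exists>M. \<forall>x\<in>{-R..R}. \<forall>m\<ge>M. \<forall>n\<ge>M. dist (f m x) (f n x) < e" by blast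
  qed
  have lim: "\<exists>l. uniform_limit {-R..R} f l sequentially" for R
    using UC[THEN Cauchy_uniformly_convergent] unfolding uniformly_convergent_on_def by blast
  define u where "u t = Topological_Spaces.lim (\<lambda>n. f n t)" for t
  have "uniform_limit {-R..R} f u sequentially" for R
  proof -
    obtain l where l: "uniform_limit {-R..R} f l sequentially" using lim by blast
    have "l t = u t" if "t \<in> {-R..R}" for t
      unfolding u_def using tendsto_uniform_limitI[OF l that] limI by metis
    then show ?thesis using l by (metis (no_types, lifting) uniform_limit_cong')
  qed
  then show ?thesis by blast
qed

section \<open>The Navier-Stokes equations over abstract Hilbert spaces\<close>

lemma tendsto_fun_pointwise:
  fixes f :: "'n \<Rightarrow> 'i \<Rightarrow> 'x::topological_space"
  assumes "\<And>i. ((\<lambda>n. f n i) \<longlongrightarrow> l i) G"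
  shows "(f \<longlongrightarrow> l) G"
proof -
  have "limitin (product_topology (\<lambda>_. euclidean) UNIV) f l G"
    unfolding limitin_componentwise using assms by auto
  then show ?thesis by (simp add: euclidean_product_topology)
qed

lemma has_bochner_integral_shift:
  fixes f :: "real \<Rightarrow> real"
  assumes "has_bochner_integral (lebesgue_on {a+t..b+t}) f i"
  shows "has_bochner_integral (lebesgue_on {a..b}) (\<lambda>x. f (x + t)) i"
proof -
  have "has_bochner_integral lebesgue (\<lambda>x. indicator {a+t..b+t} x *\<^sub>R f x) i"
    using assms by (simp add: has_bochner_integral_restrict_space)
  then have "has_bochner_integral lebesgue (\<lambda>x. indicator {a+t..b+t} (t + 1 * x) *\<^sub>R f (t + 1 * x)) (i /\<^sub>R \<bar>1\<bar>)"
    by (subst (asm) has_bochner_integral_lebesgue_real_affine_iff[of 1 _ _ t]) auto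
  then have "has_bochner_integral lebesgue (\<lambda>x. indicator {a..b} x *\<^sub>R f (x + t)) i"
    by (simp add: indicator_def of_bool_def add.commute)
  then show ?thesis by (simp add: has_bochner_integral_restrict_space)
qed

text \<open>The structure of the weak formulation that the compactness argument uses. \<open>\<G>\<close> is the graph of the
gradient on \<open>V\<close>, a subspace of \<open>H \<times> L\<^sup>2\<close> (\<open>graph_compact\<close> is Rellich's theorem), and \<open>T u w\<close> stands for the tensor
\<open>w \<otimes> u\<close>, so that \<open>\<langle>B(u,u),w\<rangle>\<close> is \<open>grad u \<bullet> T u w\<close>. The bound on \<open>T\<close> is Ladyzhenskaya's inequality.\<close>

locale navier_stokes_form =
  fixes \<G> :: "('x::{real_inner,complete_space} \<times> 'y::{real_inner,complete_space}) set"
    and T :: "'x \<Rightarrow> 'x \<Rightarrow> 'y" and C \<nu> :: real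
  assumes graph_closed: "closed \<G>" and graph_subspace: "subspace \<G>"
    and graph_single_0: "\<And>b. (0, b) \<in> \<G> \<Longrightarrow> b = 0"
    and graph_compact: "\<And>M. compact (closure {u. \<exists>a. (u, a) \<in> \<G> \<and> norm u \<le> M \<and> norm a \<le> M})"
    and T_diff: "\<And>u u' w a a' b. (u, a) \<in> \<G> \<Longrightarrow> (u', a') \<in> \<G> \<Longrightarrow> (w, b) \<in> \<G> \<Longrightarrow> T (u - u') w = T u w - T u' w"
    and T_bound: "\<And>u a w b. (u, a) \<in> \<G> \<Longrightarrow> (w, b) \<in> \<G> \<Longrightarrow>
        (norm (T u w))\<^sup>2 \<le> C * norm u * norm a * (norm w * norm b)"
    and C_nonneg: "0 \<le> C"
begin

definition grad :: "'x \<Rightarrow> 'y" where "grad u = (THE a. (u, a) \<in> \<G>)"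

definition V_bdd :: "real \<Rightarrow> 'x \<Rightarrow> bool" where
  "V_bdd M u \<longleftrightarrow> (u, grad u) \<in> \<G> \<and> norm u \<le> M \<and> norm (grad u) \<le> M"

definition rhs :: "'x \<Rightarrow> 'x \<Rightarrow> 'x \<Rightarrow> real" where
  "rhs f u w = f \<bullet> w - \<nu> * (grad u \<bullet> grad w) - grad u \<bullet> T u w"

text \<open>A weak solution on \<open>[s, \<infinity>)\<close> whose values lie in the ball of radius \<open>M\<close> of \<open>V\<close> at all times. For bounded solutions
the \<open>V\<close>-regularity holds at every time and not only at almost every time, since balls of \<open>V\<close> are closed
in \<open>H\<close> (\<open>V_bdd_limit\<close>).\<close>

definition bdd_sol :: "real \<Rightarrow> (real \<Rightarrow> 'x) \<Rightarrow> real \<Rightarrow> (real \<Rightarrow> 'x) \<Rightarrow> bool" where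
  "bdd_sol M F s u \<longleftrightarrow> continuous_on {s..} u \<and> (\<forall>t\<ge>s. V_bdd M (u t)) \<and>
     (\<forall>w a b. (w, grad w) \<in> \<G> \<longrightarrow> s \<le> a \<longrightarrow> a \<le> b \<longrightarrow>
        has_bochner_integral (lebesgue_on {a..b}) (\<lambda>t. rhs (F t) (u t) w) (u b \<bullet> w - u a \<bullet> w))"

lemma graph_single: "(u, a) \<in> \<G> \<Longrightarrow> (u, b) \<in> \<G> \<Longrightarrow> a = b"
  using subspace_diff[OF graph_subspace, of "(u, a)" "(u, b)"] graph_single_0[of "a - b"] by simp

lemma grad_eq: "(u, a) \<in> \<G> \<Longrightarrow> grad u = a"
  unfolding grad_def by (rule the_equality) (auto intro: graph_single)

lemma graph_diff: "(u, a) \<in> \<G> \<Longrightarrow> (v, b) \<in> \<G> \<Longrightarrow> (u - v, a - b) \<in> \<G>"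
  using subspace_diff[OF graph_subspace, of "(u, a)" "(v, b)"] by simp

text \<open>The gradients are bounded, and all their weak limit points lie over \<open>u0\<close> in the closed graph, hence are equal to
\<open>grad u0\<close>. Weak limits keep norm bounds, and so the ball of \<open>V\<close> is closed in \<open>H\<close>.\<close>

lemma V_bdd_limit:
  assumes "\<And>n. V_bdd M (u n)" "u \<longlonglongrightarrow> u0"
  shows "V_bdd M u0" "(\<lambda>n. grad (u n) \<bullet> h) \<longlonglongrightarrow> grad u0 \<bullet> h"
proof -
  have "\<exists>g0. (u0, g0) \<in> \<G> \<and> norm g0 \<le> M \<and> (\<forall>h. (\<lambda>n. grad (u n) \<bullet> h) \<longlonglongrightarrow> g0 \<bullet> h)"
  proof (rule graph_weak_limit)
    show "convex \<G>" using graph_subspace by (rule subspace_imp_convex)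
    show "closed \<G>" by (rule graph_closed)
    show "a = b" if "(u, a) \<in> \<G>" "(u, b) \<in> \<G>" for u a b by (rule graph_single[OF that])
    show "(u n, grad (u n)) \<in> \<G>" "norm (grad (u n)) \<le> M" for n using assms(1)[of n] by (auto simp: V_bdd_def)
    show "u \<longlonglongrightarrow> u0" by (rule assms(2))
  qed
  then obtain g0 where g0: "(u0, g0) \<in> \<G>" "norm g0 \<le> M" "\<And>h. (\<lambda>n. grad (u n) \<bullet> h) \<longlonglongrightarrow> g0 \<bullet> h" by blast
  have "norm u0 \<le> M"
    by (rule LIMSEQ_le_const2[OF tendsto_norm[OF assms(2)]]) (use assms(1) in \<open>auto simp: V_bdd_def\<close>)
  then show "V_bdd M u0" "(\<lambda>n. grad (u n) \<bullet> h) \<longlonglongrightarrow> grad u0 \<bullet> h"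
    using g0 grad_eq[OF g0(1)] by (auto simp: V_bdd_def)
qed

lemma V_bdd_diff: "V_bdd M u \<Longrightarrow> V_bdd N v \<Longrightarrow> V_bdd (M + N) (u - v)"
proof -
  assume *: "V_bdd M u" "V_bdd N v"
  then have "(u - v, grad u - grad v) \<in> \<G>" by (intro graph_diff) (auto simp: V_bdd_def)
  then show ?thesis using * norm_triangle_ineq4[of u v] norm_triangle_ineq4[of "grad u" "grad v"] grad_eq
    by (auto simp: V_bdd_def)
qed

lemma norm_T_le: "V_bdd M u \<Longrightarrow> V_bdd R w \<Longrightarrow> norm (T u w) \<le> sqrt C * M * R"
proof -
  assume *: "V_bdd M u" "V_bdd R w"
  have M: "0 \<le> M" "0 \<le> R" using * norm_ge_zero[of u] norm_ge_zero[of w] unfolding V_bdd_def by linarith+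
  have "(norm (T u w))\<^sup>2 \<le> C * norm u * norm (grad u) * (norm w * norm (grad w))"
    using * by (intro T_bound) (auto simp: V_bdd_def)
  also have "\<dots> \<le> C * M * M * (R * R)"
    using * M C_nonneg by (intro mult_mono mult_nonneg_nonneg) (auto simp: V_bdd_def)
  also have "\<dots> = (sqrt C)\<^sup>2 * M\<^sup>2 * R\<^sup>2"
    unfolding real_sqrt_pow2[OF C_nonneg] by (simp add: power2_eq_square)
  also have "\<dots> = (sqrt C * M * R)\<^sup>2" by (simp only: power_mult_distrib)
  finally show ?thesis by (rule power2_le_imp_le) (use M C_nonneg in simp)
qed

lemma rhs_bound:
  assumes "V_bdd M u" "V_bdd R w" "norm f \<le> K"
  shows "\<bar>rhs f u w\<bar> \<le> (K + \<bar>\<nu>\<bar> * M + M * (sqrt C * M)) * R"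
proof -
  have M: "0 \<le> M" "0 \<le> R" "0 \<le> K"
    using assms norm_ge_zero[of u] norm_ge_zero[of w] norm_ge_zero[of f] unfolding V_bdd_def by linarith+
  have "\<bar>f \<bullet> w\<bar> \<le> K * R"
    by (rule order_trans[OF Cauchy_Schwarz_ineq2 mult_mono]) (use assms M in \<open>auto simp: V_bdd_def\<close>)
  moreover have "\<bar>grad u \<bullet> grad w\<bar> \<le> M * R"
    by (rule order_trans[OF Cauchy_Schwarz_ineq2 mult_mono]) (use assms M in \<open>auto simp: V_bdd_def\<close>)
  then have "\<bar>\<nu> * (grad u \<bullet> grad w)\<bar> \<le> \<bar>\<nu>\<bar> * (M * R)" by (simp add: abs_mult mult_left_mono)
  moreover have "\<bar>grad u \<bullet> T u w\<bar> \<le> M * (sqrt C * M * R)"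
    by (rule order_trans[OF Cauchy_Schwarz_ineq2 mult_mono]) (use assms M norm_T_le in \<open>auto simp: V_bdd_def\<close>)
  ultimately have "\<bar>rhs f u w\<bar> \<le> K * R + \<bar>\<nu>\<bar> * (M * R) + M * (sqrt C * M * R)"
    unfolding rhs_def by linarith
  then show ?thesis by (simp add: algebra_simps)
qed

text \<open>The convection term \<open>grad (u n) \<bullet> T (u n) w\<close> pairs a weakly convergent factor with a strongly convergent one.
The second factor converges strongly because the bound on \<open>T (u n - u0) w\<close> contains the factor
\<open>norm (u n - u0)\<close>, while the gradient of the difference stays bounded.\<close>

lemma rhs_tendsto:
  assumes u: "\<And>n. V_bdd M (u n)" "u \<longlonglongrightarrow> u0" and f: "f \<longlonglongrightarrow> f0" and w: "(w, grad w) \<in> \<G>"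
  shows "(\<lambda>n. rhs (f n) (u n) w) \<longlonglongrightarrow> rhs f0 u0 w"
proof -
  have u0: "V_bdd M u0" using V_bdd_limit(1)[OF u] .
  note weak = V_bdd_limit(2)[OF u]
  have Tdiff: "T (u n) w - T u0 w = T (u n - u0) w" for n
    using u(1)[of n] u0 w by (subst T_diff) (auto simp: V_bdd_def)
  define b where "b n = C * norm (u n - u0) * (M + M) * (norm w * norm (grad w))" for n
  have "b \<longlonglongrightarrow> C * norm (u0 - u0) * (M + M) * (norm w * norm (grad w))"
    unfolding b_def by (intro tendsto_intros u(2))
  then have b: "b \<longlonglongrightarrow> 0" by simp
  have "(norm (T (u n) w - T u0 w))\<^sup>2 \<le> b n" for n
  proof -
    have d: "V_bdd (M + M) (u n - u0)" using V_bdd_diff[OF u(1) u0] .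
    then have "(norm (T (u n - u0) w))\<^sup>2 \<le> C * norm (u n - u0) * norm (grad (u n - u0)) * (norm w * norm (grad w))"
      by (intro T_bound w) (auto simp: V_bdd_def)
    also have "\<dots> \<le> b n" unfolding b_def
      using d C_nonneg by (intro mult_right_mono mult_left_mono) (auto simp: V_bdd_def)
    finally show ?thesis unfolding Tdiff .
  qed
  then have "(\<lambda>n. (norm (T (u n) w - T u0 w))\<^sup>2) \<longlonglongrightarrow> 0"
    by (intro tendsto_sandwich[OF _ _ tendsto_const b]) auto
  then have "(\<lambda>n. sqrt ((norm (T (u n) w - T u0 w))\<^sup>2)) \<longlonglongrightarrow> sqrt 0" by (rule tendsto_real_sqrt)
  then have T0: "(\<lambda>n. norm (T (u n) w - T u0 w)) \<longlonglongrightarrow> 0" by simp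
  have "(\<lambda>n. grad (u n) \<bullet> (T (u n) w - T u0 w)) \<longlonglongrightarrow> 0"
  proof (rule tendsto_rabs_zero_cancel, rule tendsto_sandwich[OF _ _ tendsto_const])
    show "\<forall>\<^sub>F n in sequentially. \<bar>grad (u n) \<bullet> (T (u n) w - T u0 w)\<bar> \<le> M * norm (T (u n) w - T u0 w)"
      by (intro always_eventually allI order_trans[OF Cauchy_Schwarz_ineq2 mult_right_mono])
         (use u(1) in \<open>auto simp: V_bdd_def\<close>)
    show "(\<lambda>n. M * norm (T (u n) w - T u0 w)) \<longlonglongrightarrow> 0" using tendsto_mult_right_zero[OF T0] by simp
  qed auto
  from tendsto_add[OF this weak[of "T u0 w"]]
  have "(\<lambda>n. grad (u n) \<bullet> T (u n) w) \<longlonglongrightarrow> grad u0 \<bullet> T u0 w" by (simp add: inner_diff_right)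
  moreover have "(\<lambda>n. \<nu> * (grad (u n) \<bullet> grad w)) \<longlonglongrightarrow> \<nu> * (grad u0 \<bullet> grad w)" by (rule tendsto_mult_left[OF weak])
  moreover have "(\<lambda>n. f n \<bullet> w) \<longlonglongrightarrow> f0 \<bullet> w" by (intro tendsto_intros f)
  ultimately show ?thesis unfolding rhs_def by (intro tendsto_diff)
qed

text \<open>The increment \<open>w = u b - u a\<close> is an admissible test function, and the left-hand side of the equation tested with it
is \<open>(norm w)\<^sup>2\<close>. The right-hand side is bounded uniformly in time.\<close>

lemma bdd_sol_increment:
  assumes sol: "bdd_sol M F s u" and ab: "s \<le> a" "a \<le> b" and K: "\<And>t. t \<in> {a..b} \<Longrightarrow> norm (F t) \<le> K"
  shows "(norm (u b - u a))\<^sup>2 \<le> (K + \<bar>\<nu>\<bar> * M + M * (sqrt C * M)) * (M + M) * (b - a)"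
proof -
  define w where "w = u b - u a"
  have bt: "V_bdd M (u t)" if "t \<ge> s" for t using sol that unfolding bdd_sol_def by blast
  have w: "V_bdd (M + M) w" unfolding w_def by (rule V_bdd_diff) (use bt ab in auto)
  define B where "B = (K + \<bar>\<nu>\<bar> * M + M * (sqrt C * M)) * (M + M)"
  have "has_bochner_integral (lebesgue_on {a..b}) (\<lambda>t. rhs (F t) (u t) w) (u b \<bullet> w - u a \<bullet> w)"
    using sol ab w unfolding bdd_sol_def V_bdd_def by blast
  then have int: "integrable (lebesgue_on {a..b}) (\<lambda>t. rhs (F t) (u t) w)"
    and eq: "integral\<^sup>L (lebesgue_on {a..b}) (\<lambda>t. rhs (F t) (u t) w) = u b \<bullet> w - u a \<bullet> w"
    by (auto simp: has_bochner_integral_iff)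
  have fin: "finite_measure (lebesgue_on {a..b})" by (rule finite_measure_lebesgue_on) simp
  have "norm (integral\<^sup>L (lebesgue_on {a..b}) (\<lambda>t. rhs (F t) (u t) w)) \<le> integral\<^sup>L (lebesgue_on {a..b}) (\<lambda>t. B)"
  proof (rule Bochner_Integration.integral_norm_bound_integral[OF int])
    show "integrable (lebesgue_on {a..b}) (\<lambda>t. B)" using fin by (simp add: finite_measure.integrable_const)
    show "norm (rhs (F t) (u t) w) \<le> B" if "t \<in> space (lebesgue_on {a..b})" for t
      using rhs_bound[OF bt w K, of t t] that ab unfolding B_def by simp
  qed
  also have "\<dots> = B * (b - a)" using ab by (simp add: measure_restrict_space)
  finally have "u b \<bullet> w - u a \<bullet> w \<le> B * (b - a)" unfolding eq by simp
  moreover have "u b \<bullet> w - u a \<bullet> w = (norm w)\<^sup>2"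
    unfolding w_def by (simp add: power2_norm_eq_inner inner_diff_left inner_diff_right inner_commute)
  ultimately show ?thesis unfolding w_def B_def by simp
qed

lemma bdd_sol_shift:
  assumes "bdd_sol M F s u"
  shows "bdd_sol M (\<lambda>r. F (r + t)) (s - t) (\<lambda>r. u (r + t))"
  unfolding bdd_sol_def
proof (intro conjI allI impI)
  show "continuous_on {s - t..} (\<lambda>r. u (r + t))"
    by (rule continuous_on_compose2[of "{s..}" u]) (use assms in \<open>auto simp: bdd_sol_def intro!: continuous_intros\<close>)
  show "V_bdd M (u (r + t))" if "s - t \<le> r" for r using assms that unfolding bdd_sol_def by auto
  show "has_bochner_integral (lebesgue_on {a..b}) (\<lambda>r. rhs (F (r + t)) (u (r + t)) w) (u (b + t) \<bullet> w - u (a + t) \<bullet> w)"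
    if "(w, grad w) \<in> \<G>" "s - t \<le> a" "a \<le> b" for w a b
    by (rule has_bochner_integral_shift) (use assms that in \<open>auto simp: bdd_sol_def\<close>)
qed

section \<open>Compactness of bounded solutions\<close>

text \<open>On \<open>[-R, R]\<close> late forcings differ from the bounded function \<open>F0\<close> by less than \<open>1\<close>, so the constant in
\<open>bdd_sol_increment\<close> can be chosen independently of \<open>n\<close>. The same constant \<open>L\<close> also bounds the forcings, which
the dominated convergence in \<open>bdd_sols_compact\<close> uses.\<close>

lemma solutions_equicontinuous:
  fixes F :: "nat \<Rightarrow> real \<Rightarrow> 'x"
  assumes F_lim: "uniform_limit {-R..R} F F0 sequentially" and F0: "continuous_on UNIV F0"
    and s: "filterlim s at_bot sequentially" and sol: "\<And>n. bdd_sol M (F n) (s n) (u n)"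
  shows "\<exists>L\<ge>0. \<forall>\<^sub>F n in sequentially. s n \<le> -R \<and> (\<forall>t\<in>{-R..R}. norm (F n t) \<le> L) \<and>
    (\<forall>a\<in>{-R..R}. \<forall>b\<in>{-R..R}. (norm (u n b - u n a))\<^sup>2 \<le> L * \<bar>b - a\<bar>)"
proof -
  have "V_bdd M (u 0 (s 0))" using sol[of 0] unfolding bdd_sol_def by blast
  then have M: "0 \<le> M" using norm_ge_zero[of "u 0 (s 0)"] unfolding V_bdd_def by linarith
  have "bounded (F0 ` {-R..R})"
    by (intro compact_imp_bounded compact_continuous_image continuous_on_subset[OF F0]) auto
  then obtain K0 where K0: "\<And>t. t \<in> {-R..R} \<Longrightarrow> norm (F0 t) \<le> K0" "0 < K0"
    unfolding bounded_pos by blast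
  define K where "K = K0 + 1"
  define B where "B = (K + \<bar>\<nu>\<bar> * M + M * (sqrt C * M)) * (M + M)"
  have B: "0 \<le> B" unfolding B_def K_def using K0(2) M C_nonneg by simp
  have ev1: "\<forall>\<^sub>F n in sequentially. \<forall>t\<in>{-R..R}. dist (F n t) (F0 t) < 1"
    using F_lim unfolding uniform_limit_iff by simp
  have ev2: "\<forall>\<^sub>F n in sequentially. s n \<le> -R" using s unfolding filterlim_at_bot by blast
  have "\<forall>\<^sub>F n in sequentially. s n \<le> -R \<and> (\<forall>t\<in>{-R..R}. norm (F n t) \<le> max K B) \<and>
    (\<forall>a\<in>{-R..R}. \<forall>b\<in>{-R..R}. (norm (u n b - u n a))\<^sup>2 \<le> max K B * \<bar>b - a\<bar>)"
    using ev1 ev2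
  proof eventually_elim
    case (elim n)
    have FK: "norm (F n t) \<le> K" if "t \<in> {-R..R}" for t
    proof -
      have "norm (F n t) \<le> norm (F0 t) + dist (F n t) (F0 t)"
        by (simp add: dist_norm norm_triangle_sub)
      moreover have "dist (F n t) (F0 t) < 1" using elim(1) that by blast
      ultimately show ?thesis using K0(1)[OF that] unfolding K_def by linarith
    qed
    have inc: "(norm (u n b - u n a))\<^sup>2 \<le> B * (b - a)" if "a \<in> {-R..R}" "b \<in> {-R..R}" "a \<le> b" for a b
      unfolding B_def by (rule bdd_sol_increment[OF sol[of n]]) (use that elim(2) FK in auto)
    have mx: "B * \<bar>b - a\<bar> \<le> max K B * \<bar>b - a\<bar>" for a b by (intro mult_right_mono) auto
    have "(norm (u n b - u n a))\<^sup>2 \<le> max K B * \<bar>b - a\<bar>" if ab: "a \<in> {-R..R}" "b \<in> {-R..R}" for a b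
    proof (cases "a \<le> b")
      case True
      then show ?thesis using inc[OF ab True] mx[of b a] by simp
    next
      case False
      have e: "\<bar>b - a\<bar> = a - b" using False by simp
      have "(norm (u n a - u n b))\<^sup>2 \<le> max K B * (a - b)"
        by (rule order_trans[OF inc[OF ab(2,1)] mult_right_mono]) (use False in auto)
      then show ?thesis unfolding e by (simp add: norm_minus_commute)
    qed
    moreover have "norm (F n t) \<le> max K B" if "t \<in> {-R..R}" for t using FK[OF that] by simp
    ultimately show ?case using elim(2) by blast
  qed
  moreover have "0 \<le> max K B" using B by simp
  ultimately show ?thesis by blast
qed

text \<open>At each fixed time all late solutions take their values in the relatively compact ball of \<open>V\<close>; a diagonal
sequence serves all rational times.\<close>

lemma convergent_subsequence_at_rationals:
  assumes s: "filterlim s at_bot sequentially" and sol: "\<And>n. bdd_sol M (F n) (s n) (u n)"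
  shows "\<exists>r::nat \<Rightarrow> nat. strict_mono r \<and> (\<forall>q\<in>\<rat>. convergent (\<lambda>n. u (r n) q))"
proof -
  define q where "q = from_nat_into (\<rat>::real set)"
  define K where "K = closure {v. \<exists>a. (v, a) \<in> \<G> \<and> norm v \<le> M \<and> norm a \<le> M}"
  have K: "compact K" unfolding K_def by (rule graph_compact)
  define P where "P k \<sigma> = convergent (\<lambda>n. u (\<sigma> n) (q k))" for k and \<sigma> :: "nat \<Rightarrow> nat"
  have "\<exists>r'. strict_mono r' \<and> P k (\<sigma> \<circ> r')" if \<sigma>: "strict_mono \<sigma>" for k and \<sigma> :: "nat \<Rightarrow> nat"
  proof -
    have "filterlim (\<lambda>n. s (\<sigma> n)) at_bot sequentially"
      by (rule filterlim_compose[OF s filterlim_subseq[OF \<sigma>]])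
    then have "\<forall>\<^sub>F n in sequentially. s (\<sigma> n) \<le> q k" unfolding filterlim_at_bot by blast
    then obtain N where N: "\<And>n. n \<ge> N \<Longrightarrow> s (\<sigma> n) \<le> q k" unfolding eventually_sequentially by blast
    have "u (\<sigma> (n + N)) (q k) \<in> K" for n
    proof -
      have "V_bdd M (u (\<sigma> (n + N)) (q k))" using sol[of "\<sigma> (n + N)"] N[of "n + N"] unfolding bdd_sol_def by simp
      then show ?thesis unfolding K_def V_bdd_def by (intro subsetD[OF closure_subset]) blast
    qed
    then obtain l r where r: "strict_mono r" "((\<lambda>n. u (\<sigma> (n + N)) (q k)) \<circ> r) \<longlonglongrightarrow> l"
      using compact_imp_seq_compact[OF K] unfolding seq_compact_def by meson
    have "strict_mono (\<lambda>n. r n + N)" using r(1) by (simp add: strict_mono_def)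
    moreover have "P k (\<sigma> \<circ> (\<lambda>n. r n + N))" using r(2) unfolding P_def convergent_def by (auto simp: o_def)
    ultimately show ?thesis by blast
  qed
  then interpret subseqs P by unfold_locales
  have "convergent (\<lambda>n. u (diagseq n) (q k))" for k
  proof -
    have "P k (diagseq \<circ> (+) (Suc k))"
    proof (rule diagseq_holds)
      fix r s :: "nat \<Rightarrow> nat" and n
      assume "strict_mono r" "P n s"
      then show "P n (s \<circ> r)" unfolding P_def
        using convergent_subseq_convergent[of "\<lambda>m. u (s m) (q n)" r] by (simp add: o_def)
    qed
    then have "convergent (\<lambda>n. u (diagseq (n + Suc k)) (q k))"
      unfolding P_def by (simp add: o_def add.commute)
    then show ?thesis using convergent_ignore_initial_segment[of "\<lambda>n. u (diagseq n) (q k)" "Suc k"] by blast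
  qed
  moreover have "\<exists>k. q k = x" if "x \<in> \<rat>" for x
    unfolding q_def using from_nat_into_surj[OF countable_rat that] by blast
  ultimately show ?thesis using subseq_diagseq by metis
qed

text \<open>Equicontinuity and convergence at rational times give a locally uniform limit, which is an entire solution because the
half-lines on which the solutions live grow to the whole line. The equation passes to the limit by \<open>rhs_tendsto\<close> at each time and dominated convergence in time.\<close>

theorem bdd_sols_compact:
  fixes F :: "nat \<Rightarrow> real \<Rightarrow> 'x"
  assumes F_lim: "\<And>R. uniform_limit {-R..R} F F0 sequentially" and F0: "continuous_on UNIV F0"
    and s: "filterlim s at_bot sequentially" and sol: "\<And>n. bdd_sol M (F n) (s n) (u n)"
  shows "\<exists>r v. strict_mono (r::nat \<Rightarrow> nat) \<and> (\<forall>R. uniform_limit {-R..R} (\<lambda>n. u (r n)) v sequentially) \<and>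
    (\<forall>s. bdd_sol M F0 s v)"
proof -
  obtain r :: "nat \<Rightarrow> nat" where r: "strict_mono r" and conv: "\<And>q. q \<in> \<rat> \<Longrightarrow> convergent (\<lambda>n. u (r n) q)"
    using convergent_subsequence_at_rationals[OF s sol] by blast
  have fr: "filterlim r sequentially sequentially" by (rule filterlim_subseq[OF r])
  note equi = solutions_equicontinuous[OF F_lim F0 s sol]
  have eq: "\<exists>L\<ge>0. \<forall>\<^sub>F n in sequentially. s (r n) \<le> -R \<and> (\<forall>t\<in>{-R..R}. norm (F (r n) t) \<le> L) \<and>
    (\<forall>a\<in>{-R..R}. \<forall>b\<in>{-R..R}. (norm (u (r n) b - u (r n) a))\<^sup>2 \<le> L * \<bar>b - a\<bar>)" for R
  proof -
    obtain L where L: "L \<ge> 0" and ev: "\<forall>\<^sub>F n in sequentially. s n \<le> -R \<and> (\<forall>t\<in>{-R..R}. norm (F n t) \<le> L) \<and>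
    (\<forall>a\<in>{-R..R}. \<forall>b\<in>{-R..R}. (norm (u n b - u n a))\<^sup>2 \<le> L * \<bar>b - a\<bar>)" using equi[of R] by blast
    show ?thesis using L eventually_compose_filterlim[OF ev fr] by blast
  qed
  have "\<exists>v. \<forall>R. uniform_limit {-R..R} (\<lambda>n. u (r n)) v sequentially"
  proof (rule locally_uniform_limit_if_pointwise_on_rationals)
    show "convergent (\<lambda>n. u (r n) q)" if "q \<in> \<rat>" for q by (rule conv[OF that])
    fix R e :: real assume e: "0 < e"
    obtain L where L: "L \<ge> 0" and ev: "\<forall>\<^sub>F n in sequentially. s (r n) \<le> -R \<and> (\<forall>t\<in>{-R..R}. norm (F (r n) t) \<le> L) \<and>
    (\<forall>a\<in>{-R..R}. \<forall>b\<in>{-R..R}. (norm (u (r n) b - u (r n) a))\<^sup>2 \<le> L * \<bar>b - a\<bar>)" using eq[of R] by blast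
    \<comment> \<open>The modulus of continuity of the square root; the summand \<open>1\<close> covers \<open>L = 0\<close>.\<close>
    define d where "d = e\<^sup>2 / (L + 1)"
    have d: "0 < d" using e L unfolding d_def by simp
    have "\<forall>\<^sub>F n in sequentially. \<forall>a\<in>{-R..R}. \<forall>b\<in>{-R..R}. \<bar>a - b\<bar> < d \<longrightarrow> dist (u (r n) a) (u (r n) b) < e"
      using ev
    proof eventually_elim
      case (elim n)
      show ?case
      proof (intro ballI impI)
        fix a b assume ab: "a \<in> {-R..R}" "b \<in> {-R..R}" "\<bar>a - b\<bar> < d"
        have "(norm (u (r n) a - u (r n) b))\<^sup>2 \<le> L * \<bar>a - b\<bar>" using elim ab(1,2) by blast
        also have "\<dots> \<le> (L + 1) * \<bar>a - b\<bar>" by (intro mult_right_mono) auto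
        also have "\<dots> < (L + 1) * d" using ab(3) L by (intro mult_strict_left_mono) auto
        also have "\<dots> = e\<^sup>2" unfolding d_def using L by simp
        finally show "dist (u (r n) a) (u (r n) b) < e"
          unfolding dist_norm by (rule power_less_imp_less_base) (use e in simp)
      qed
    qed
    then show "\<exists>d>0. \<forall>\<^sub>F n in sequentially. \<forall>a\<in>{-R..R}. \<forall>b\<in>{-R..R}. \<bar>a - b\<bar> < d \<longrightarrow> dist (u (r n) a) (u (r n) b) < e"
      using d by blast
  qed
  then obtain v where v: "\<And>R. uniform_limit {-R..R} (\<lambda>n. u (r n)) v sequentially" by blast
  have vt: "(\<lambda>n. u (r n) t) \<longlonglongrightarrow> v t" for t
    by (rule tendsto_uniform_limitI[OF v[of "\<bar>t\<bar>"]]) auto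
  have Ft: "(\<lambda>n. F (r n) t) \<longlonglongrightarrow> F0 t" for t
    by (rule filterlim_compose[OF tendsto_uniform_limitI[OF F_lim[of "\<bar>t\<bar>"]] fr]) auto
  have evR: "\<exists>N. \<forall>n\<ge>N. s (r n) \<le> -R" for R
    using eq[of R] unfolding eventually_sequentially by blast
  have bv: "V_bdd M (v t)" for t
  proof -
    obtain N where N: "\<And>n. n \<ge> N \<Longrightarrow> s (r n) \<le> - (-t)" using evR[of "- t"] by blast
    have "V_bdd M (u (r (n + N)) t)" for n
      using sol[of "r (n + N)"] N[of "n + N"] unfolding bdd_sol_def by simp
    then show ?thesis by (rule V_bdd_limit(1)[OF _ LIMSEQ_ignore_initial_segment[OF vt]])
  qed
  have cv: "continuous_on UNIV v"
  proof -
    have "continuous_on (\<Union>k::nat. {-real k<..<real k}) v"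
    proof (rule continuous_on_open_UN)
      fix k :: nat
      have "continuous_on {-real k..real k} v"
      proof (rule uniform_limit_theorem[OF _ v])
        obtain N where N: "\<And>n. n \<ge> N \<Longrightarrow> s (r n) \<le> - real k" using evR[of "real k"] by blast
        have "continuous_on {-real k..real k} (u (r n))" if "n \<ge> N" for n
          using sol[of "r n"] N[OF that] unfolding bdd_sol_def by (auto elim!: continuous_on_subset)
        then show "\<forall>\<^sub>F n in sequentially. continuous_on {-real k..real k} (u (r n))"
          unfolding eventually_sequentially by blast
      qed simp
      then show "continuous_on {-real k<..<real k} v" by (rule continuous_on_subset) auto
    qed auto
    moreover have "(\<Union>k::nat. {-real k<..<real k}) = UNIV"
    proof -
      have "\<exists>k::nat. x \<in> {-real k<..<real k}" for x :: real
      proof -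
        obtain k :: nat where "\<bar>x\<bar> < real k" using reals_Archimedean2 by blast
        then have "x \<in> {-real k<..<real k}" by auto
        then show ?thesis by blast
      qed
      then show ?thesis by blast
    qed
    ultimately show ?thesis by simp
  qed
  have int: "has_bochner_integral (lebesgue_on {a..b}) (\<lambda>t. rhs (F0 t) (v t) w) (v b \<bullet> w - v a \<bullet> w)"
    if w: "(w, grad w) \<in> \<G>" and ab: "a \<le> b" for w a b
  proof -
    define R where "R = max \<bar>a\<bar> \<bar>b\<bar>"
    have sub: "{a..b} \<subseteq> {-R..R}" unfolding R_def by auto
    obtain L N where LN: "\<And>n. n \<ge> N \<Longrightarrow> s (r n) \<le> -R" "\<And>n t. n \<ge> N \<Longrightarrow> t \<in> {-R..R} \<Longrightarrow> norm (F (r n) t) \<le> L"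
      using eq[of R] unfolding eventually_sequentially by blast
    define k where "k n = r (n + N)" for n
    define Q where "Q = max (norm w) (norm (grad w))"
    have bw: "V_bdd Q w" using w unfolding V_bdd_def Q_def by simp
    define B where "B = (L + \<bar>\<nu>\<bar> * M + M * (sqrt C * M)) * Q"
    have sa: "s (k n) \<le> a" for n using LN(1)[of "n + N"] sub ab unfolding k_def R_def by auto
    have bu: "V_bdd M (u (k n) t)" if "a \<le> t" for n t
      using sol[of "k n"] sa[of n] that unfolding bdd_sol_def by auto
    have hb: "has_bochner_integral (lebesgue_on {a..b}) (\<lambda>t. rhs (F (k n) t) (u (k n) t) w) (u (k n) b \<bullet> w - u (k n) a \<bullet> w)" for n
      using sol[of "k n"] sa[of n] ab w unfolding bdd_sol_def by blast
    have meas: "(\<lambda>t. rhs (F (k n) t) (u (k n) t) w) \<in> borel_measurable (lebesgue_on {a..b})" for n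
      using hb[of n] by (auto simp: has_bochner_integral_iff)
    have lim: "(\<lambda>n. rhs (F (k n) t) (u (k n) t) w) \<longlonglongrightarrow> rhs (F0 t) (v t) w" if "t \<in> {a..b}" for t
    proof (rule rhs_tendsto[OF _ _ _ w])
      show "V_bdd M (u (k n) t)" for n using bu that by auto
      show "(\<lambda>n. u (k n) t) \<longlonglongrightarrow> v t" unfolding k_def by (rule LIMSEQ_ignore_initial_segment[OF vt])
      show "(\<lambda>n. F (k n) t) \<longlonglongrightarrow> F0 t" unfolding k_def by (rule LIMSEQ_ignore_initial_segment[OF Ft])
    qed
    have measlim: "(\<lambda>t. rhs (F0 t) (v t) w) \<in> borel_measurable (lebesgue_on {a..b})"
      by (rule borel_measurable_LIMSEQ_real[where u="\<lambda>n t. rhs (F (k n) t) (u (k n) t) w", OF _ meas]) (use lim in auto)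
    have bound: "\<bar>rhs (F (k n) t) (u (k n) t) w\<bar> \<le> B" if "t \<in> {a..b}" for n t
      unfolding B_def by (rule rhs_bound[OF _ bw]) (use that bu sub LN(2)[of "n + N" t] in \<open>auto simp: k_def\<close>)
    have fin: "finite_measure (lebesgue_on {a..b})" by (rule finite_measure_lebesgue_on) simp
    have cB: "integrable (lebesgue_on {a..b}) (\<lambda>t. B)" using fin by (simp add: finite_measure.integrable_const)
    have AEl: "AE t in lebesgue_on {a..b}. (\<lambda>n. rhs (F (k n) t) (u (k n) t) w) \<longlonglongrightarrow> rhs (F0 t) (v t) w"
      by (rule AE_I2) (use lim in simp)
    have AEb: "AE t in lebesgue_on {a..b}. norm (rhs (F (k n) t) (u (k n) t) w) \<le> B" for n
      by (rule AE_I2) (use bound in simp)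
    have I: "integrable (lebesgue_on {a..b}) (\<lambda>t. rhs (F0 t) (v t) w)"
      by (rule integrable_dominated_convergence[OF measlim meas cB AEl AEb])
    have "(\<lambda>n. integral\<^sup>L (lebesgue_on {a..b}) (\<lambda>t. rhs (F (k n) t) (u (k n) t) w)) \<longlonglongrightarrow>
        integral\<^sup>L (lebesgue_on {a..b}) (\<lambda>t. rhs (F0 t) (v t) w)"
      by (rule integral_dominated_convergence[OF measlim meas cB AEl AEb])
    then have "(\<lambda>n. u (k n) b \<bullet> w - u (k n) a \<bullet> w) \<longlonglongrightarrow> integral\<^sup>L (lebesgue_on {a..b}) (\<lambda>t. rhs (F0 t) (v t) w)"
      using hb by (simp add: has_bochner_integral_iff)
    moreover have "(\<lambda>n. u (k n) b \<bullet> w - u (k n) a \<bullet> w) \<longlonglongrightarrow> v b \<bullet> w - v a \<bullet> w"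
      unfolding k_def by (intro tendsto_intros LIMSEQ_ignore_initial_segment[OF vt])
    ultimately show ?thesis using I LIMSEQ_unique unfolding has_bochner_integral_iff by blast
  qed
  have "bdd_sol M F0 s v" for s
    unfolding bdd_sol_def using bv int continuous_on_subset[OF cv] by simp
  then show ?thesis using r v by blast
qed

section \<open>Recurrent solutions\<close>

lemma bdd_sol_continuous:
  assumes "\<And>s. bdd_sol M F s u"
  shows "continuous_on UNIV u"
proof -
  have "isCont u t" for t
  proof -
    have "continuous_on {t - 1..} u" using assms[of "t - 1"] unfolding bdd_sol_def by blast
    then have "continuous_on {t - 1<..} u" by (rule continuous_on_subset) auto
    then show ?thesis by (subst (asm) continuous_on_eq_continuous_at) auto
  qed
  then show ?thesis by (simp add: continuous_at_imp_continuous_on)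
qed

text \<open>The parameter \<open>\<sigma>\<close> is \<open>1\<close> for returns in the future and \<open>-1\<close> for returns in the past. One radius \<open>R\<close>
measures both how late the return is and how long the interval of closeness is.\<close>

definition recurrent :: "real \<Rightarrow> (real \<Rightarrow> 'x) \<Rightarrow> bool" where
  "recurrent \<sigma> F \<longleftrightarrow> (\<forall>R e. 0 < e \<longrightarrow> (\<exists>t. R \<le> \<sigma> * t \<and> (\<forall>r\<in>{-R..R}. dist (F (r + t)) (F r) < e)))"

text \<open>The entire bounded solutions \<open>w\<close> for which \<open>(w, F)\<close> is a limit point of the translates of \<open>(u, F)\<close> as
\<open>\<sigma> t \<rightarrow> \<infinity>\<close>, for locally uniform convergence.\<close>

definition returns :: "real \<Rightarrow> real \<Rightarrow> (real \<Rightarrow> 'x) \<Rightarrow> (real \<Rightarrow> 'x) \<Rightarrow> (real \<Rightarrow> 'x) set" where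
  "returns M \<sigma> F u = {w. (\<forall>s. bdd_sol M F s w) \<and> (\<forall>R e. 0 < e \<longrightarrow>
     (\<exists>t. R \<le> \<sigma> * t \<and> (\<forall>r\<in>{-R..R}. dist (u (r + t)) (w r) < e \<and> dist (F (r + t)) (F r) < e)))}"

text \<open>Translates of \<open>u\<close> by the return times of \<open>F\<close> have a convergent subsequence. The starting times \<open>s t\<close> cover two
uses: \<open>u\<close> is an entire solution, or \<open>u\<close> is given on \<open>[0, \<infinity>)\<close> and \<open>\<sigma> = 1\<close>, which produces a first entire
solution.\<close>

lemma ex_return:
  assumes F: "continuous_on UNIV F" and rec: "recurrent \<sigma> F"
    and sol: "\<And>t. 0 \<le> \<sigma> * t \<Longrightarrow> bdd_sol M F (s t) u"
    and s: "\<And>t n. filterlim (\<lambda>n. \<sigma> * t n) at_top sequentially \<Longrightarrow> filterlim (\<lambda>n. s (t n) - t n) at_bot sequentially"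
  shows "returns M \<sigma> F u \<noteq> {}"
proof -
  have "\<exists>t. real n \<le> \<sigma> * t \<and> (\<forall>r\<in>{-real n..real n}. dist (F (r + t)) (F r) < 1 / (real n + 1))" for n
    using rec unfolding recurrent_def by simp
  then obtain t where t: "\<And>n. real n \<le> \<sigma> * t n"
      "\<And>n r. r \<in> {-real n..real n} \<Longrightarrow> dist (F (r + t n)) (F r) < 1 / (real n + 1)" by metis
  have lim: "filterlim (\<lambda>n. \<sigma> * t n) at_top sequentially"
    by (rule filterlim_at_top_mono[OF filterlim_real_sequentially]) (use t(1) in auto)
  have small: "\<forall>\<^sub>F n in sequentially. 1 / (real n + 1) < e" if "0 < e" for e :: real
    using that by real_asymp
  have Flim: "\<forall>\<^sub>F n in sequentially. \<forall>r\<in>{-R..R}. dist (F (r + t n)) (F r) < e" if "0 < e" for R e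
  proof -
    have "\<forall>\<^sub>F n in sequentially. R \<le> real n" by real_asymp
    with small[OF that] show ?thesis
    proof eventually_elim
      case (elim n)
      show ?case
      proof
        fix r assume "r \<in> {-R..R}"
        then have "r \<in> {-real n..real n}" using elim by auto
        then show "dist (F (r + t n)) (F r) < e" using t(2)[of r n] elim by linarith
      qed
    qed
  qed
  have "\<exists>k v. strict_mono (k::nat \<Rightarrow> nat) \<and> (\<forall>R. uniform_limit {-R..R} (\<lambda>n. \<lambda>r. u (r + t (k n))) v sequentially) \<and>
      (\<forall>s. bdd_sol M F s v)"
  proof (rule bdd_sols_compact[where F = "\<lambda>n r. F (r + t n)" and s = "\<lambda>n. s (t n) - t n" and u = "\<lambda>n r. u (r + t n)", OF _ F])
    show "uniform_limit {-R..R} (\<lambda>n r. F (r + t n)) F sequentially" for R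
      unfolding uniform_limit_iff using Flim by blast
    show "filterlim (\<lambda>n. s (t n) - t n) at_bot sequentially" by (rule s[OF lim])
    show "bdd_sol M (\<lambda>r. F (r + t n)) (s (t n) - t n) (\<lambda>r. u (r + t n))" for n
      by (rule bdd_sol_shift[OF sol]) (use t(1)[of n] in linarith)
  qed
  then obtain k v where k: "strict_mono (k::nat \<Rightarrow> nat)"
    and v: "\<And>R. uniform_limit {-R..R} (\<lambda>n. \<lambda>r. u (r + t (k n))) v sequentially"
    and sv: "\<forall>s. bdd_sol M F s v" by blast
  have fk: "filterlim k sequentially sequentially" by (rule filterlim_subseq[OF k])
  have "\<exists>t. R \<le> \<sigma> * t \<and> (\<forall>r\<in>{-R..R}. dist (u (r + t)) (v r) < e \<and> dist (F (r + t)) (F r) < e)"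
    if e: "0 < e" for R e
  proof -
    have "\<forall>\<^sub>F n in sequentially. \<forall>r\<in>{-R..R}. dist (u (r + t (k n))) (v r) < e"
      using v[of R] e unfolding uniform_limit_iff by blast
    moreover have "\<forall>\<^sub>F n in sequentially. \<forall>r\<in>{-R..R}. dist (F (r + t (k n))) (F r) < e"
      by (rule eventually_compose_filterlim[OF Flim[OF e] fk])
    moreover have "\<forall>\<^sub>F n in sequentially. R \<le> \<sigma> * t n" using lim unfolding filterlim_at_top by blast
    then have "\<forall>\<^sub>F n in sequentially. R \<le> \<sigma> * t (k n)" by (rule eventually_compose_filterlim[OF _ fk])
    ultimately have "\<forall>\<^sub>F n in sequentially. R \<le> \<sigma> * t (k n) \<and>
        (\<forall>r\<in>{-R..R}. dist (u (r + t (k n))) (v r) < e \<and> dist (F (r + t (k n))) (F r) < e)"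
      by eventually_elim blast
    then obtain n where "R \<le> \<sigma> * t (k n) \<and>
        (\<forall>r\<in>{-R..R}. dist (u (r + t (k n))) (v r) < e \<and> dist (F (r + t (k n))) (F r) < e)"
      using eventually_happens'[OF sequentially_bot] by blast
    then show ?thesis by blast
  qed
  then have "v \<in> returns M \<sigma> F u" unfolding returns_def using sv by simp
  then show ?thesis by blast
qed

text \<open>If \<open>y(\<cdot> + s)\<close> is close to \<open>w\<close> on \<open>[-R, R]\<close> and \<open>z(\<cdot> + t)\<close> is close to \<open>y\<close> on \<open>[-R - |s|, R + |s|]\<close>, then
\<open>z(\<cdot> + s + t)\<close> is close to \<open>w\<close> on \<open>[-R, R]\<close>. If \<open>\<sigma> t \<ge> R + |s|\<close>, then \<open>\<sigma> (s + t) \<ge> R\<close> for either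
sign of \<open>s\<close>, and so a return of \<open>y\<close> in either direction gives a return of \<open>z\<close> in the direction \<open>\<sigma>\<close>.\<close>

lemma returns_trans:
  assumes \<sigma>: "\<bar>\<sigma>\<bar> = 1" and y: "y \<in> returns M \<sigma> F z" and w: "w \<in> returns M \<sigma>' F y"
  shows "w \<in> returns M \<sigma> F z"
  unfolding returns_def mem_Collect_eq
proof (intro conjI allI impI)
  show "bdd_sol M F s w" for s using w unfolding returns_def by blast
  fix R e :: real assume e: "0 < e"
  then have e2: "0 < e / 2" by simp
  obtain s where s: "\<And>r. r \<in> {-R..R} \<Longrightarrow> dist (y (r + s)) (w r) < e/2 \<and> dist (F (r + s)) (F r) < e/2"
    using w e2 unfolding returns_def by blast
  obtain t where t: "R + \<bar>s\<bar> \<le> \<sigma> * t"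
    "\<And>r. r \<in> {-(R+\<bar>s\<bar>)..R+\<bar>s\<bar>} \<Longrightarrow> dist (z (r + t)) (y r) < e/2 \<and> dist (F (r + t)) (F r) < e/2"
    using y e2 unfolding returns_def by blast
  have "R \<le> \<sigma> * (s + t)"
  proof -
    have "\<bar>\<sigma> * s\<bar> = \<bar>s\<bar>" using \<sigma> by (simp add: abs_mult)
    then show ?thesis using t(1) by (simp add: distrib_left)
  qed
  moreover have "dist (z (r + (s + t))) (w r) < e \<and> dist (F (r + (s + t))) (F r) < e" if r: "r \<in> {-R..R}" for r
  proof -
    have "r + s \<in> {-(R+\<bar>s\<bar>)..R+\<bar>s\<bar>}" using r by auto
    from t(2)[OF this] s[OF r]
    show ?thesis
      using dist_triangle_half_l[of "z (r + (s + t))" "y (r + s)" e "w r"]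
        dist_triangle_half_l[of "F (r + (s + t))" "F (r + s)" e "F r"]
      by (simp add: add.assoc dist_commute)
  qed
  ultimately show "\<exists>t. R \<le> \<sigma> * t \<and> (\<forall>r\<in>{-R..R}. dist (z (r + t)) (w r) < e \<and> dist (F (r + t)) (F r) < e)"
    by blast
qed

lemma returns_closed:
  assumes w: "\<And>n. w n \<in> returns M \<sigma> F u" and lim: "\<And>R. uniform_limit {-R..R} w v sequentially"
    and v: "\<And>s. bdd_sol M F s v"
  shows "v \<in> returns M \<sigma> F u"
  unfolding returns_def mem_Collect_eq
proof (intro conjI allI impI)
  show "bdd_sol M F s v" for s by (rule v)
  fix R e :: real assume e: "0 < e"
  then have e2: "0 < e / 2" by simp
  have "\<forall>\<^sub>F n in sequentially. \<forall>r\<in>{-R..R}. dist (w n r) (v r) < e/2"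
    using lim[of R] e2 unfolding uniform_limit_iff by blast
  then obtain n where n: "\<And>r. r\<in>{-R..R} \<Longrightarrow> dist (w n r) (v r) < e/2"
    using eventually_happens'[OF sequentially_bot] by blast
  obtain t where t: "R \<le> \<sigma> * t"
    "\<And>r. r \<in> {-R..R} \<Longrightarrow> dist (u (r + t)) (w n r) < e/2 \<and> dist (F (r + t)) (F r) < e/2"
    using w[of n] e2 unfolding returns_def by blast
  have "dist (u (r + t)) (v r) < e \<and> dist (F (r + t)) (F r) < e" if r: "r \<in> {-R..R}" for r
    using t(2)[OF r] n[OF r] e dist_triangle[of "u (r + t)" "v r" "w n r"] by linarith
  then show "\<exists>t. R \<le> \<sigma> * t \<and> (\<forall>r\<in>{-R..R}. dist (u (r + t)) (v r) < e \<and> dist (F (r + t)) (F r) < e)"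
    using t(1) by blast
qed

text \<open>To apply the minimal-set lemma, an entire solution is encoded by its values at rational times (\<open>J\<close>). In the
countable product of copies of the Hilbert space, which is metrizable, the set of entire solutions with bound \<open>M\<close> is compact
by \<open>bdd_sols_compact\<close>.\<close>

theorem ex_recurrent_solution:
  assumes F: "continuous_on UNIV F" and rec: "recurrent 1 F" "recurrent (-1) F"
    and v: "bdd_sol M F 0 v"
  shows "\<exists>u. (\<forall>s. bdd_sol M F s u) \<and> u \<in> returns M 1 F u \<and> u \<in> returns M (-1) F u"
proof -
  define S where "S = {u. \<forall>s. bdd_sol M F s u}"
  define J where "J u = (\<lambda>q::rat. u (of_rat q))" for u :: "real \<Rightarrow> 'x"
  define E where "E = inv_into S J"
  have ret: "returns M \<sigma> F u \<noteq> {}" if "u \<in> S" "\<sigma> = 1 \<or> \<sigma> = -1" for \<sigma> u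
  \<comment> \<open>An entire solution may start anywhere; starting at \<open>t - |t|\<close>, the translate by \<open>t\<close> starts at \<open>-|t|\<close>.\<close>
  proof (rule ex_return[OF F, of \<sigma> M "\<lambda>t. t - \<bar>t\<bar>"])
    show "recurrent \<sigma> F" using that(2) rec by blast
    show "bdd_sol M F (t - \<bar>t\<bar>) u" for t using that(1) unfolding S_def by blast
    fix t :: "nat \<Rightarrow> real" assume "filterlim (\<lambda>n. \<sigma> * t n) at_top sequentially"
    then have "filterlim (\<lambda>n. - (\<sigma> * t n)) at_bot sequentially"
      by (simp add: filterlim_uminus_at_top)
    then show "filterlim (\<lambda>n. t n - \<bar>t n\<bar> - t n) at_bot sequentially"
    proof (rule filterlim_at_bot_mono)
      show "\<forall>\<^sub>F n in sequentially. t n - \<bar>t n\<bar> - t n \<le> - (\<sigma> * t n)"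
        using that(2) by (intro always_eventually allI) auto
    qed
  qed
  have retS: "returns M \<sigma> F u \<subseteq> S" for \<sigma> u unfolding returns_def S_def by blast
  have "returns M 1 F v \<noteq> {}"
  proof (rule ex_return[OF F rec(1), of M "\<lambda>_. 0"])
    show "bdd_sol M F 0 v" by (rule v)
    fix t :: "nat \<Rightarrow> real" assume "filterlim (\<lambda>n. 1 * t n) at_top sequentially"
    then show "filterlim (\<lambda>n. 0 - t n) at_bot sequentially" by (simp add: filterlim_uminus_at_top)
  qed
  then have Sne: "S \<noteq> {}" using retS by blast
  have cont: "continuous_on UNIV u" if "u \<in> S" for u
    by (rule bdd_sol_continuous) (use that in \<open>auto simp: S_def\<close>)
  have inj: "inj_on J S"
  proof (rule inj_onI)
    fix u w assume uw: "u \<in> S" "w \<in> S" "J u = J w"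
    have cl: "closed {t. u t = w t}"
      by (rule closed_Collect_eq[OF cont[OF uw(1)] cont[OF uw(2)]])
    have "\<rat> \<subseteq> {t. u t = w t}"
    proof
      fix t :: real assume "t \<in> \<rat>"
      then obtain q where "t = of_rat q" by (auto simp: Rats_def)
      then show "t \<in> {t. u t = w t}" using fun_cong[OF uw(3), of q] by (simp add: J_def)
    qed
    then have sub: "closure \<rat> \<subseteq> {t. u t = w t}" by (rule closure_minimal[OF _ cl])
    then have "u t = w t" for t using sub Rats_closure_real by blast
    then show "u = w" by blast
  qed
  have EJ: "E (J u) = u" if "u \<in> S" for u unfolding E_def by (rule inv_into_f_f[OF inj that])
  \<comment> \<open>Convergence in the product is convergence at rational times only, but the subsequences provided by
    \<open>bdd_sols_compact\<close> converge locally uniformly; so it suffices that \<open>A\<close> is closed in that sense.\<close>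
  have comp: "compact (J ` A)"
    if A: "A \<subseteq> S" and cl: "\<And>w l. (\<And>n. w n \<in> A) \<Longrightarrow> (\<And>R. uniform_limit {-R..R} w l sequentially) \<Longrightarrow> l \<in> S \<Longrightarrow> l \<in> A" for A
    unfolding compact_eq_seq_compact_metric
  proof (rule seq_compactI)
    fix f :: "nat \<Rightarrow> rat \<Rightarrow> 'x" assume "\<forall>n. f n \<in> J ` A"
    then have "\<forall>n. \<exists>w. w \<in> A \<and> f n = J w" by blast
    then obtain w :: "nat \<Rightarrow> real \<Rightarrow> 'x" where w: "\<And>n. w n \<in> A" "\<And>n. f n = J (w n)" by metis
    have wS: "w n \<in> S" for n using w(1) A by blast
    have "\<exists>k l. strict_mono (k::nat \<Rightarrow> nat) \<and> (\<forall>R. uniform_limit {-R..R} (\<lambda>n. w (k n)) l sequentially) \<and> (\<forall>s. bdd_sol M F s l)"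
    proof (rule bdd_sols_compact[where F = "\<lambda>_. F" and s = "\<lambda>n. - real n", OF _ F])
      show "uniform_limit {-R..R} (\<lambda>_. F) F sequentially" for R by (simp add: uniform_limit_iff)
      show "filterlim (\<lambda>n. - real n) at_bot sequentially" by real_asymp
      show "bdd_sol M F (- real n) (w n)" for n using wS unfolding S_def by blast
    qed
    then obtain k l where k: "strict_mono (k::nat \<Rightarrow> nat)"
      and l: "\<And>R. uniform_limit {-R..R} (\<lambda>n. w (k n)) l sequentially" and lS: "l \<in> S"
      unfolding S_def by blast
    have "l \<in> A" by (rule cl[of "\<lambda>n. w (k n)"]) (fact w(1) l lS)+
    moreover have "(f \<circ> k) \<longlonglongrightarrow> J l"
    proof (rule tendsto_fun_pointwise)
      fix q :: rat
      have in_sym: "x \<in> {-\<bar>x\<bar>..\<bar>x\<bar>}" for x :: real by auto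
      have "(\<lambda>n. w (k n) (of_rat q)) \<longlonglongrightarrow> l (of_rat q)"
        by (rule tendsto_uniform_limitI[OF l in_sym])
      then show "(\<lambda>n. (f \<circ> k) n q) \<longlonglongrightarrow> J l q" by (simp add: w(2) J_def)
    qed
    ultimately show "\<exists>l\<in>J ` A. \<exists>r. strict_mono r \<and> (f \<circ> r) \<longlonglongrightarrow> l" using k by blast
  qed
  define P where "P \<sigma> z = J ` returns M \<sigma> F (E z)" for \<sigma> z
  have ES: "E z \<in> S" "J (E z) = z" if "z \<in> J ` S" for z
    using that EJ by auto
  have Ptrans: "P \<sigma>' y \<subseteq> P \<sigma> z" if z: "z \<in> J ` S" and \<sigma>: "\<bar>\<sigma>\<bar> = 1" and y: "y \<in> P \<sigma> z" for z y \<sigma> \<sigma>'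
  proof -
    obtain y' where y': "y' \<in> returns M \<sigma> F (E z)" "y = J y'" using y unfolding P_def by blast
    then have "E y = y'" using EJ retS by blast
    then show ?thesis unfolding P_def using returns_trans[OF \<sigma> y'(1)] by auto
  qed
  have "\<exists>z\<in>J ` S. z \<in> P 1 z \<inter> P (-1) z"
  proof (rule ex_point_in_all_returns)
    show "compact (J ` S)" by (rule comp) auto
    show "J ` S \<noteq> {}" using Sne by simp
    show "P 1 z \<subseteq> J ` S" "P (-1) z \<subseteq> J ` S" for z unfolding P_def by (rule image_mono[OF retS])+
    show "P 1 z \<noteq> {}" "P (-1) z \<noteq> {}" if "z \<in> J ` S" for z
      unfolding P_def using ret[OF ES(1)[OF that], of 1] ret[OF ES(1)[OF that], of "-1"] by simp_all
    have "compact (P \<sigma> z)" for \<sigma> z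
      unfolding P_def by (rule comp[OF retS]) (auto intro: returns_closed simp: S_def)
    then show "compact (P 1 z)" "compact (P (-1) z)" for z by blast+
    show "P 1 y \<union> P (-1) y \<subseteq> P 1 z" if "z \<in> J ` S" "y \<in> P 1 z" for z y
      by (rule Un_least; rule Ptrans) (use that in auto)
    show "P 1 y \<union> P (-1) y \<subseteq> P (-1) z" if "z \<in> J ` S" "y \<in> P (-1) z" for z y
      by (rule Un_least; rule Ptrans) (use that in auto)
  qed
  then obtain z where z: "z \<in> J ` S" "z \<in> P 1 z" "z \<in> P (-1) z" by blast
  have *: "E z \<in> returns M \<sigma> F (E z)" if "z \<in> P \<sigma> z" for \<sigma>
  proof -
    obtain y where y: "y \<in> returns M \<sigma> F (E z)" "z = J y" using \<open>z \<in> P \<sigma> z\<close> unfolding P_def by blast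
    have "y \<in> S" using retS y(1) by (rule subsetD)
    then have "E z = y" using EJ y(2) by simp
    then show ?thesis using y(1) by simp
  qed
  have "\<forall>s. bdd_sol M F s (E z)" using ES(1)[OF z(1)] unfolding S_def by simp
  then show ?thesis using *[OF z(2)] *[OF z(3)] by blast
qed

end

section \<open>The Hilbert space of square-integrable functions\<close>

definition sq_integrable :: "('a::euclidean_space \<Rightarrow> 'b::euclidean_space) \<Rightarrow> bool" where
  "sq_integrable f \<longleftrightarrow> f \<in> borel_measurable lebesgue \<and> integrable lebesgue (\<lambda>x. (norm (f x))\<^sup>2)"

lemma sq_integrable_measurable: "sq_integrable f \<Longrightarrow> f \<in> borel_measurable lebesgue"
  and sq_integrable_integrable: "sq_integrable f \<Longrightarrow> integrable lebesgue (\<lambda>x. (norm (f x))\<^sup>2)"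
  by (auto simp: sq_integrable_def)

lemma norm_square_measurable [measurable (raw)]:
  fixes f :: "'a \<Rightarrow> 'b::euclidean_space"
  assumes [measurable]: "f \<in> borel_measurable M"
  shows "(\<lambda>x. (norm (f x))\<^sup>2) \<in> borel_measurable M"
  by measurable

lemma sq_integrable_bound:
  fixes f :: "'a::euclidean_space \<Rightarrow> 'b::euclidean_space"
  assumes "integrable lebesgue g" "f \<in> borel_measurable lebesgue" "\<And>x. (norm (f x))\<^sup>2 \<le> g x"
  shows "sq_integrable f"
  unfolding sq_integrable_def
proof (intro conjI assms(2) Bochner_Integration.integrable_bound[OF assms(1)])
  show "(\<lambda>x. (norm (f x))\<^sup>2) \<in> borel_measurable lebesgue"
    by (rule norm_square_measurable[OF assms(2)])
  show "AE x in lebesgue. norm ((norm (f x))\<^sup>2) \<le> norm (g x)"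
    using order_trans[OF assms(3) abs_ge_self] by (intro AE_I2) simp
qed

lemma sq_integrable_zero [simp]: "sq_integrable (\<lambda>_. 0)"
  by (simp add: sq_integrable_def)

lemma norm_add_square_le: "(norm (a + b))\<^sup>2 \<le> 2 * (norm a)\<^sup>2 + 2 * (norm b)\<^sup>2" for a b :: "'a::real_inner"
proof -
  have "0 \<le> (norm (a - b))\<^sup>2" by simp
  then show ?thesis
    by (simp add: power2_norm_eq_inner inner_add_left inner_add_right inner_diff_left inner_diff_right inner_commute)
qed

lemma sq_integrable_add: "sq_integrable f \<Longrightarrow> sq_integrable g \<Longrightarrow> sq_integrable (\<lambda>x. f x + g x)"
proof (rule sq_integrable_bound[where g = "\<lambda>x. 2 * (norm (f x))\<^sup>2 + 2 * (norm (g x))\<^sup>2"])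
  assume *: "sq_integrable f" "sq_integrable g"
  show "integrable lebesgue (\<lambda>x. 2 * (norm (f x))\<^sup>2 + 2 * (norm (g x))\<^sup>2)"
    using * by (intro Bochner_Integration.integrable_add integrable_mult_right sq_integrable_integrable)
  show "(\<lambda>x. f x + g x) \<in> borel_measurable lebesgue"
    using * by (intro borel_measurable_add sq_integrable_measurable)
qed (rule norm_add_square_le)

lemma sq_integrable_scaleR: "sq_integrable f \<Longrightarrow> sq_integrable (\<lambda>x. c *\<^sub>R f x)"
proof (rule sq_integrable_bound[where g = "\<lambda>x. c\<^sup>2 * (norm (f x))\<^sup>2"])
  assume *: "sq_integrable f"
  show "integrable lebesgue (\<lambda>x. c\<^sup>2 * (norm (f x))\<^sup>2)"
    using * by (intro integrable_mult_right sq_integrable_integrable)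
  show "(\<lambda>x. c *\<^sub>R f x) \<in> borel_measurable lebesgue"
    using sq_integrable_measurable[OF *] by (intro borel_measurable_scaleR) auto
qed (simp add: power_mult_distrib)

lemma sq_integrable_uminus: "sq_integrable f \<Longrightarrow> sq_integrable (\<lambda>x. - f x)"
  using sq_integrable_scaleR[of f "-1"] by simp

lemma sq_integrable_diff: "sq_integrable f \<Longrightarrow> sq_integrable g \<Longrightarrow> sq_integrable (\<lambda>x. f x - g x)"
  using sq_integrable_add[OF _ sq_integrable_uminus, of f g] by simp

lemma sq_integrable_inner_integrable:
  assumes "sq_integrable f" "sq_integrable g"
  shows "integrable lebesgue (\<lambda>x. f x \<bullet> g x)"
proof (rule Bochner_Integration.integrable_bound)
  show "integrable lebesgue (\<lambda>x. (norm (f x))\<^sup>2 + (norm (g x))\<^sup>2)"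
    using assms by (intro Bochner_Integration.integrable_add sq_integrable_integrable)
  show "(\<lambda>x. f x \<bullet> g x) \<in> borel_measurable lebesgue"
    using assms by (intro borel_measurable_inner sq_integrable_measurable)
  have "\<bar>f x \<bullet> g x\<bar> \<le> (norm (f x))\<^sup>2 + (norm (g x))\<^sup>2" for x
  proof -
    have "0 \<le> (norm (f x) - norm (g x))\<^sup>2" by simp
    then have "2 * (norm (f x) * norm (g x)) \<le> (norm (f x))\<^sup>2 + (norm (g x))\<^sup>2"
      by (simp add: power2_diff)
    moreover have "0 \<le> norm (f x) * norm (g x)" by simp
    ultimately show ?thesis using Cauchy_Schwarz_ineq2[of "f x" "g x"] by linarith
  qed
  then show "AE x in lebesgue. norm (f x \<bullet> g x) \<le> norm ((norm (f x))\<^sup>2 + (norm (g x))\<^sup>2)"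
    by (intro AE_I2) simp
qed

text \<open>Square-integrable functions modulo null sets. The domain is the whole space; functions on \<open>D\<close> will be extended by
zero, because the type cannot depend on \<open>D\<close>.\<close>

quotient_type (overloaded) ('a, 'b) Lsq = "'a::euclidean_space \<Rightarrow> 'b::euclidean_space" / partial:
  "\<lambda>f g. sq_integrable f \<and> sq_integrable g \<and> (AE x in lebesgue. f x = g x)"
proof (rule part_equivpI)
  show "\<exists>f::'a \<Rightarrow> 'b. sq_integrable f \<and> sq_integrable f \<and> (AE x in lebesgue. f x = f x)" by (intro exI[of _ "\<lambda>_. 0"]) simp
  show "symp (\<lambda>f g :: 'a \<Rightarrow> 'b. sq_integrable f \<and> sq_integrable g \<and> (AE x in lebesgue. f x = g x))"
    by (auto intro!: sympI elim!: eventually_mono)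
  show "transp (\<lambda>f g :: 'a \<Rightarrow> 'b. sq_integrable f \<and> sq_integrable g \<and> (AE x in lebesgue. f x = g x))"
  proof (rule transpI)
    fix f g h :: "'a \<Rightarrow> 'b"
    assume *: "sq_integrable f \<and> sq_integrable g \<and> (AE x in lebesgue. f x = g x)" "sq_integrable g \<and> sq_integrable h \<and> (AE x in lebesgue. g x = h x)"
    from * have "AE x in lebesgue. f x = g x" "AE x in lebesgue. g x = h x" by auto
    then have "AE x in lebesgue. f x = h x" by eventually_elim simp
    with * show "sq_integrable f \<and> sq_integrable h \<and> (AE x in lebesgue. f x = h x)" by simp
  qed
qed

instantiation Lsq :: (euclidean_space, euclidean_space) real_inner
begin

lift_definition zero_Lsq :: "('a, 'b) Lsq" is "\<lambda>_. 0" by simp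
lift_definition plus_Lsq :: "('a, 'b) Lsq \<Rightarrow> ('a, 'b) Lsq \<Rightarrow> ('a, 'b) Lsq" is "\<lambda>f g x. f x + g x"
  by (auto intro: sq_integrable_add elim: eventually_elim2)
lift_definition uminus_Lsq :: "('a, 'b) Lsq \<Rightarrow> ('a, 'b) Lsq" is "\<lambda>f x. - f x"
  by (auto intro: sq_integrable_uminus)
lift_definition minus_Lsq :: "('a, 'b) Lsq \<Rightarrow> ('a, 'b) Lsq \<Rightarrow> ('a, 'b) Lsq" is "\<lambda>f g x. f x - g x"
  by (auto intro: sq_integrable_diff elim: eventually_elim2)
lift_definition scaleR_Lsq :: "real \<Rightarrow> ('a, 'b) Lsq \<Rightarrow> ('a, 'b) Lsq" is "\<lambda>c f x. c *\<^sub>R f x"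
  by (auto intro: sq_integrable_scaleR)
lift_definition inner_Lsq :: "('a, 'b) Lsq \<Rightarrow> ('a, 'b) Lsq \<Rightarrow> real" is "\<lambda>f g. \<integral>x. f x \<bullet> g x \<partial>lebesgue"
proof -
  fix f f' g g' :: "'a \<Rightarrow> 'b"
  assume *: "sq_integrable f \<and> sq_integrable f' \<and> (AE x in lebesgue. f x = f' x)" "sq_integrable g \<and> sq_integrable g' \<and> (AE x in lebesgue. g x = g' x)"
  have m: "(\<lambda>x. f x \<bullet> g x) \<in> borel_measurable lebesgue" "(\<lambda>x. f' x \<bullet> g' x) \<in> borel_measurable lebesgue"
    using * sq_integrable_measurable[of f] sq_integrable_measurable[of g] sq_integrable_measurable[of f'] sq_integrable_measurable[of g']
    by (auto intro!: borel_measurable_inner)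
  from * have "AE x in lebesgue. f x = f' x" "AE x in lebesgue. g x = g' x" by auto
  then have "AE x in lebesgue. f x \<bullet> g x = f' x \<bullet> g' x" by eventually_elim simp
  then show "(\<integral>x. f x \<bullet> g x \<partial>lebesgue) = (\<integral>x. f' x \<bullet> g' x \<partial>lebesgue)" by (intro integral_cong_AE m)
qed

definition norm_Lsq :: "('a, 'b) Lsq \<Rightarrow> real" where "norm_Lsq U = sqrt (inner U U)"
definition dist_Lsq :: "('a, 'b) Lsq \<Rightarrow> ('a, 'b) Lsq \<Rightarrow> real" where "dist_Lsq U V = norm (U - V)"
definition sgn_Lsq :: "('a, 'b) Lsq \<Rightarrow> ('a, 'b) Lsq" where "sgn_Lsq U = scaleR (inverse (norm U)) U"
definition uniformity_Lsq :: "(('a, 'b) Lsq \<times> ('a, 'b) Lsq) filter" where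
  "uniformity_Lsq = (INF e\<in>{0<..}. principal {(x, y). dist x y < e})"
definition open_Lsq :: "('a, 'b) Lsq set \<Rightarrow> bool" where
  "open_Lsq S \<longleftrightarrow> (\<forall>x\<in>S. \<forall>\<^sub>F (x', y) in uniformity. x' = x \<longrightarrow> y \<in> S)"

instance
proof
  fix U V W :: "('a, 'b) Lsq" and a b :: real
  show "dist U V = norm (U - V)" by (rule dist_Lsq_def)
  show "sgn U = scaleR (inverse (norm U)) U" by (rule sgn_Lsq_def)
  show "uniformity = (INF e\<in>{0<..}. principal {(x, y). dist x y < (e::real)} :: (('a, 'b) Lsq \<times> ('a, 'b) Lsq) filter)"
    by (rule uniformity_Lsq_def)
  show "open S = (\<forall>x\<in>S. \<forall>\<^sub>F (x', y) in uniformity. x' = x \<longrightarrow> y \<in> S)" for S :: "('a, 'b) Lsq set"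
    by (rule open_Lsq_def)
  show "norm U = sqrt (inner U U)" by (rule norm_Lsq_def)
  show "U + V + W = U + (V + W)" by transfer (auto intro!: sq_integrable_add simp: add.assoc)
  show "U + V = V + U" by transfer (auto intro!: sq_integrable_add simp: add.commute)
  show "0 + U = U" by transfer auto
  show "- U + U = 0" by transfer (auto intro!: sq_integrable_uminus sq_integrable_add)
  show "U - V = U + - V" by transfer (auto intro!: sq_integrable_add sq_integrable_uminus sq_integrable_diff)
  show "a *\<^sub>R (U + V) = a *\<^sub>R U + a *\<^sub>R V"
    by transfer (auto intro!: sq_integrable_add sq_integrable_scaleR simp: scaleR_add_right)
  show "(a + b) *\<^sub>R U = a *\<^sub>R U + b *\<^sub>R U"
    by transfer (auto intro!: sq_integrable_add sq_integrable_scaleR simp: scaleR_add_left)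
  show "a *\<^sub>R b *\<^sub>R U = (a * b) *\<^sub>R U" by transfer (auto intro!: sq_integrable_scaleR)
  show "1 *\<^sub>R U = U" by transfer auto
  show "inner U V = inner V U" by transfer (simp add: inner_commute)
  show "inner (U + V) W = inner U W + inner V W"
    by transfer (simp add: inner_add_left sq_integrable_inner_integrable)
  show "inner (a *\<^sub>R U) V = a * inner U V" by transfer simp
  show "0 \<le> inner U U" by transfer simp
  show "(inner U U = 0) = (U = 0)"
  proof transfer
    fix f :: "'a \<Rightarrow> 'b" assume "sq_integrable f \<and> sq_integrable f \<and> (AE x in lebesgue. f x = f x)"
    then have f: "sq_integrable f" by simp
    have "(\<integral>x. f x \<bullet> f x \<partial>lebesgue) = 0 \<longleftrightarrow> (AE x in lebesgue. f x \<bullet> f x = 0)"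
      using sq_integrable_inner_integrable[OF f f] by (intro integral_nonneg_eq_0_iff_AE) auto
    then show "((\<integral>x. f x \<bullet> f x \<partial>lebesgue) = 0) = (sq_integrable f \<and> sq_integrable (\<lambda>_::'a. 0::'b) \<and> (AE x in lebesgue. f x = 0))"
      using f by simp
  qed
qed

end

definition repr :: "('a, 'b) Lsq \<Rightarrow> 'a::euclidean_space \<Rightarrow> 'b::euclidean_space" where "repr = rep_Lsq"

lemma sq_integrable_repr: "sq_integrable (repr U)"
  unfolding repr_def using Quotient_rep_reflp[OF Quotient_Lsq, of U] by simp

lemma abs_repr: "abs_Lsq (repr U) = U"
  unfolding repr_def using Quotient_abs_rep[OF Quotient_Lsq] .

lemma abs_Lsq_eq_iff: "sq_integrable f \<Longrightarrow> sq_integrable g \<Longrightarrow> abs_Lsq f = abs_Lsq g \<longleftrightarrow> (AE x in lebesgue. f x = g x)"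
  using Quotient_rel_abs2 Quotient_rel[OF Quotient_Lsq, of f g] by auto

lemma repr_abs: "sq_integrable f \<Longrightarrow> AE x in lebesgue. repr (abs_Lsq f) x = f x"
  using abs_Lsq_eq_iff[OF sq_integrable_repr, of f "abs_Lsq f"] abs_repr by blast

lemma abs_add: "sq_integrable f \<Longrightarrow> sq_integrable g \<Longrightarrow> abs_Lsq f + abs_Lsq g = abs_Lsq (\<lambda>x. f x + g x)"
  by (rule plus_Lsq.abs_eq) (auto simp: eq_onp_def)

lemma abs_diff: "sq_integrable f \<Longrightarrow> sq_integrable g \<Longrightarrow> abs_Lsq f - abs_Lsq g = abs_Lsq (\<lambda>x. f x - g x)"
  by (rule minus_Lsq.abs_eq) (auto simp: eq_onp_def)

lemma abs_scaleR: "sq_integrable f \<Longrightarrow> c *\<^sub>R abs_Lsq f = abs_Lsq (\<lambda>x. c *\<^sub>R f x)"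
  by (rule scaleR_Lsq.abs_eq) (auto simp: eq_onp_def)

lemma inner_abs: "sq_integrable f \<Longrightarrow> sq_integrable g \<Longrightarrow> abs_Lsq f \<bullet> abs_Lsq g = (\<integral>x. f x \<bullet> g x \<partial>lebesgue)"
  by (rule inner_Lsq.abs_eq) (auto simp: eq_onp_def)

lemma norm_abs: "sq_integrable f \<Longrightarrow> (norm (abs_Lsq f))\<^sup>2 = (\<integral>x. (norm (f x))\<^sup>2 \<partial>lebesgue)"
  by (simp add: power2_norm_eq_inner inner_abs)

lemma abs_0: "abs_Lsq (\<lambda>_. 0) = 0"
  by (simp add: zero_Lsq_def)

lemma repr_diff: "AE x in lebesgue. repr (U - V) x = repr U x - repr V x"
  using repr_abs[OF sq_integrable_diff[OF sq_integrable_repr sq_integrable_repr, of U V]] abs_diff[OF sq_integrable_repr sq_integrable_repr, of U V] by (simp add: abs_repr)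

text \<open>Lower semicontinuity of the norm under almost everywhere convergence, by Fatou's lemma. It also yields the
square-integrability of the limit.\<close>

lemma sq_integrable_fatou:
  fixes g :: "nat \<Rightarrow> 'a::euclidean_space \<Rightarrow> 'b::euclidean_space"
  assumes g: "\<And>n. sq_integrable (g n)" and m: "g0 \<in> borel_measurable lebesgue"
    and lim: "AE x in lebesgue. (\<lambda>n. g n x) \<longlonglongrightarrow> g0 x"
    and K: "\<And>n. (norm (abs_Lsq (g n)))\<^sup>2 \<le> K n" and Kl: "K \<longlonglongrightarrow> K0"
  shows "sq_integrable g0 \<and> (norm (abs_Lsq g0))\<^sup>2 \<le> K0"
proof -
  have nn: "(\<integral>\<^sup>+x. ennreal ((norm (g n x))\<^sup>2) \<partial>lebesgue) = ennreal ((norm (abs_Lsq (g n)))\<^sup>2)" for n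
    unfolding norm_abs[OF g] by (rule nn_integral_eq_integral[OF sq_integrable_integrable[OF g]]) auto
  have "(\<integral>\<^sup>+x. ennreal ((norm (g0 x))\<^sup>2) \<partial>lebesgue) = (\<integral>\<^sup>+x. liminf (\<lambda>n. ennreal ((norm (g n x))\<^sup>2)) \<partial>lebesgue)"
  proof (rule nn_integral_cong_AE)
    show "AE x in lebesgue. ennreal ((norm (g0 x))\<^sup>2) = liminf (\<lambda>n. ennreal ((norm (g n x))\<^sup>2))"
      using lim
    proof eventually_elim
      case (elim x)
      have "(\<lambda>n. ennreal ((norm (g n x))\<^sup>2)) \<longlonglongrightarrow> ennreal ((norm (g0 x))\<^sup>2)"
        by (intro tendsto_ennrealI tendsto_power tendsto_norm elim)
      from lim_imp_Liminf[OF sequentially_bot this] show ?case by (rule sym)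
    qed
  qed
  also have "\<dots> \<le> liminf (\<lambda>n. \<integral>\<^sup>+x. ennreal ((norm (g n x))\<^sup>2) \<partial>lebesgue)"
    by (rule nn_integral_liminf) (intro measurable_compose[OF _ measurable_ennreal] norm_square_measurable sq_integrable_measurable[OF g])
  also have "\<dots> \<le> liminf (\<lambda>n. ennreal (K n))"
    unfolding nn by (intro Liminf_mono always_eventually allI ennreal_leI K)
  also have "\<dots> = ennreal K0" by (rule lim_imp_Liminf[OF _ tendsto_ennrealI[OF Kl]]) simp
  finally have le: "(\<integral>\<^sup>+x. ennreal ((norm (g0 x))\<^sup>2) \<partial>lebesgue) \<le> ennreal K0" .
  have meas: "(\<lambda>x. (norm (g0 x))\<^sup>2) \<in> borel_measurable lebesgue"
    by (rule norm_square_measurable[OF m])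
  have "integrable lebesgue (\<lambda>x. (norm (g0 x))\<^sup>2)"
  proof (rule integrableI_bounded[OF meas])
    show "(\<integral>\<^sup>+x. ennreal (norm ((norm (g0 x))\<^sup>2)) \<partial>lebesgue) < \<infinity>"
      using le_less_trans[OF le ennreal_less_top] by simp
  qed
  then have s: "sq_integrable g0" using m by (simp add: sq_integrable_def)
  have K0: "0 \<le> K0"
    by (rule LIMSEQ_le_const[OF Kl]) (intro exI allI impI order_trans[OF zero_le_power2 K])
  have "ennreal ((norm (abs_Lsq g0))\<^sup>2) \<le> ennreal K0"
    using le nn_integral_eq_integral[OF sq_integrable_integrable[OF s]] unfolding norm_abs[OF s] by simp
  then show ?thesis using s K0 by (simp add: ennreal_le_iff)
qed

text \<open>Squared distances of representatives converge to zero in \<open>L\<^sup>1\<close>, and convergence in \<open>L\<^sup>1\<close> implies convergence almost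
everywhere along a subsequence.\<close>

lemma Lsq_AE_subseq:
  fixes X :: "nat \<Rightarrow> ('a::euclidean_space, 'b::euclidean_space) Lsq"
  assumes "X \<longlonglongrightarrow> L"
  shows "\<exists>r. strict_mono (r::nat \<Rightarrow> nat) \<and> (AE x in lebesgue. (\<lambda>n. repr (X (r n)) x) \<longlonglongrightarrow> repr L x)"
proof -
  define h where "h n x = (norm (repr (X n) x - repr L x))\<^sup>2" for n x
  have s: "sq_integrable (\<lambda>x. repr (X n) x - repr L x)" for n by (intro sq_integrable_diff sq_integrable_repr)
  have int: "integrable lebesgue (h n)" for n unfolding h_def using sq_integrable_integrable[OF s] .
  have "(\<integral>x. norm (h n x) \<partial>lebesgue) = (norm (X n - L))\<^sup>2" for n
    using norm_abs[OF s, of n] abs_diff[OF sq_integrable_repr sq_integrable_repr, of "X n" L] by (simp add: h_def abs_repr)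
  moreover have "(\<lambda>n. (norm (X n - L))\<^sup>2) \<longlonglongrightarrow> 0"
    using tendsto_power[OF tendsto_norm_zero[OF LIM_zero[OF assms]], of 2] by simp
  ultimately have "(\<lambda>n. \<integral>x. norm (h n x) \<partial>lebesgue) \<longlonglongrightarrow> 0" by simp
  then obtain r where r: "strict_mono (r::nat \<Rightarrow> nat)" "AE x in lebesgue. (\<lambda>n. h (r n) x) \<longlonglongrightarrow> 0"
    using tendsto_L1_AE_subseq[of lebesgue h, OF int] by blast
  have "AE x in lebesgue. (\<lambda>n. repr (X (r n)) x) \<longlonglongrightarrow> repr L x"
    using r(2)
  proof eventually_elim
    case (elim x)
    then have "(\<lambda>n. sqrt (h (r n) x)) \<longlonglongrightarrow> sqrt 0" by (rule tendsto_real_sqrt)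
    then show ?case unfolding h_def by (simp add: tendsto_norm_zero_iff LIM_zero_iff)
  qed
  with r(1) show ?thesis by blast
qed

text \<open>Riesz-Fischer. Along a subsequence with \<open>\<parallel>f (k+1) - f k\<parallel> \<le> 4\<^sup>-\<^sup>k\<close> the series of
\<open>4\<^sup>k |f (k+1) - f k|\<^sup>2\<close> has a finite integral. So its terms are bounded at almost every point, which makes the
increments there geometrically small, and Fatou's lemma upgrades the pointwise limit to a limit in norm.\<close>

lemma Lsq_Cauchy_convergent:
  fixes X :: "nat \<Rightarrow> ('a::euclidean_space, 'b::euclidean_space) Lsq"
  assumes X: "Cauchy X"
  shows "convergent X"
proof -
  have "\<exists>N. \<forall>m\<ge>N. \<forall>n\<ge>N. dist (X m) (X n) < (1/4) ^ k" for k :: nat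
    using metric_CauchyD[OF X, of "(1/4) ^ k"] by simp
  then obtain N where N: "\<And>k m n. m \<ge> N k \<Longrightarrow> n \<ge> N k \<Longrightarrow> dist (X m) (X n) < (1/4) ^ k" by metis
  \<comment> \<open>The summand \<open>k\<close> makes \<open>r\<close> strictly increasing.\<close>
  define r where "r k = Max (N ` {..k}) + k" for k
  have rN: "r k \<ge> N j" if "j \<le> k" for j k
    unfolding r_def using that by (intro trans_le_add1 Max_ge) auto
  have r: "strict_mono r"
  proof (rule strict_monoI_Suc)
    fix k
    have "Max (N ` {..k}) \<le> Max (N ` {..Suc k})" by (intro Max_mono) auto
    then show "r k < r (Suc k)" unfolding r_def by linarith
  qed
  define f where "f k = repr (X (r k))" for k
  have near: "norm (abs_Lsq (\<lambda>x. f m x - f n x)) < (1/4) ^ k" if "m \<ge> k" "n \<ge> k" for m n k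
    using N[OF rN[OF that(1)] rN[OF that(2)]] abs_diff[OF sq_integrable_repr sq_integrable_repr, of "X (r m)" "X (r n)"]
    unfolding f_def by (simp add: abs_repr dist_norm)
  have sd: "sq_integrable (\<lambda>x. f m x - f n x)" for m n unfolding f_def by (intro sq_integrable_diff sq_integrable_repr)
  have fm: "f k \<in> borel_measurable lebesgue" for k unfolding f_def by (intro sq_integrable_measurable sq_integrable_repr)
  define h where "h k x = 4 ^ k * (norm (f (Suc k) x - f k x))\<^sup>2" for k x
  have hm0: "h k \<in> borel_measurable lebesgue" for k
    unfolding h_def by (intro borel_measurable_times norm_square_measurable borel_measurable_diff fm borel_measurable_const)
  have hm: "(\<lambda>x. ennreal (h k x)) \<in> borel_measurable lebesgue" for k
    by (rule measurable_compose[OF hm0 measurable_ennreal])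
  have hint: "(\<integral>\<^sup>+x. ennreal (h k x) \<partial>lebesgue) \<le> ennreal ((1/4) ^ k)" for k
  proof -
    have "(\<integral>\<^sup>+x. ennreal (h k x) \<partial>lebesgue) = ennreal (\<integral>x. h k x \<partial>lebesgue)"
      unfolding h_def by (intro nn_integral_eq_integral integrable_mult_right sq_integrable_integrable[OF sd]) auto
    also have "(\<integral>x. h k x \<partial>lebesgue) = 4 ^ k * (norm (abs_Lsq (\<lambda>x. f (Suc k) x - f k x)))\<^sup>2"
      unfolding h_def norm_abs[OF sd] by simp
    also have "\<dots> \<le> 4 ^ k * ((1/4) ^ k)\<^sup>2"
      by (intro mult_left_mono power_mono less_imp_le[OF near]) auto
    also have "\<dots> = (1/4) ^ k" by (simp add: power2_eq_square power_divide)
    finally show ?thesis by (simp add: ennreal_leI)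
  qed
  have "(\<integral>\<^sup>+x. (\<Sum>k. ennreal (h k x)) \<partial>lebesgue) = (\<Sum>k. \<integral>\<^sup>+x. ennreal (h k x) \<partial>lebesgue)"
    by (rule nn_integral_suminf[OF hm])
  also have "\<dots> \<le> (\<Sum>k. ennreal ((1/4) ^ k))"
    by (intro suminf_le hint) auto
  also have "\<dots> = ennreal (\<Sum>k. (1/4) ^ k)"
    by (rule suminf_ennreal2) (auto intro: summable_geometric)
  also have "\<dots> < \<infinity>" by simp
  finally have "AE x in lebesgue. (\<Sum>k. ennreal (h k x)) \<noteq> \<infinity>"
    using hm0 by (intro nn_integral_PInf_AE) (measurable, auto)
  then have conv: "AE x in lebesgue. convergent (\<lambda>k. f k x)"
  proof eventually_elim
    case (elim x)
    have sm: "summable (\<lambda>k. h k x)" using elim by (intro summable_suminf_not_top) (auto simp: h_def)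
    have "Bseq (\<lambda>k. h k x)" by (rule convergent_imp_Bseq[OF convergentI[OF summable_LIMSEQ_zero[OF sm]]])
    then obtain B where B: "0 < B" "\<And>k. \<bar>h k x\<bar> \<le> B" by (auto simp: Bseq_def)
    have "norm (f (Suc k) x - f k x) \<le> sqrt B * (1/2) ^ k" for k
    proof -
      have "4 ^ k * (norm (f (Suc k) x - f k x))\<^sup>2 \<le> B" using B(2)[of k] unfolding h_def by simp
      moreover have e: "((2::real) ^ k)\<^sup>2 = 4 ^ k" by (simp add: power2_eq_square flip: power_mult_distrib)
      have "(2 ^ k * norm (f (Suc k) x - f k x))\<^sup>2 = 4 ^ k * (norm (f (Suc k) x - f k x))\<^sup>2"
        unfolding power_mult_distrib e ..
      ultimately have "(2 ^ k * norm (f (Suc k) x - f k x))\<^sup>2 \<le> B" by simp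
      then have "2 ^ k * norm (f (Suc k) x - f k x) \<le> sqrt B" by (rule real_le_rsqrt)
      then show ?thesis by (simp add: power_divide mult.commute pos_le_divide_eq)
    qed
    note bd = this
    have "summable (\<lambda>k. f (Suc k) x - f k x)"
    proof (rule summable_comparison_test'[where g = "\<lambda>k. sqrt B * (1/2) ^ k" and N = 0])
      show "summable (\<lambda>k. sqrt B * (1/2) ^ k)" by (intro summable_mult summable_geometric) simp
    qed (rule bd)
    then have "(\<lambda>k. f k x - f 0 x) \<longlonglongrightarrow> (\<Sum>k. f (Suc k) x - f k x)"
      unfolding sum_lessThan_telescope[of "\<lambda>k. f k x", symmetric] by (rule summable_LIMSEQ)
    from tendsto_add[OF this tendsto_const[of "f 0 x"]] show ?case
      unfolding convergent_def by (intro exI) simp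
  qed
  define f0 where "f0 x = lim (\<lambda>k. f k x)" for x
  have lim0: "AE x in lebesgue. (\<lambda>k. f k x) \<longlonglongrightarrow> f0 x"
    using conv by eventually_elim (simp add: f0_def convergent_LIMSEQ_iff)
  have f0m: "f0 \<in> borel_measurable lebesgue"
    unfolding f0_def by (rule borel_measurable_lim_metric[OF fm])
  have est: "sq_integrable (\<lambda>x. f k x - f0 x) \<and> (norm (abs_Lsq (\<lambda>x. f k x - f0 x)))\<^sup>2 \<le> ((1/4) ^ k)\<^sup>2" for k
  proof (rule sq_integrable_fatou[where g = "\<lambda>m x. f k x - f (m + k) x" and K = "\<lambda>_. ((1/4) ^ k)\<^sup>2"])
    show "sq_integrable (\<lambda>x. f k x - f (m + k) x)" for m by (rule sd)
    show "(\<lambda>x. f k x - f0 x) \<in> borel_measurable lebesgue" by (intro borel_measurable_diff fm f0m)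
    show "AE x in lebesgue. (\<lambda>m. f k x - f (m + k) x) \<longlonglongrightarrow> f k x - f0 x"
      using lim0 by eventually_elim (intro tendsto_diff tendsto_const LIMSEQ_ignore_initial_segment)
    show "(norm (abs_Lsq (\<lambda>x. f k x - f (m + k) x)))\<^sup>2 \<le> ((1/4) ^ k)\<^sup>2" for m
      by (intro power_mono less_imp_le[OF near]) auto
  qed simp
  have "sq_integrable (f 0)" unfolding f_def by (rule sq_integrable_repr)
  then have "sq_integrable (\<lambda>x. f 0 x - (f 0 x - f0 x))" by (rule sq_integrable_diff[OF _ conjunct1[OF est[of 0]]])
  then have s0: "sq_integrable f0" by simp
  have "(X \<circ> r) \<longlonglongrightarrow> abs_Lsq f0"
  proof (rule metric_tendsto_imp_tendsto)
    show "(\<lambda>k. (1/4::real) ^ k) \<longlonglongrightarrow> 0" by (intro LIMSEQ_power_zero) simp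
    have "norm (X (r k) - abs_Lsq f0) \<le> (1/4) ^ k" for k
    proof -
      have "X (r k) - abs_Lsq f0 = abs_Lsq (\<lambda>x. f k x - f0 x)"
        using abs_diff[OF sq_integrable_repr s0, of "X (r k)"] by (simp add: abs_repr f_def)
      moreover have "norm (abs_Lsq (\<lambda>x. f k x - f0 x)) \<le> (1/4) ^ k"
        by (rule power2_le_imp_le) (use est[of k] in auto)
      ultimately show ?thesis by simp
    qed
    then show "\<forall>\<^sub>F k in sequentially. dist ((X \<circ> r) k) (abs_Lsq f0) \<le> dist ((1/4::real) ^ k) 0"
      by (intro always_eventually allI) (simp add: dist_norm)
  qed
  then have "X \<longlonglongrightarrow> abs_Lsq f0" using Cauchy_converges_subseq[OF X r] by (simp add: o_def)
  then show "convergent X" unfolding convergent_def by blast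
qed

instance Lsq :: (euclidean_space, euclidean_space) complete_space
  by standard (rule Lsq_Cauchy_convergent)

section \<open>Smooth functions and the fundamental lemma of the calculus of variations\<close>

lemma class_C_differentiable: "class_C (Suc k) f \<Longrightarrow> f differentiable (at x)"
  by simp

lemma class_C_continuous: "class_C k f \<Longrightarrow> continuous_on UNIV f"
  by (cases k) (auto intro!: continuous_at_imp_continuous_on differentiable_imp_continuous_within)

lemma class_C_Suc_D: "class_C (Suc k) f \<Longrightarrow> class_C k f"
proof (induction k arbitrary: f)
  case 0
  then show ?case using class_C_continuous by fastforce
next
  case (Suc k)
  have "f differentiable (at x)" for x using Suc.prems by simp
  moreover have "class_C k (\<lambda>x. frechet_derivative f (at x) b)" if "b \<in> Basis" for b
    using Suc.prems Suc.IH[of "\<lambda>x. frechet_derivative f (at x) b"] that by simp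
  ultimately show ?case by simp
qed

lemma class_C_SucI:
  assumes "\<And>x. (f has_derivative f' x) (at x)" "\<And>b. b \<in> Basis \<Longrightarrow> class_C k (\<lambda>x. f' x b)"
  shows "class_C (Suc k) f"
proof -
  have "frechet_derivative f (at x) = f' x" for x using frechet_derivative_at[OF assms(1)] by simp
  then show ?thesis using assms unfolding class_C.simps by (auto simp: differentiable_def)
qed

lemma class_C_has_derivative:
  "class_C (Suc k) f \<Longrightarrow> (f has_derivative frechet_derivative f (at x)) (at x)"
  using frechet_derivative_works[of f "at x"] class_C_differentiable by blast

lemma class_C_const: "class_C k (\<lambda>_. c)"
proof (induction k arbitrary: c)
  case (Suc k)
  show ?case by (rule class_C_SucI[where f' = "\<lambda>_ _. 0"]) (use Suc in auto)
qed simp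

lemma class_C_add: "class_C k f \<Longrightarrow> class_C k g \<Longrightarrow> class_C k (\<lambda>x. f x + g x)"
proof (induction k arbitrary: f g)
  case 0 then show ?case by (simp add: continuous_on_add)
next
  case (Suc k)
  show ?case
  proof (rule class_C_SucI)
    show "((\<lambda>x. f x + g x) has_derivative (\<lambda>h. frechet_derivative f (at x) h + frechet_derivative g (at x) h)) (at x)" for x
      by (intro has_derivative_add class_C_has_derivative[OF Suc.prems(1)] class_C_has_derivative[OF Suc.prems(2)])
    show "class_C k (\<lambda>x. frechet_derivative f (at x) b + frechet_derivative g (at x) b)" if "b \<in> Basis" for b
      using Suc.prems that by (intro Suc.IH) auto
  qed
qed

text \<open>All products that occur (of scalars, and of scalars with vectors) are bounded bilinear maps, so one product rule covers
them.\<close>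

lemma class_C_bilinear:
  assumes "bounded_bilinear p"
  shows "class_C k f \<Longrightarrow> class_C k g \<Longrightarrow> class_C k (\<lambda>x. p (f x) (g x))"
proof (induction k arbitrary: f g)
  case 0 then show ?case using bounded_bilinear.continuous_on[OF assms] by simp
next
  case (Suc k)
  show ?case
  proof (rule class_C_SucI)
    show "((\<lambda>x. p (f x) (g x)) has_derivative
        (\<lambda>h. p (f x) (frechet_derivative g (at x) h) + p (frechet_derivative f (at x) h) (g x))) (at x)" for x
      by (intro bounded_bilinear.FDERIV[OF assms] class_C_has_derivative[OF Suc.prems(1)] class_C_has_derivative[OF Suc.prems(2)])
    show "class_C k (\<lambda>x. p (f x) (frechet_derivative g (at x) b) + p (frechet_derivative f (at x) b) (g x))"
      if "b \<in> Basis" for b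
      using Suc.prems that class_C_Suc_D[OF Suc.prems(1)] class_C_Suc_D[OF Suc.prems(2)]
      by (intro class_C_add Suc.IH) auto
  qed
qed

lemmas class_C_mult = class_C_bilinear[OF bounded_bilinear_mult]
lemmas class_C_scaleR = class_C_bilinear[OF bounded_bilinear_scaleR]

lemma class_C_affine_coordinate:
  fixes f :: "real \<Rightarrow> real"
  shows "class_C k f \<Longrightarrow> class_C k (\<lambda>x::real^'n. f (c + d * x $ j))"
proof (induction k arbitrary: f)
  case 0
  then show ?case by (auto intro!: continuous_on_compose2[of UNIV f] continuous_intros)
next
  case (Suc k)
  show ?case
  proof (rule class_C_SucI)
    have c: "((\<lambda>x::real^'n. x $ j) has_derivative (\<lambda>h. h $ j)) (at x)" for x
      by (rule bounded_linear_imp_has_derivative[OF bounded_linear_vec_nth])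
    show "((\<lambda>x::real^'n. f (c + d * x $ j)) has_derivative
      (\<lambda>h. frechet_derivative f (at (c + d * x $ j)) (d * h $ j))) (at x)" for x
      by (rule has_derivative_compose[where f = "\<lambda>x. c + d * x $ j", OF _ class_C_has_derivative[OF Suc.prems]])
         (auto intro!: derivative_eq_intros c)
    have lin: "frechet_derivative f (at t) s = frechet_derivative f (at t) 1 * s" for t s
      using linear_frechet_derivative[OF class_C_differentiable[OF Suc.prems], of t]
      by (metis linear_cmul real_scaleR_def mult.commute mult.right_neutral)
    have "class_C k (\<lambda>x::real^'n. frechet_derivative f (at (c + d * x $ j)) 1)"
      by (rule Suc.IH[of "\<lambda>t. frechet_derivative f (at t) 1"]) (use Suc.prems in simp)
    then show "class_C k (\<lambda>x::real^'n. frechet_derivative f (at (c + d * x $ j)) (d * b $ j))" for b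
      unfolding lin[of _ "d * b $ j"] by (intro class_C_mult class_C_const)
  qed
qed

text \<open>The function \<open>exp (-1/t)\<close> for \<open>t > 0\<close>, extended by zero, together with all its derivatives: they have the form
\<open>p(1/t) exp (-1/t)\<close> with a polynomial \<open>p\<close>.\<close>

definition flat_poly :: "real poly \<Rightarrow> real \<Rightarrow> real" where
  "flat_poly p t = (if 0 < t then poly p (1 / t) * exp (- (1 / t)) else 0)"

lemma poly_exp_tendsto_0: "((\<lambda>s. poly p s * exp (- s)) \<longlongrightarrow> 0) at_top" for p :: "real poly"
proof -
  have "((\<lambda>s. \<Sum>i\<le>degree p. coeff p i * (s ^ i / exp s)) \<longlongrightarrow> (\<Sum>i\<le>degree p. coeff p i * 0)) at_top"
    by (intro tendsto_sum tendsto_mult tendsto_const tendsto_power_div_exp_0)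
  then show ?thesis
    by (simp add: poly_altdef sum_distrib_right exp_minus divide_inverse mult.assoc)
qed

lemma flat_poly_tendsto_0: "(flat_poly p \<longlongrightarrow> 0) (at 0)"
proof -
  have "filterlim (\<lambda>t::real. 1 / t) at_top (at_right 0)" by real_asymp
  from filterlim_compose[OF poly_exp_tendsto_0 this]
  have "((\<lambda>t. poly p (1 / t) * exp (- (1 / t))) \<longlongrightarrow> 0) (at_right 0)" .
  then have r: "(flat_poly p \<longlongrightarrow> 0) (at_right 0)"
  proof (rule Lim_transform_eventually)
    show "\<forall>\<^sub>F t in at_right 0. poly p (1 / t) * exp (- (1 / t)) = flat_poly p t"
      using eventually_at_right_less[of "0::real"] by eventually_elim (simp add: flat_poly_def)
  qed
  have "((\<lambda>_. 0) \<longlongrightarrow> (0::real)) (at_left (0::real))" by simp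
  then have "(flat_poly p \<longlongrightarrow> 0) (at_left 0)"
    by (rule Lim_transform_eventually) (auto simp: flat_poly_def eventually_at_filter)
  with r show ?thesis by (simp add: filterlim_at_split)
qed

text \<open>For \<open>t > 0\<close> the derivative of \<open>p(1/t) exp (-1/t)\<close> is \<open>t\<^sup>-\<^sup>2 (p - p')(1/t) exp (-1/t)\<close>, again of the same form. At
\<open>t = 0\<close> the difference quotient is \<open>s p(s) exp (-s)\<close> with \<open>s = 1/t\<close>, which tends to zero.\<close>

lemma flat_poly_has_derivative:
  "(flat_poly p has_real_derivative flat_poly ([:0, 0, 1:] * (p - pderiv p)) t) (at t)"
proof -
  consider "t < 0" | "t = 0" | "0 < t" by linarith
  then show ?thesis
  proof cases
    case 1
    have "((\<lambda>_. 0) has_real_derivative 0) (at t)" by simp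
    then have "(flat_poly p has_real_derivative 0) (at t)"
      by (rule has_field_derivative_transform_within_open[of _ _ _ "{..<0}"]) (use 1 in \<open>auto simp: flat_poly_def\<close>)
    then show ?thesis using 1 by (simp add: flat_poly_def)
  next
    case 2
    have "((\<lambda>h. flat_poly ([:0, 1:] * p) h) \<longlongrightarrow> 0) (at 0)" by (rule flat_poly_tendsto_0)
    then have "((\<lambda>h. (flat_poly p (0 + h) - flat_poly p 0) / h) \<longlongrightarrow> 0) (at 0)"
      by (rule Lim_transform_eventually) (auto simp: flat_poly_def eventually_at_filter)
    then have "(flat_poly p has_real_derivative 0) (at 0)" by (simp only: DERIV_def)
    then show ?thesis using 2 by (simp add: flat_poly_def)
  next
    case 3
    have "((\<lambda>t. poly p (1 / t) * exp (- (1 / t))) has_real_derivative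
      poly ([:0, 0, 1:] * (p - pderiv p)) (1 / t) * exp (- (1 / t))) (at t)"
      using 3 by (auto intro!: derivative_eq_intros simp: power2_eq_square field_simps)
    then have "(flat_poly p has_real_derivative
      poly ([:0, 0, 1:] * (p - pderiv p)) (1 / t) * exp (- (1 / t))) (at t)"
      by (rule has_field_derivative_transform_within_open[of _ _ _ "{0<..}"]) (use 3 in \<open>auto simp: flat_poly_def\<close>)
    then show ?thesis using 3 by (simp add: flat_poly_def)
  qed
qed

lemma class_C_flat_poly: "class_C k (flat_poly p)"
proof (induction k arbitrary: p)
  case 0
  then show ?case
    using flat_poly_has_derivative by (auto intro!: continuous_at_imp_continuous_on DERIV_isCont)
next
  case (Suc k)
  show ?case
  proof (rule class_C_SucI)
    show "(flat_poly p has_derivative (\<lambda>h. flat_poly ([:0, 0, 1:] * (p - pderiv p)) x * h)) (at x)" for x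
      using flat_poly_has_derivative[of p x] by (simp add: has_field_derivative_def)
    show "class_C k (\<lambda>x. flat_poly ([:0, 0, 1:] * (p - pderiv p)) x * b)" for b
      by (intro class_C_mult class_C_const Suc.IH)
  qed
qed

text \<open>Smooth functions supported in a box that increase to its indicator function as \<open>n\<close> grows.\<close>

definition box_bump :: "nat \<Rightarrow> real^'n \<Rightarrow> real^'n \<Rightarrow> real^'n \<Rightarrow> real" where
  "box_bump n a b x = (\<Prod>j\<in>UNIV. flat_poly 1 (real n * (x $ j - a $ j)) * flat_poly 1 (real n * (b $ j - x $ j)))"

lemma flat_poly_1: "0 \<le> flat_poly 1 t" "flat_poly 1 t \<le> 1" "t \<le> 0 \<Longrightarrow> flat_poly 1 t = 0"
  by (auto simp: flat_poly_def)

lemma class_C_prod: "finite S \<Longrightarrow> (\<And>i. i \<in> S \<Longrightarrow> class_C k (f i)) \<Longrightarrow> class_C k (\<lambda>x. \<Prod>i\<in>S. (f i x :: real))"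
  by (induction S rule: finite_induct) (auto intro: class_C_const class_C_mult)

lemma class_C_box_bump: "class_C k (box_bump n a b :: real^'n \<Rightarrow> real)"
proof -
  have *: "class_C k (\<lambda>x::real^'n. flat_poly 1 (c + d * x $ j))" for c d j
    by (rule class_C_affine_coordinate[OF class_C_flat_poly])
  have "class_C k (\<lambda>x::real^'n. flat_poly 1 (real n * (x $ j - a $ j)) * flat_poly 1 (real n * (b $ j - x $ j)))" for j
    using class_C_mult[OF *[of "- real n * a $ j" "real n" j] *[of "real n * b $ j" "- real n" j]]
    by (simp add: algebra_simps)
  then show ?thesis unfolding box_bump_def by (intro class_C_prod) auto
qed

lemma box_bump_bounds: "0 \<le> box_bump n a b x" "box_bump n a b x \<le> 1"
  unfolding box_bump_def
  by (auto intro!: prod_nonneg prod_le_1 mult_nonneg_nonneg mult_le_one flat_poly_1)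

lemma box_bump_outside: "x \<notin> box a b \<Longrightarrow> box_bump n a b x = 0"
proof -
  assume "x \<notin> box a b"
  then obtain j where "x $ j \<le> a $ j \<or> b $ j \<le> x $ j" by (auto simp: mem_box_cart not_less)
  then have "flat_poly 1 (real n * (x $ j - a $ j)) * flat_poly 1 (real n * (b $ j - x $ j)) = 0"
    using flat_poly_1(3) by (auto simp: mult_nonneg_nonpos)
  then show ?thesis unfolding box_bump_def by (intro prod_zero) auto
qed

lemma box_bump_tendsto:
  fixes x :: "real^'n"
  shows "(\<lambda>n. box_bump n a b x) \<longlonglongrightarrow> indicator (box a b) x"
proof (cases "x \<in> box a b")
  case True
  have *: "(\<lambda>n. flat_poly 1 (real n * t)) \<longlonglongrightarrow> 1" if "0 < t" for t
  proof -
    have "(\<lambda>n. exp (- (1 / (real n * t)))) \<longlonglongrightarrow> 1" using that by real_asymp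
    moreover have "\<forall>\<^sub>F n in sequentially. exp (- (1 / (real n * t))) = flat_poly 1 (real n * t)"
      using eventually_gt_at_top[of 0] by eventually_elim (use that in \<open>auto simp: flat_poly_def\<close>)
    ultimately show ?thesis by (rule Lim_transform_eventually)
  qed
  have "(\<lambda>n. box_bump n a b x) \<longlonglongrightarrow> (\<Prod>j\<in>(UNIV::'n set). 1 * 1)"
    unfolding box_bump_def by (intro tendsto_prod tendsto_mult *) (use True in \<open>auto simp: mem_box_cart\<close>)
  then show ?thesis using True by simp
next
  case False
  then show ?thesis by (simp add: box_bump_outside)
qed

lemma box_bump_test_function:
  assumes "cbox a b \<subseteq> D"
  shows "box_bump n a b \<in> test_functions D"
  unfolding test_functions_def mem_Collect_eq
proof (intro conjI allI exI[of _ "cbox a b"] impI)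
  show "class_C k (box_bump n a b)" for k by (rule class_C_box_bump)
  show "box_bump n a b x = 0" if "x \<notin> cbox a b" for x
    by (rule box_bump_outside) (use that box_subset_cbox in blast)
qed (use assms in auto)

text \<open>Boxes form an intersection-stable generator of the Borel sets, so the integral of \<open>f\<close> over every Borel set
vanishes.\<close>

lemma AE_zero_if_box_integrals_zero:
  fixes f :: "'a::euclidean_space \<Rightarrow> real"
  assumes int: "integrable lebesgue f"
    and zero: "\<And>a b. (\<integral>x. indicator (box a b) x * f x \<partial>lebesgue) = 0"
  shows "AE x in lebesgue. f x = 0"
proof -
  obtain g where g: "g \<in> borel_measurable lborel" and fg: "AE x in lborel. f x = g x"
    using completion_ex_borel_measurable_real[of f lborel] borel_measurable_integrable[OF int] by blast
  have fgL: "AE x in lebesgue. f x = g x" using fg by (rule AE_completion)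
  have gm: "g \<in> borel_measurable lebesgue" by (rule measurable_completion[OF g])
  have gL: "integrable lebesgue g"
    by (rule iffD1[OF integrable_cong_AE[OF borel_measurable_integrable[OF int] gm fgL] int])
  have gi: "integrable lborel g" using gL integrable_completion[of g lborel] g by simp
  have iA: "integrable lborel (\<lambda>x. indicator A x * g x)" if "A \<in> sets borel" for A
    using integrable_mult_indicator[OF _ gi, of A] that by simp
  have box0: "(\<integral>x. indicator (box a b) x * g x \<partial>lborel) = 0" for a b
  proof -
    have m: "(\<lambda>x. indicator (box a b) x * g x) \<in> borel_measurable lborel"
      using iA[of "box a b"] by (intro borel_measurable_integrable) simp
    have "(\<integral>x. indicator (box a b) x * g x \<partial>lborel) = (\<integral>x. indicator (box a b) x * g x \<partial>lebesgue)"
      using integral_completion[OF m] by simp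
    also have "\<dots> = (\<integral>x. indicator (box a b) x * f x \<partial>lebesgue)"
    proof (rule integral_cong_AE)
      show "(\<lambda>x. indicator (box a b) x * g x) \<in> borel_measurable lebesgue"
        by (rule measurable_completion[OF m])
      show "(\<lambda>x. indicator (box a b) x * f x) \<in> borel_measurable lebesgue"
        by (intro borel_measurable_times borel_measurable_indicator borel_measurable_integrable[OF int]) simp
      show "AE x in lebesgue. indicator (box a b) x * g x = indicator (box a b) x * f x"
        using fgL by eventually_elim simp
    qed
    finally show ?thesis using zero by simp
  qed
  have UNIV0: "(\<integral>x. g x \<partial>lborel) = 0"
  proof -
    have "(\<lambda>n. \<integral>x. indicator (box (- real n *\<^sub>R One) (real n *\<^sub>R One)) x * g x \<partial>lborel) \<longlonglongrightarrow> (\<integral>x. g x \<partial>lborel)"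
    proof (rule integral_dominated_convergence[where w = "\<lambda>x. \<bar>g x\<bar>"])
      show "integrable lborel (\<lambda>x. \<bar>g x\<bar>)" using gi by simp
      show "(\<lambda>x. indicator (box (- real n *\<^sub>R One) (real n *\<^sub>R One)) x * g x) \<in> borel_measurable lborel" for n
        using g by (intro borel_measurable_times borel_measurable_indicator) auto
      show "AE x in lborel. (\<lambda>n. indicator (box (- real n *\<^sub>R One) (real n *\<^sub>R One)) x * g x) \<longlonglongrightarrow> g x"
      proof (rule AE_I2)
        fix x :: 'a
        obtain N :: nat where N: "norm x < real N" using reals_Archimedean2 by blast
        have "\<forall>\<^sub>F n in sequentially. indicator (box (- real n *\<^sub>R One) (real n *\<^sub>R One)) x * g x = g x"
          using eventually_ge_at_top[of N]
        proof eventually_elim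
          case (elim n)
          have "\<bar>x \<bullet> i\<bar> < real n" if "i \<in> Basis" for i
            using Basis_le_norm[OF that, of x] N elim by linarith
          then have "x \<in> box (- real n *\<^sub>R One) (real n *\<^sub>R One)" by (auto simp: mem_box abs_less_iff minus_less_iff)
          then show ?case by simp
        qed
        then show "(\<lambda>n. indicator (box (- real n *\<^sub>R One) (real n *\<^sub>R One)) x * g x) \<longlonglongrightarrow> g x"
          by (rule tendsto_eventually)
      qed
    qed (use g in \<open>auto simp: abs_mult indicator_def\<close>)
    then show ?thesis unfolding box0 by (simp add: LIMSEQ_const_iff)
  qed
  have "(\<integral>x. indicator A x * g x \<partial>lborel) = 0" if "A \<in> sets borel" for A
  proof -
    have Int: "Int_stable (range (\<lambda>(a, b). box a b :: 'a set))"
    proof (rule Int_stableI)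
      fix X Y :: "'a set" assume "X \<in> range (\<lambda>(a, b). box a b)" "Y \<in> range (\<lambda>(a, b). box a b)"
      then obtain a b c d where "X = box a b" "Y = box c d" by auto
      then show "X \<inter> Y \<in> range (\<lambda>(a, b). box a b)" by (auto simp: box_Int_box)
    qed
    have "A \<in> sigma_sets UNIV (range (\<lambda>(a, b). box a b))"
      using that unfolding borel_eq_box by (simp add: sets_measure_of)
    have "range (\<lambda>(a, b). box a b) \<subseteq> Pow (UNIV :: 'a set)" by simp
    from Int this \<open>A \<in> sigma_sets UNIV (range (\<lambda>(a, b). box a b))\<close> show ?thesis
    proof (induction rule: sigma_sets_induct_disjoint)
      case (basic A) then show ?case using box0 by auto
    next
      case empty show ?case by simp
    next
      case (compl A)
      then have A: "A \<in> sets borel" unfolding borel_eq_box by (simp add: sets_measure_of)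
      have "(\<integral>x. indicator (UNIV - A) x * g x \<partial>lborel) = (\<integral>x. g x - indicator A x * g x \<partial>lborel)"
        by (intro Bochner_Integration.integral_cong) (auto simp: indicator_def)
      also have "\<dots> = 0" using compl UNIV0 Bochner_Integration.integral_diff[OF gi iA[OF A]] by simp
      finally show ?case .
    next
      case (union A)
      then have A: "A i \<in> sets borel" for i unfolding borel_eq_box by (auto simp: sets_measure_of)
      have "(\<integral>x. indicator (\<Union>i. A i) x * g x \<partial>lborel) = (\<Sum>i. \<integral>x. indicator (A i) x * g x \<partial>lborel)"
      proof -
        have "set_integrable lborel (\<Union>i. A i) g"
          unfolding set_integrable_def using iA[of "\<Union>i. A i"] A by auto
        then show ?thesis
          using lebesgue_integral_countable_add[of A lborel g] A union
          unfolding set_lebesgue_integral_def by (auto simp: disjoint_family_on_def)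
      qed
      then show ?case using union by simp
    qed
  qed
  then have "AE x in lborel. g x = 0"
    by (intro sigma_finite_measure.density_zero[OF lborel.sigma_finite_measure_axioms gi]) (simp add: set_lebesgue_integral_def)
  then have "AE x in lebesgue. g x = 0" by (rule AE_completion)
  with fgL show ?thesis by eventually_elim simp
qed

text \<open>Testing with bumps and passing to the limit gives a vanishing integral over every box whose closure lies in \<open>D\<close>.
Countably many such boxes cover \<open>D\<close> up to a null set.\<close>

lemma fundamental_lemma:
  fixes g :: "real^2 \<Rightarrow> real"
  assumes D: "open D" and g: "integrable (lebesgue_on D) g"
    and zero: "\<And>\<psi>. \<psi> \<in> test_functions D \<Longrightarrow> (\<integral>x. g x * \<psi> x \<partial>lebesgue_on D) = 0"
  shows "AE x in lebesgue_on D. g x = 0"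
proof -
  have DL: "D \<in> sets lebesgue" using D by (simp add: lborelD)
  define G where "G x = indicator D x * g x" for x
  have gL: "integrable lebesgue G"
    unfolding G_def using g DL by (simp add: integrable_restrict_space)
  have box0: "(\<integral>x. indicator (box a b) x * G x \<partial>lebesgue) = 0" if ab: "cbox a b \<subseteq> D" for a b
  proof -
    have "(\<lambda>n. \<integral>x. box_bump n a b x * G x \<partial>lebesgue) \<longlonglongrightarrow>
        (\<integral>x. indicator (box a b) x * G x \<partial>lebesgue)"
    proof (rule integral_dominated_convergence[where w = "\<lambda>x. \<bar>G x\<bar>"])
      show "integrable lebesgue (\<lambda>x. \<bar>G x\<bar>)" using gL by (rule integrable_abs)
      show "(\<lambda>x. indicator (box a b) x * G x) \<in> borel_measurable lebesgue"
        by (intro borel_measurable_times borel_measurable_indicator borel_measurable_integrable[OF gL]) simp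
      show "(\<lambda>x. box_bump n a b x * G x) \<in> borel_measurable lebesgue" for n
      proof (intro borel_measurable_times borel_measurable_integrable[OF gL])
        have "box_bump n a b \<in> borel_measurable borel"
          by (rule borel_measurable_continuous_onI[OF class_C_continuous[OF class_C_box_bump]])
        then show "box_bump n a b \<in> borel_measurable lebesgue"
          by (simp add: measurable_completion)
      qed
      show "AE x in lebesgue. (\<lambda>n. box_bump n a b x * G x) \<longlonglongrightarrow> indicator (box a b) x * G x"
        by (intro AE_I2 tendsto_mult tendsto_const box_bump_tendsto)
      show "AE x in lebesgue. norm (box_bump n a b x * G x) \<le> \<bar>G x\<bar>" for n
        using box_bump_bounds[of n a b]
        by (intro AE_I2) (simp only: real_norm_def abs_mult mult_left_le_one_le abs_ge_zero abs_of_nonneg)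
    qed
    moreover have "(\<integral>x. box_bump n a b x * G x \<partial>lebesgue) = 0" for n
    proof -
      have "(\<integral>x. g x * box_bump n a b x \<partial>lebesgue_on D) = 0"
        by (rule zero[OF box_bump_test_function[OF ab]])
      then show ?thesis using DL by (simp add: integral_restrict_space G_def ac_simps)
    qed
    ultimately show ?thesis by (simp add: LIMSEQ_const_iff)
  qed
  have boxAE: "AE x in lebesgue. x \<in> box a b \<longrightarrow> G x = 0" if ab: "cbox a b \<subseteq> D" for a b
  proof -
    have "AE x in lebesgue. indicator (box a b) x * G x = 0"
    proof (rule AE_zero_if_box_integrals_zero)
      show "integrable lebesgue (\<lambda>x. indicator (box a b) x * G x)"
        using integrable_mult_indicator[OF _ gL, of "box a b"] by simp
      fix c d :: "real^2"
      obtain u v where uv: "box c d \<inter> box a b = box u v" by (rule that[OF box_Int_box])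
      show "(\<integral>x. indicator (box c d) x * (indicator (box a b) x * G x) \<partial>lebesgue) = 0"
      proof (cases "box u v = {}")
        case True
        have "(\<lambda>x. indicator (box c d) x * (indicator (box a b) x * G x)) = (\<lambda>_. 0)"
          using True uv by (auto simp: indicator_def fun_eq_iff)
        then show ?thesis by (simp only: integral_zero)
      next
        case False
        have "cbox u v \<subseteq> D"
        proof -
          have "cbox u v = closure (box u v)" using False by (simp add: closure_box)
          also have "\<dots> \<subseteq> closure (box a b)" by (rule closure_mono) (use uv in blast)
          also have "\<dots> \<subseteq> cbox a b" by (rule closure_minimal) (auto simp: box_subset_cbox)
          finally show ?thesis using ab by blast
        qed
        from box0[OF this] show ?thesis
          unfolding uv[symmetric] indicator_inter_arith by (simp add: mult.assoc)
      qed
    qed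
    then show ?thesis by eventually_elim (auto simp: indicator_def)
  qed
  have cboxAE: "AE x in lebesgue. x \<in> cbox a b \<longrightarrow> G x = 0" if ab: "cbox a b \<subseteq> D" for a b
  proof -
    have "negligible (cbox a b - box a b)" by (rule negligible_frontier_interval)
    then have "cbox a b - box a b \<in> null_sets lebesgue" by (simp only: negligible_iff_null_sets)
    then have "AE x in lebesgue. x \<notin> cbox a b - box a b" by (rule AE_not_in)
    with boxAE[OF ab] show ?thesis by eventually_elim auto
  qed
  obtain \<D> where \<D>: "countable \<D>" "\<And>X. X \<in> \<D> \<Longrightarrow> \<exists>a b. X = cbox a b" "\<D> \<subseteq> Pow D" "\<Union>\<D> = D"
    using open_countable_Union_open_cbox[OF D] by metis
  have "AE x in lebesgue. x \<in> X \<longrightarrow> G x = 0" if "X \<in> \<D>" for X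
    using \<D>(2)[OF that] \<D>(3) that cboxAE by blast
  then have "AE x in lebesgue. \<forall>X\<in>\<D>. x \<in> X \<longrightarrow> G x = 0"
    by (intro AE_ball_countable[THEN iffD2, OF \<D>(1)] ballI)
  then have "AE x in lebesgue. x \<in> D \<longrightarrow> g x = 0"
    by eventually_elim (use \<D>(4) in \<open>auto simp: G_def indicator_def\<close>)
  then show ?thesis using DL by (simp add: AE_restrict_space_iff)
qed

section \<open>Translations of compactly supported functions\<close>

text \<open>Functions of class \<open>C\<^sup>1\<close> with compact support. On a Euclidean space the support is compact if and only if the function
vanishes outside some ball.\<close>

definition C1c :: "('a::euclidean_space \<Rightarrow> 'b::euclidean_space) \<Rightarrow> bool" where
  "C1c f \<longleftrightarrow> class_C 1 f \<and> (\<exists>R. \<forall>x. R \<le> norm x \<longrightarrow> f x = 0)"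

lemma C1c_has_derivative: "C1c f \<Longrightarrow> (f has_derivative frechet_derivative f (at x)) (at x)"
  unfolding C1c_def using class_C_has_derivative[of 0 f x] by simp

lemma C1c_continuous: "C1c f \<Longrightarrow> continuous_on UNIV f"
  unfolding C1c_def using class_C_continuous by blast

lemma C1c_derivative_basis:
  assumes "C1c f"
  shows "frechet_derivative f (at x) h = (\<Sum>b\<in>Basis. (h \<bullet> b) *\<^sub>R frechet_derivative f (at x) b)"
proof -
  have lin: "linear (frechet_derivative f (at x))"
    using C1c_has_derivative[OF assms] by (rule has_derivative_linear)
  have "frechet_derivative f (at x) h = frechet_derivative f (at x) (\<Sum>b\<in>Basis. (h \<bullet> b) *\<^sub>R b)"
    by (simp only: euclidean_representation)
  also have "\<dots> = (\<Sum>b\<in>Basis. frechet_derivative f (at x) ((h \<bullet> b) *\<^sub>R b))" by (rule linear_sum[OF lin])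
  finally show ?thesis by (simp only: linear_cmul[OF lin])
qed

lemma C1c_derivative_continuous:
  assumes "C1c f"
  shows "continuous_on UNIV (\<lambda>x. frechet_derivative f (at x) h)"
  unfolding C1c_derivative_basis[OF assms, of _ h] using assms unfolding C1c_def
  by (auto simp: numeral_eq_Suc intro!: continuous_intros)

lemma C1c_derivative_outside:
  assumes "\<And>x. R \<le> norm x \<Longrightarrow> f x = 0" "R < norm x" "(f has_derivative f') (at x)"
  shows "f' h = 0"
proof -
  have "((\<lambda>_. 0) has_derivative f') (at x)"
  proof (rule has_derivative_transform_within_open[OF assms(3)])
    show "open {x. R < norm x}" by (intro open_Collect_less continuous_intros)
  qed (use assms in auto)
  then have "f' = (\<lambda>_. 0)" by (rule has_derivative_unique[OF _ has_derivative_const])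
  then show ?thesis by simp
qed

lemma C1c_bounds:
  assumes "C1c f"
  obtains R L where "0 < R" "0 \<le> L" "\<And>x. R \<le> norm x \<Longrightarrow> f x = 0"
    "\<And>x h. R \<le> norm x \<Longrightarrow> frechet_derivative f (at x) h = 0"
    "\<And>x y. norm (f x - f y) \<le> L * norm (x - y)"
proof -
  obtain R0 where R0: "\<And>x. R0 \<le> norm x \<Longrightarrow> f x = 0" using assms unfolding C1c_def by blast
  define R where "R = \<bar>R0\<bar> + 1"
  have R: "0 < R" "\<And>x. R \<le> norm x \<Longrightarrow> f x = 0" unfolding R_def using R0 by auto
  have out: "frechet_derivative f (at x) h = 0" if "R \<le> norm x" for x h
    by (rule C1c_derivative_outside[OF R0 _ C1c_has_derivative[OF assms]]) (use that in \<open>auto simp: R_def\<close>)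
  have "\<exists>B. \<forall>x\<in>cball 0 R. norm (frechet_derivative f (at x) b) \<le> B" for b
  proof -
    have "bounded ((\<lambda>x. frechet_derivative f (at x) b) ` cball 0 R)"
      by (intro compact_imp_bounded compact_continuous_image continuous_on_subset[OF C1c_derivative_continuous[OF assms]]) auto
    then show ?thesis unfolding bounded_iff by auto
  qed
  then obtain B where B: "\<And>b x. x \<in> cball 0 R \<Longrightarrow> norm (frechet_derivative f (at x) b) \<le> B b" by metis
  define L where "L = (\<Sum>b\<in>Basis. \<bar>B b\<bar>)"
  have bd: "norm (frechet_derivative f (at x) h) \<le> L * norm h" for x h
  proof -
    have "norm (frechet_derivative f (at x) b) \<le> \<bar>B b\<bar>" for b
      using B[of x b] out[of x b] by (cases "norm x \<le> R") auto
    then have s: "norm ((h \<bullet> b) *\<^sub>R frechet_derivative f (at x) b) \<le> norm h * \<bar>B b\<bar>" if "b \<in> Basis" for b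
      unfolding norm_scaleR using Basis_le_norm[OF that] by (intro mult_mono) auto
    have "norm (frechet_derivative f (at x) h) \<le> (\<Sum>b\<in>Basis. norm ((h \<bullet> b) *\<^sub>R frechet_derivative f (at x) b))"
      unfolding C1c_derivative_basis[OF assms, of x h] by (rule norm_sum)
    also have "\<dots> \<le> (\<Sum>b\<in>Basis. norm h * \<bar>B b\<bar>)" by (intro sum_mono s)
    finally show ?thesis unfolding L_def by (simp add: sum_distrib_left mult.commute)
  qed
  have L0: "0 \<le> L" unfolding L_def by (intro sum_nonneg) auto
  have "norm (f x - f y) \<le> L * norm (x - y)" for x y
  proof (rule differentiable_bound[of UNIV])
    show "(f has_derivative frechet_derivative f (at z)) (at z within UNIV)" for z
      using C1c_has_derivative[OF assms] by simp
    show "onorm (frechet_derivative f (at z)) \<le> L" for z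
      by (rule onorm_bound[OF L0 bd])
  qed auto
  with R out L0 show ?thesis using that by blast
qed

lemma sq_integrable_continuous:
  fixes f :: "'a::euclidean_space \<Rightarrow> 'b::euclidean_space"
  assumes f: "continuous_on UNIV f" and R: "\<And>x. R \<le> norm x \<Longrightarrow> f x = 0"
  shows "sq_integrable f"
proof -
  have fm: "f \<in> borel_measurable borel" by (rule borel_measurable_continuous_onI[OF f])
  have "integrable lborel (\<lambda>x. indicator (cball 0 R) x *\<^sub>R (norm (f x))\<^sup>2)"
    by (rule borel_integrable_compact) (auto intro!: continuous_intros continuous_on_subset[OF f])
  moreover have "(\<lambda>x. indicator (cball 0 R) x *\<^sub>R (norm (f x))\<^sup>2) = (\<lambda>x. (norm (f x))\<^sup>2)"
    using R by (auto simp: fun_eq_iff indicator_def)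
  ultimately have "integrable lborel (\<lambda>x. (norm (f x))\<^sup>2)" by simp
  then have "integrable lebesgue (\<lambda>x. (norm (f x))\<^sup>2)"
    using fm by (subst integrable_completion) auto
  then show ?thesis unfolding sq_integrable_def using fm by (simp add: measurable_completion)
qed

lemma sq_integrable_C1c: "C1c f \<Longrightarrow> sq_integrable f"
  by (rule C1c_bounds, assumption) (rule sq_integrable_continuous[OF C1c_continuous])

lemma sq_integrable_C1c_derivative: "C1c f \<Longrightarrow> sq_integrable (\<lambda>x. frechet_derivative f (at x) h)"
  by (rule C1c_bounds, assumption) (rule sq_integrable_continuous[OF C1c_derivative_continuous])

lemma integral_translation:
  fixes g :: "'a::euclidean_space \<Rightarrow> real"
  assumes "g \<in> borel_measurable borel"
  shows "(\<integral>x. g (x + h) \<partial>lebesgue) = (\<integral>x. g x \<partial>lebesgue)"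
proof -
  have m: "(\<lambda>x. g (x + h)) \<in> borel_measurable lborel" using assms by simp
  have "(\<integral>x. g x \<partial>lborel) = (\<integral>x. g x \<partial>distr lborel borel ((+) h))"
    by (simp only: lborel_distr_plus)
  also have "\<dots> = (\<integral>x. g (h + x) \<partial>lborel)" using assms by (intro integral_distr) auto
  finally show ?thesis using m assms by (simp add: integral_completion add.commute)
qed

lemma norm_translation:
  fixes f :: "'a::euclidean_space \<Rightarrow> 'b::euclidean_space"
  assumes f: "continuous_on UNIV f" and R: "\<And>x. R \<le> norm x \<Longrightarrow> f x = 0"
  shows "sq_integrable (\<lambda>x. f (x + h))" "norm (abs_Lsq (\<lambda>x. f (x + h))) = norm (abs_Lsq f)"
proof -
  show s: "sq_integrable (\<lambda>x. f (x + h))"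
  proof (rule sq_integrable_continuous)
    show "continuous_on UNIV (\<lambda>x. f (x + h))"
      by (rule continuous_on_compose2[OF f]) (auto intro!: continuous_intros)
    show "f (x + h) = 0" if "R + norm h \<le> norm x" for x
    proof (rule R)
      show "R \<le> norm (x + h)" using that norm_triangle_ineq2[of x "- h"] by simp
    qed
  qed
  have s0: "sq_integrable f" by (rule sq_integrable_continuous[OF f]) (rule R)
  have m: "(\<lambda>x. (norm (f x))\<^sup>2) \<in> borel_measurable borel"
    by (rule norm_square_measurable[OF borel_measurable_continuous_onI[OF f]])
  have "(norm (abs_Lsq (\<lambda>x. f (x + h))))\<^sup>2 = (norm (abs_Lsq f))\<^sup>2"
    using integral_translation[OF m, of h] norm_abs[OF s] norm_abs[OF s0] by simp
  then show "norm (abs_Lsq (\<lambda>x. f (x + h))) = norm (abs_Lsq f)" by simp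
qed

text \<open>The difference quotients with steps \<open>h/(n+1)\<close> converge pointwise, and by the Lipschitz bound they are dominated by a
multiple of the indicator of one ball. This is the input of two applications of dominated convergence.\<close>

lemma difference_quotient_limit:
  fixes h :: "'a::euclidean_space"
  assumes f: "C1c f"
  defines "q \<equiv> \<lambda>n x. real (Suc n) *\<^sub>R (f (x + (1 / real (Suc n)) *\<^sub>R h) - f x)"
  shows "(\<lambda>n. q n x) \<longlonglongrightarrow> frechet_derivative f (at x) h"
    and "\<exists>B R. \<forall>n x. norm (q n x) \<le> B * indicator (cball 0 R) x"
proof -
  define d where "d s = (f (x + s *\<^sub>R h) - f x) /\<^sub>R s" for s :: real
  have "((\<lambda>s::real. x + s *\<^sub>R h) has_derivative (\<lambda>s. s *\<^sub>R h)) (at 0)"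
    by (auto intro!: derivative_eq_intros)
  from has_derivative_compose[OF this, of f "frechet_derivative f (at x)"]
  have "((\<lambda>s. f (x + s *\<^sub>R h)) has_derivative (\<lambda>s. frechet_derivative f (at x) (s *\<^sub>R h))) (at 0)"
    using C1c_has_derivative[OF f, of x] by simp
  then have "((\<lambda>s. norm (f (x + (0 + s) *\<^sub>R h) - f (x + 0 *\<^sub>R h) - frechet_derivative f (at x) (s *\<^sub>R h)) / norm s) \<longlongrightarrow> 0) (at 0)"
    unfolding has_derivative_at by blast
  then have "((\<lambda>s. norm (d s - frechet_derivative f (at x) h)) \<longlongrightarrow> 0) (at 0)"
  proof (rule Lim_transform_eventually)
    have lin: "linear (frechet_derivative f (at x))"
      using C1c_has_derivative[OF f] by (rule has_derivative_linear)
    have "norm (f (x + (0 + s) *\<^sub>R h) - f (x + 0 *\<^sub>R h) - frechet_derivative f (at x) (s *\<^sub>R h)) / norm s =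
        norm (d s - frechet_derivative f (at x) h)" if s: "s \<noteq> 0" for s
    proof -
      have "f (x + (0 + s) *\<^sub>R h) - f (x + 0 *\<^sub>R h) - frechet_derivative f (at x) (s *\<^sub>R h) =
          s *\<^sub>R (d s - frechet_derivative f (at x) h)"
        unfolding d_def linear_cmul[OF lin] using s by (simp add: scaleR_diff_right)
      then show ?thesis using s by simp
    qed
    then show "\<forall>\<^sub>F s in at 0. norm (f (x + (0 + s) *\<^sub>R h) - f (x + 0 *\<^sub>R h) - frechet_derivative f (at x) (s *\<^sub>R h)) / norm s =
        norm (d s - frechet_derivative f (at x) h)"
      by (simp only: eventually_at_filter) simp
  qed
  then have "(d \<longlongrightarrow> frechet_derivative f (at x) h) (at 0)"
    by (rule LIM_zero_cancel[OF tendsto_norm_zero_cancel])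
  moreover have "filterlim (\<lambda>n. 1 / real (Suc n)) (at 0) sequentially"
    by real_asymp
  ultimately have "(\<lambda>n. d (1 / real (Suc n))) \<longlonglongrightarrow> frechet_derivative f (at x) h"
    by (rule filterlim_compose)
  then show "(\<lambda>n. q n x) \<longlonglongrightarrow> frechet_derivative f (at x) h"
    unfolding q_def d_def by simp
  obtain R L where RL: "0 < R" "0 \<le> L" "\<And>x. R \<le> norm x \<Longrightarrow> f x = 0"
    "\<And>x y. norm (f x - f y) \<le> L * norm (x - y)" by (rule C1c_bounds[OF f]) (rule that)
  have "norm (q n x) \<le> L * norm h * indicator (cball 0 (R + norm h)) x" for n x
  proof (cases "norm x \<le> R + norm h")
    case True
    have "norm (q n x) \<le> real (Suc n) * (L * norm ((1 / real (Suc n)) *\<^sub>R h))"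
      unfolding q_def norm_scaleR using RL(4)[of "x + (1 / real (Suc n)) *\<^sub>R h" x] by (intro mult_mono) auto
    also have "\<dots> = L * norm h" by simp
    finally show ?thesis using True by simp
  next
    case False
    have "norm ((1 / real (Suc n)) *\<^sub>R h) \<le> norm h" using mult_left_mono[of 1 "1 + real n" "norm h"] by (simp add: divide_le_eq)
    then have "R \<le> norm (x + (1 / real (Suc n)) *\<^sub>R h)"
      using False norm_triangle_ineq2[of x "- ((1 / real (Suc n)) *\<^sub>R h)"] by simp
    moreover have "R \<le> norm x" using False norm_ge_zero[of h] by linarith
    ultimately have "q n x = 0" unfolding q_def using RL(3) by simp
    then show ?thesis using RL(2) by simp
  qed
  then show "\<exists>B R. \<forall>n x. norm (q n x) \<le> B * indicator (cball 0 R) x" by blast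
qed

lemma integrable_indicator_cball: "integrable lebesgue (\<lambda>x. c * indicator (cball 0 R) x :: real)" for R :: real
  by (intro integrable_mult_right integrable_real_indicator) (use emeasure_bounded_finite[OF bounded_cball, of 0 R] in auto)

lemma C1c_translate_quotient_continuous:
  assumes "C1c f" shows "continuous_on UNIV (\<lambda>x. c *\<^sub>R (f (x + k) - f x))"
  by (intro continuous_intros continuous_on_compose2[OF C1c_continuous[OF assms]] C1c_continuous[OF assms]) auto

text \<open>The basis of integration by parts. The integral of each difference quotient vanishes because the
integral is invariant under translations; the derivative is their dominated limit.\<close>

lemma integral_derivative_zero:
  fixes g :: "'a::euclidean_space \<Rightarrow> real"
  assumes g: "C1c g"
  shows "(\<integral>x. frechet_derivative g (at x) h \<partial>lebesgue) = 0"
proof -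
  define q where "q n x = real (Suc n) *\<^sub>R (g (x + (1 / real (Suc n)) *\<^sub>R h) - g x)" for n x
  have qm: "q n \<in> borel_measurable lebesgue" for n
  proof -
    have "q n \<in> borel_measurable borel"
      unfolding q_def by (rule borel_measurable_continuous_onI[OF C1c_translate_quotient_continuous[OF g]])
    then show ?thesis by (simp add: measurable_completion)
  qed
  have lim: "(\<lambda>n. q n x) \<longlonglongrightarrow> frechet_derivative g (at x) h" for x
    unfolding q_def by (rule difference_quotient_limit(1)[OF g])
  obtain B R where B: "\<And>n x. norm (q n x) \<le> B * indicator (cball 0 R) x"
    using difference_quotient_limit(2)[OF g] unfolding q_def by blast
  have "(\<lambda>n. \<integral>x. q n x \<partial>lebesgue) \<longlonglongrightarrow> (\<integral>x. frechet_derivative g (at x) h \<partial>lebesgue)"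
  proof (rule integral_dominated_convergence[where w = "\<lambda>x. B * indicator (cball 0 R) x"])
    show "(\<lambda>x. frechet_derivative g (at x) h) \<in> borel_measurable lebesgue"
      by (rule sq_integrable_measurable[OF sq_integrable_C1c_derivative[OF g]])
    show "integrable lebesgue (\<lambda>x::'a. B * indicator (cball 0 R) x)" by (rule integrable_indicator_cball)
  qed (use qm lim B in auto)
  moreover have "(\<integral>x. q n x \<partial>lebesgue) = 0" for n
  proof -
    obtain R where RL: "\<And>x. R \<le> norm x \<Longrightarrow> g x = 0" using g unfolding C1c_def by blast
    define k where "k = (1 / real (Suc n)) *\<^sub>R h"
    have gm: "g \<in> borel_measurable borel" by (rule borel_measurable_continuous_onI[OF C1c_continuous[OF g]])
    have gi: "integrable lebesgue g"
    proof -
      have "integrable lborel (\<lambda>x. indicator (cball 0 R) x *\<^sub>R g x)"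
        by (rule borel_integrable_compact) (auto intro!: continuous_on_subset[OF C1c_continuous[OF g]])
      moreover have "(\<lambda>x. indicator (cball 0 R) x *\<^sub>R g x) = g"
        using RL by (auto simp: fun_eq_iff indicator_def)
      ultimately show ?thesis using gm by (subst integrable_completion) auto
    qed
    have gk: "integrable lebesgue (\<lambda>x. g (x + k))"
    proof -
      have "integrable (distr lborel borel ((+) k)) g"
        using gi gm by (simp add: lborel_distr_plus integrable_completion)
      then have "integrable lborel (\<lambda>x. g (k + x))" using gm by (subst (asm) integrable_distr_eq) auto
      then show ?thesis using gm by (subst integrable_completion) (auto simp: add.commute)
    qed
    have "(\<integral>x. q n x \<partial>lebesgue) = real (Suc n) * ((\<integral>x. g (x + k) \<partial>lebesgue) - (\<integral>x. g x \<partial>lebesgue))"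
      unfolding q_def k_def[symmetric] using gk gi by simp
    also have "\<dots> = 0" using integral_translation[OF gm, of k] by simp
    finally show ?thesis .
  qed
  ultimately show ?thesis by (simp add: LIMSEQ_const_iff)
qed

text \<open>The translation by \<open>h\<close> is composed of \<open>n\<close> translations by \<open>h/n\<close>. Since translations preserve the norm, the
triangle inequality bounds \<open>\<parallel>f(\<cdot> + h) - f\<parallel>\<close> by the norm of the difference quotient with step \<open>h/n\<close>, which tends to
the norm of the derivative in the direction \<open>h\<close>.\<close>

lemma C1c_translation_estimate:
  fixes f :: "'a::euclidean_space \<Rightarrow> 'b::euclidean_space"
  assumes f: "C1c f"
  shows "norm (abs_Lsq (\<lambda>x. f (x + h) - f x)) \<le> norm (abs_Lsq (\<lambda>x. frechet_derivative f (at x) h))"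
proof -
  obtain R where R: "\<And>x. R \<le> norm x \<Longrightarrow> f x = 0" using f unfolding C1c_def by blast
  have sf: "sq_integrable (\<lambda>x. f (x + k))" for k by (rule norm_translation(1)[OF C1c_continuous[OF f] R])
  have sd: "sq_integrable (\<lambda>x. f (x + k) - f x)" for k using sq_integrable_diff[OF sf sq_integrable_C1c[OF f]] .
  have tr: "norm (abs_Lsq (\<lambda>x. f (x + (l + k)) - f (x + l))) = norm (abs_Lsq (\<lambda>x. f (x + k) - f x))" for k l
  proof -
    have "norm (abs_Lsq (\<lambda>x. f (x + l + k) - f (x + l))) = norm (abs_Lsq (\<lambda>x. f (x + k) - f x))"
    proof (rule norm_translation(2)[of "\<lambda>x. f (x + k) - f x" "R + norm k"])
      show "continuous_on UNIV (\<lambda>x. f (x + k) - f x)"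
        using C1c_translate_quotient_continuous[OF f, of 1 k] by simp
      show "f (x + k) - f x = 0" if "R + norm k \<le> norm x" for x
      proof -
        have "R \<le> norm (x + k)" using that norm_triangle_ineq2[of x "- k"] by simp
        moreover have "R \<le> norm x" using that norm_ge_zero[of k] by linarith
        ultimately show ?thesis using R by simp
      qed
    qed
    then show ?thesis by (simp add: add.assoc)
  qed
  have multi: "norm (abs_Lsq (\<lambda>x. f (x + real m *\<^sub>R k) - f x)) \<le> real m * norm (abs_Lsq (\<lambda>x. f (x + k) - f x))" for m k
  proof (induction m)
    case 0
    then show ?case by (simp add: abs_0)
  next
    case (Suc m)
    have "abs_Lsq (\<lambda>x. f (x + real (Suc m) *\<^sub>R k) - f x) =
        abs_Lsq (\<lambda>x. f (x + (real m *\<^sub>R k + k)) - f (x + real m *\<^sub>R k)) + abs_Lsq (\<lambda>x. f (x + real m *\<^sub>R k) - f x)"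
      by (subst abs_add[OF sq_integrable_diff[OF sf sf] sd]) (simp add: algebra_simps)
    then have "norm (abs_Lsq (\<lambda>x. f (x + real (Suc m) *\<^sub>R k) - f x)) \<le>
        norm (abs_Lsq (\<lambda>x. f (x + (real m *\<^sub>R k + k)) - f (x + real m *\<^sub>R k))) + norm (abs_Lsq (\<lambda>x. f (x + real m *\<^sub>R k) - f x))"
      by (simp only: norm_triangle_ineq)
    then show ?case using Suc tr[of "real m *\<^sub>R k" k] by (simp add: algebra_simps)
  qed
  define q where "q n x = real (Suc n) *\<^sub>R (f (x + (1 / real (Suc n)) *\<^sub>R h) - f x)" for n x
  have sq: "sq_integrable (q n)" for n unfolding q_def by (rule sq_integrable_scaleR[OF sd])
  have lim: "(\<lambda>n. q n x) \<longlonglongrightarrow> frechet_derivative f (at x) h" for x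
    unfolding q_def by (rule difference_quotient_limit(1)[OF f])
  obtain B R' where B: "\<And>n x. norm (q n x) \<le> B * indicator (cball 0 R') x"
    using difference_quotient_limit(2)[OF f] unfolding q_def by blast
  have le: "norm (abs_Lsq (\<lambda>x. f (x + h) - f x)) \<le> norm (abs_Lsq (q n))" for n
  proof -
    have "norm (abs_Lsq (\<lambda>x. f (x + h) - f x)) \<le> real (Suc n) * norm (abs_Lsq (\<lambda>x. f (x + (1 / real (Suc n)) *\<^sub>R h) - f x))"
      using multi[of "Suc n" "(1 / real (Suc n)) *\<^sub>R h"] by simp
    also have "\<dots> = norm (abs_Lsq (q n))"
      unfolding q_def abs_scaleR[OF sd, symmetric] by simp
    finally show ?thesis .
  qed
  have "(\<lambda>n. \<integral>x. (norm (q n x))\<^sup>2 \<partial>lebesgue) \<longlonglongrightarrow> (\<integral>x. (norm (frechet_derivative f (at x) h))\<^sup>2 \<partial>lebesgue)"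
  proof (rule integral_dominated_convergence[where w = "\<lambda>x. B\<^sup>2 * indicator (cball 0 R') x"])
    show "(\<lambda>x. (norm (frechet_derivative f (at x) h))\<^sup>2) \<in> borel_measurable lebesgue"
      by (rule norm_square_measurable[OF sq_integrable_measurable[OF sq_integrable_C1c_derivative[OF f]]])
    show "(\<lambda>x. (norm (q n x))\<^sup>2) \<in> borel_measurable lebesgue" for n
      by (rule norm_square_measurable[OF sq_integrable_measurable[OF sq]])
    show "integrable lebesgue (\<lambda>x::'a. B\<^sup>2 * indicator (cball 0 R') x)" by (rule integrable_indicator_cball)
    show "AE x in lebesgue. (\<lambda>n. (norm (q n x))\<^sup>2) \<longlonglongrightarrow> (norm (frechet_derivative f (at x) h))\<^sup>2"
      by (intro AE_I2 tendsto_power tendsto_norm lim)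
    show "AE x in lebesgue. norm ((norm (q n x))\<^sup>2) \<le> B\<^sup>2 * indicator (cball 0 R') x" for n
    proof (rule AE_I2)
      fix x
      have "(norm (q n x))\<^sup>2 \<le> (B * indicator (cball 0 R') x)\<^sup>2" by (rule power_mono[OF B norm_ge_zero])
      also have "\<dots> = B\<^sup>2 * indicator (cball 0 R') x"
        by (cases "x \<in> cball 0 R'") (simp_all add: power2_eq_square)
      finally show "norm ((norm (q n x))\<^sup>2) \<le> B\<^sup>2 * indicator (cball 0 R') x" by simp
    qed
  qed
  then have "(\<lambda>n. (norm (abs_Lsq (q n)))\<^sup>2) \<longlonglongrightarrow> (norm (abs_Lsq (\<lambda>x. frechet_derivative f (at x) h)))\<^sup>2"
    unfolding norm_abs[OF sq] norm_abs[OF sq_integrable_C1c_derivative[OF f]] .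
  moreover have "(norm (abs_Lsq (\<lambda>x. f (x + h) - f x)))\<^sup>2 \<le> (norm (abs_Lsq (q n)))\<^sup>2" for n
    by (rule power_mono[OF le norm_ge_zero])
  ultimately have "(norm (abs_Lsq (\<lambda>x. f (x + h) - f x)))\<^sup>2 \<le> (norm (abs_Lsq (\<lambda>x. frechet_derivative f (at x) h)))\<^sup>2"
    by (intro LIMSEQ_le_const) auto
  then show ?thesis by (rule power2_le_imp_le) simp
qed

section \<open>Ladyzhenskaya's inequality\<close>

text \<open>The identification of \<open>\<real> \<times> \<real>\<close> with the plane, used to integrate first along lines.\<close>

definition plane_pt :: "real \<times> real \<Rightarrow> real^2" where "plane_pt p = fst p *\<^sub>R axis 1 1 + snd p *\<^sub>R axis 2 1"

lemma plane_pt_nth [simp]: "plane_pt p $ 1 = fst p" "plane_pt p $ 2 = snd p"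
  by (simp_all add: plane_pt_def axis_def)

lemma plane_pt_continuous: "continuous_on UNIV plane_pt"
  unfolding plane_pt_def by (intro continuous_intros)

lemma plane_pt_measurable [measurable]: "plane_pt \<in> borel_measurable (lborel \<Otimes>\<^sub>M lborel)"
proof -
  have "plane_pt \<in> borel_measurable borel" by (rule borel_measurable_continuous_onI[OF plane_pt_continuous])
  then show ?thesis by (simp add: borel_prod[symmetric] cong: measurable_cong_sets)
qed

lemma Basis_plane: "(Basis :: (real^2) set) = {axis 1 1, axis 2 1}"
  by (auto simp: Basis_vec_def UNIV_2)

lemma lborel_plane: "(lborel :: (real^2) measure) = distr (lborel \<Otimes>\<^sub>M lborel) borel plane_pt"
proof (rule lborel_eqI)
  fix l u :: "real^2"
  assume le: "\<And>b. b \<in> Basis \<Longrightarrow> l \<bullet> b \<le> u \<bullet> b"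
  have l12: "l $ 1 \<le> u $ 1" "l $ 2 \<le> u $ 2" using le[of "axis 1 1"] le[of "axis 2 1"] by (simp_all add: Basis_plane inner_axis)
  have "plane_pt -` box l u \<inter> space (lborel \<Otimes>\<^sub>M lborel) = {l $ 1<..<u $ 1} \<times> {l $ 2<..<u $ 2}"
    by (auto simp: mem_box_cart forall_2 space_pair_measure)
  then have "emeasure (distr (lborel \<Otimes>\<^sub>M lborel) borel plane_pt) (box l u) =
      emeasure (lborel \<Otimes>\<^sub>M lborel) ({l $ 1<..<u $ 1} \<times> {l $ 2<..<u $ 2})"
    by (subst emeasure_distr) auto
  also have "\<dots> = emeasure lborel {l $ 1<..<u $ 1} * emeasure lborel {l $ 2<..<u $ 2}"
    by (rule lborel.emeasure_pair_measure_Times) auto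
  also have "\<dots> = ennreal ((u $ 1 - l $ 1) * (u $ 2 - l $ 2))" using l12 by (simp add: ennreal_mult)
  also have "(u $ 1 - l $ 1) * (u $ 2 - l $ 2) = (\<Prod>b\<in>Basis. (u - l) \<bullet> b)"
    by (simp add: Basis_plane inner_axis axis_eq_axis)
  finally show "emeasure (distr (lborel \<Otimes>\<^sub>M lborel) borel plane_pt) (box l u) = (\<Prod>b\<in>Basis. (u - l) \<bullet> b)" .
qed simp

lemma nn_integral_plane:
  assumes f: "f \<in> borel_measurable (borel :: (real^2) measure)"
  shows "(\<integral>\<^sup>+x. f x \<partial>lborel) = (\<integral>\<^sup>+a. \<integral>\<^sup>+b. f (plane_pt (a, b)) \<partial>lborel \<partial>lborel)"
    and "(\<integral>\<^sup>+x. f x \<partial>lborel) = (\<integral>\<^sup>+b. \<integral>\<^sup>+a. f (plane_pt (a, b)) \<partial>lborel \<partial>lborel)"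
proof -
  have m: "(\<lambda>p. f (plane_pt p)) \<in> borel_measurable (lborel \<Otimes>\<^sub>M lborel)"
    by (rule measurable_compose[OF plane_pt_measurable f])
  have "(\<integral>\<^sup>+x. f x \<partial>lborel) = (\<integral>\<^sup>+p. f (plane_pt p) \<partial>(lborel \<Otimes>\<^sub>M lborel))"
    by (subst lborel_plane, rule nn_integral_distr) (use f in auto)
  also have "\<dots> = (\<integral>\<^sup>+a. \<integral>\<^sup>+b. f (plane_pt (a, b)) \<partial>lborel \<partial>lborel)"
    by (rule lborel.nn_integral_fst[OF m, symmetric])
  finally show 1: "(\<integral>\<^sup>+x. f x \<partial>lborel) = (\<integral>\<^sup>+a. \<integral>\<^sup>+b. f (plane_pt (a, b)) \<partial>lborel \<partial>lborel)" .
  show "(\<integral>\<^sup>+x. f x \<partial>lborel) = (\<integral>\<^sup>+b. \<integral>\<^sup>+a. f (plane_pt (a, b)) \<partial>lborel \<partial>lborel)"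
    unfolding 1 by (rule lborel_pair.Fubini'[symmetric]) (use m in \<open>simp add: case_prod_unfold\<close>)
qed

text \<open>\<open>|\<phi>|\<^sup>2\<close> is the integral of its derivative \<open>2 \<phi> \<bullet> \<phi>'\<close> from a point where \<open>\<phi>\<close> vanishes.\<close>

lemma square_le_nn_integral_line:
  fixes \<phi> :: "real \<Rightarrow> 'b::euclidean_space"
  assumes d: "\<And>s. (\<phi> has_vector_derivative \<phi>' s) (at s)" and c: "continuous_on UNIV \<phi>'"
    and R: "\<And>s. R \<le> \<bar>s\<bar> \<Longrightarrow> \<phi> s = 0"
  shows "ennreal ((norm (\<phi> t))\<^sup>2) \<le> (\<integral>\<^sup>+s. ennreal (2 * (norm (\<phi> s) * norm (\<phi>' s))) \<partial>lborel)"
proof -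
  define r where "r = max \<bar>R\<bar> \<bar>t\<bar>"
  have r: "-r \<le> t" "R \<le> \<bar>- r\<bar>" unfolding r_def by auto
  have c\<phi>: "continuous_on UNIV \<phi>"
    by (intro continuous_at_imp_continuous_on ballI has_vector_derivative_continuous[OF d])
  have ftc: "has_bochner_integral lborel (\<lambda>s. indicator {-r..t} s *\<^sub>R (2 * (\<phi> s \<bullet> \<phi>' s))) (\<phi> t \<bullet> \<phi> t - \<phi> (-r) \<bullet> \<phi> (-r))"
  proof (rule has_bochner_integral_FTC_Icc[OF r(1)])
    fix s
    have "((\<lambda>s. \<phi> s \<bullet> \<phi> s) has_vector_derivative \<phi> s \<bullet> \<phi>' s + \<phi>' s \<bullet> \<phi> s) (at s)"
      by (rule bounded_bilinear.has_vector_derivative[OF bounded_bilinear_inner d d])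
    then have at: "((\<lambda>s. \<phi> s \<bullet> \<phi> s) has_vector_derivative 2 * (\<phi> s \<bullet> \<phi>' s)) (at s)"
      by (simp add: inner_commute)
    show "((\<lambda>s. \<phi> s \<bullet> \<phi> s) has_vector_derivative 2 * (\<phi> s \<bullet> \<phi>' s)) (at s within {-r..t})"
      by (rule has_vector_derivative_at_within[OF at])
    show "continuous_on {-r..t} (\<lambda>s. 2 * (\<phi> s \<bullet> \<phi>' s))"
      by (intro continuous_intros continuous_on_subset[OF c\<phi>] continuous_on_subset[OF c]) auto
  qed
  have eq: "(norm (\<phi> t))\<^sup>2 = (\<integral>s. indicator {-r..t} s *\<^sub>R (2 * (\<phi> s \<bullet> \<phi>' s)) \<partial>lborel)"
    using ftc R[OF r(2)] by (simp add: has_bochner_integral_iff power2_norm_eq_inner)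
  have "ennreal ((norm (\<phi> t))\<^sup>2) = ennreal (norm (\<integral>s. indicator {-r..t} s *\<^sub>R (2 * (\<phi> s \<bullet> \<phi>' s)) \<partial>lborel))"
    unfolding eq[symmetric] by simp
  also have "\<dots> \<le> (\<integral>\<^sup>+s. ennreal (norm (indicator {-r..t} s *\<^sub>R (2 * (\<phi> s \<bullet> \<phi>' s)))) \<partial>lborel)"
    by (rule integral_norm_bound_ennreal) (use ftc in \<open>simp add: has_bochner_integral_iff\<close>)
  also have "\<dots> \<le> (\<integral>\<^sup>+s. ennreal (2 * (norm (\<phi> s) * norm (\<phi>' s))) \<partial>lborel)"
  proof (intro nn_integral_mono ennreal_leI)
    fix s
    show "norm (indicator {-r..t} s *\<^sub>R (2 * (\<phi> s \<bullet> \<phi>' s))) \<le> 2 * (norm (\<phi> s) * norm (\<phi>' s))"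
      using Cauchy_Schwarz_ineq2[of "\<phi> s" "\<phi>' s"] by (auto simp: indicator_def abs_mult)
  qed
  finally show ?thesis .
qed

lemma C1c_line_derivative:
  assumes f: "C1c f"
  shows "((\<lambda>s. f (x + s *\<^sub>R e)) has_vector_derivative frechet_derivative f (at (x + s *\<^sub>R e)) e) (at s)"
proof -
  have "((\<lambda>s::real. x + s *\<^sub>R e) has_derivative (\<lambda>s. s *\<^sub>R e)) (at s)"
    by (auto intro!: derivative_eq_intros)
  from has_derivative_compose[OF this C1c_has_derivative[OF f]]
  have "((\<lambda>s. f (x + s *\<^sub>R e)) has_derivative (\<lambda>h. frechet_derivative f (at (x + s *\<^sub>R e)) (h *\<^sub>R e))) (at s)" .
  moreover have "linear (frechet_derivative f (at (x + s *\<^sub>R e)))"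
    using C1c_has_derivative[OF f] by (rule has_derivative_linear)
  ultimately show ?thesis unfolding has_vector_derivative_def by (simp add: linear_cmul)
qed

text \<open>The bound along one line, applied to the restrictions of \<open>f\<close> to the horizontal and the vertical line through the point.\<close>

lemma C1c_line_bound:
  fixes f :: "real^2 \<Rightarrow> 'b::euclidean_space"
  assumes f: "C1c f"
  shows "ennreal ((norm (f (plane_pt (a, b))))\<^sup>2) \<le>
      (\<integral>\<^sup>+s. ennreal (2 * (norm (f (plane_pt (a, s))) * norm (frechet_derivative f (at (plane_pt (a, s))) (axis 2 1)))) \<partial>lborel)"
    and "ennreal ((norm (f (plane_pt (a, b))))\<^sup>2) \<le>
      (\<integral>\<^sup>+s. ennreal (2 * (norm (f (plane_pt (s, b))) * norm (frechet_derivative f (at (plane_pt (s, b))) (axis 1 1)))) \<partial>lborel)"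
proof -
  obtain R where R: "\<And>x. R \<le> norm x \<Longrightarrow> f x = 0" using f unfolding C1c_def by blast
  have 1: "plane_pt (a, s) = plane_pt (a, 0) + s *\<^sub>R axis 2 1" for s a by (simp add: plane_pt_def)
  have 2: "plane_pt (s, b) = plane_pt (0, b) + s *\<^sub>R axis 1 1" for s b by (simp add: plane_pt_def)
  show "ennreal ((norm (f (plane_pt (a, b))))\<^sup>2) \<le>
      (\<integral>\<^sup>+s. ennreal (2 * (norm (f (plane_pt (a, s))) * norm (frechet_derivative f (at (plane_pt (a, s))) (axis 2 1)))) \<partial>lborel)"
  proof (rule square_le_nn_integral_line[where \<phi> = "\<lambda>s. f (plane_pt (a, s))"])
    show "((\<lambda>s. f (plane_pt (a, s))) has_vector_derivative frechet_derivative f (at (plane_pt (a, s))) (axis 2 1)) (at s)" for s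
      using C1c_line_derivative[OF f, of "plane_pt (a, 0)" "axis 2 1" s] unfolding 1[symmetric] .
    show "continuous_on UNIV (\<lambda>s. frechet_derivative f (at (plane_pt (a, s))) (axis 2 1))"
      by (rule continuous_on_compose2[OF C1c_derivative_continuous[OF f] continuous_on_compose2[OF plane_pt_continuous]])
         (auto intro!: continuous_intros)
    show "f (plane_pt (a, s)) = 0" if "R \<le> \<bar>s\<bar>" for s
      by (rule R) (use that component_le_norm_cart[of "plane_pt (a, s)" 2] in simp)
  qed
  show "ennreal ((norm (f (plane_pt (a, b))))\<^sup>2) \<le>
      (\<integral>\<^sup>+s. ennreal (2 * (norm (f (plane_pt (s, b))) * norm (frechet_derivative f (at (plane_pt (s, b))) (axis 1 1)))) \<partial>lborel)"
  proof (rule square_le_nn_integral_line[where \<phi> = "\<lambda>s. f (plane_pt (s, b))"])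
    show "((\<lambda>s. f (plane_pt (s, b))) has_vector_derivative frechet_derivative f (at (plane_pt (s, b))) (axis 1 1)) (at s)" for s
      using C1c_line_derivative[OF f, of "plane_pt (0, b)" "axis 1 1" s] unfolding 2[symmetric] .
    show "continuous_on UNIV (\<lambda>s. frechet_derivative f (at (plane_pt (s, b))) (axis 1 1))"
      by (rule continuous_on_compose2[OF C1c_derivative_continuous[OF f] continuous_on_compose2[OF plane_pt_continuous]])
         (auto intro!: continuous_intros)
    show "f (plane_pt (s, b)) = 0" if "R \<le> \<bar>s\<bar>" for s
      by (rule R) (use that component_le_norm_cart[of "plane_pt (s, b)" 1] in simp)
  qed
qed

lemma nn_integral_norm_mult_le:
  assumes f: "continuous_on UNIV f" "\<And>x. R \<le> norm x \<Longrightarrow> f x = 0"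
    and g: "continuous_on UNIV g" "\<And>x. S \<le> norm x \<Longrightarrow> g x = 0"
  shows "(\<integral>\<^sup>+x. ennreal (2 * (norm (f x) * norm (g x))) \<partial>lborel) \<le> ennreal (2 * (norm (abs_Lsq f) * norm (abs_Lsq g)))"
proof -
  define f' where "f' x = norm (f x)" for x
  define g' where "g' x = norm (g x)" for x
  have cf: "continuous_on UNIV f'" and cg: "continuous_on UNIV g'"
    unfolding f'_def g'_def by (intro continuous_on_norm f(1) g(1))+
  have sf: "sq_integrable f'" by (rule sq_integrable_continuous[OF cf, of R]) (simp add: f'_def f(2))
  have sg: "sq_integrable g'" by (rule sq_integrable_continuous[OF cg, of S]) (simp add: g'_def g(2))
  have sf0: "sq_integrable f" by (rule sq_integrable_continuous[OF f(1)]) (rule f(2))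
  have sg0: "sq_integrable g" by (rule sq_integrable_continuous[OF g(1)]) (rule g(2))
  have "(norm (abs_Lsq f'))\<^sup>2 = (norm (abs_Lsq f))\<^sup>2"
    unfolding norm_abs[OF sf] norm_abs[OF sf0] by (simp add: f'_def)
  then have nf: "norm (abs_Lsq f') = norm (abs_Lsq f)" by simp
  have "(norm (abs_Lsq g'))\<^sup>2 = (norm (abs_Lsq g))\<^sup>2"
    unfolding norm_abs[OF sg] norm_abs[OF sg0] by (simp add: g'_def)
  then have ng: "norm (abs_Lsq g') = norm (abs_Lsq g)" by simp
  have "(\<integral>\<^sup>+x. ennreal (2 * (norm (f x) * norm (g x))) \<partial>lborel) = (\<integral>\<^sup>+x. ennreal (2 * (f' x \<bullet> g' x)) \<partial>lebesgue)"
    by (simp add: nn_integral_completion f'_def g'_def)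
  also have "\<dots> = ennreal (\<integral>x. 2 * (f' x \<bullet> g' x) \<partial>lebesgue)"
    by (intro nn_integral_eq_integral integrable_mult_right sq_integrable_inner_integrable sf sg AE_I2)
       (simp add: f'_def g'_def)
  also have "(\<integral>x. 2 * (f' x \<bullet> g' x) \<partial>lebesgue) = 2 * (abs_Lsq f' \<bullet> abs_Lsq g')"
    unfolding inner_abs[OF sf sg] by simp
  also have "ennreal (2 * (abs_Lsq f' \<bullet> abs_Lsq g')) \<le> ennreal (2 * (norm (abs_Lsq f) * norm (abs_Lsq g)))"
    using norm_cauchy_schwarz[of "abs_Lsq f'" "abs_Lsq g'"] unfolding nf ng by (intro ennreal_leI) simp
  finally show ?thesis .
qed

text \<open>At the point \<open>(a, b)\<close>, \<open>|f|\<^sup>2\<close> is bounded by an integral \<open>A a\<close> over the vertical line through the point, and \<open>|g|\<^sup>2\<close>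
by an integral \<open>B b\<close> over the horizontal line. The double integral of \<open>A a * B b\<close> factors, and the Cauchy-Schwarz
inequality bounds each factor.\<close>

lemma ladyzhenskaya_C1c:
  fixes f :: "real^2 \<Rightarrow> 'b::euclidean_space" and g :: "real^2 \<Rightarrow> 'c::euclidean_space"
  assumes f: "C1c f" and g: "C1c g"
  shows "(\<integral>\<^sup>+x. ennreal ((norm (f x))\<^sup>2 * (norm (g x))\<^sup>2) \<partial>lborel) \<le>
    ennreal (4 * (norm (abs_Lsq f) * norm (abs_Lsq (\<lambda>x. frechet_derivative f (at x) (axis 2 1))) *
      (norm (abs_Lsq g) * norm (abs_Lsq (\<lambda>x. frechet_derivative g (at x) (axis 1 1))))))"
proof -
  define F where "F x = ennreal (2 * (norm (f x) * norm (frechet_derivative f (at x) (axis 2 1))))" for x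
  define G where "G x = ennreal (2 * (norm (g x) * norm (frechet_derivative g (at x) (axis 1 1))))" for x
  have mf[measurable]: "f \<in> borel_measurable borel" and mg[measurable]: "g \<in> borel_measurable borel"
    by (intro borel_measurable_continuous_onI C1c_continuous f g)+
  have md[measurable]: "(\<lambda>x. frechet_derivative f (at x) (axis 2 1)) \<in> borel_measurable borel"
      "(\<lambda>x. frechet_derivative g (at x) (axis 1 1)) \<in> borel_measurable borel"
    by (intro borel_measurable_continuous_onI C1c_derivative_continuous f g)+
  have mF: "F \<in> borel_measurable borel" unfolding F_def by measurable
  have mG: "G \<in> borel_measurable borel" unfolding G_def by measurable
  have mp: "(\<lambda>p. F (plane_pt p)) \<in> borel_measurable (lborel \<Otimes>\<^sub>M lborel)" "(\<lambda>p. G (plane_pt p)) \<in> borel_measurable (lborel \<Otimes>\<^sub>M lborel)"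
    by (rule measurable_compose[OF plane_pt_measurable mF], rule measurable_compose[OF plane_pt_measurable mG])
  define A where "A a = (\<integral>\<^sup>+s. F (plane_pt (a, s)) \<partial>lborel)" for a
  define B where "B b = (\<integral>\<^sup>+s. G (plane_pt (s, b)) \<partial>lborel)" for b
  have mA: "A \<in> borel_measurable lborel" unfolding A_def
    by (rule lborel.borel_measurable_nn_integral) (use mp(1) in \<open>simp add: case_prod_unfold\<close>)
  have mB: "B \<in> borel_measurable lborel" unfolding B_def
    by (rule lborel.borel_measurable_nn_integral)
       (use measurable_compose[OF measurable_pair_swap' mp(2)] in \<open>simp add: case_prod_unfold\<close>)
  have "(\<integral>\<^sup>+x. ennreal ((norm (f x))\<^sup>2 * (norm (g x))\<^sup>2) \<partial>lborel) =
      (\<integral>\<^sup>+a. \<integral>\<^sup>+b. ennreal ((norm (f (plane_pt (a, b))))\<^sup>2 * (norm (g (plane_pt (a, b))))\<^sup>2) \<partial>lborel \<partial>lborel)"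
    by (rule nn_integral_plane(1)) measurable
  also have "\<dots> \<le> (\<integral>\<^sup>+a. \<integral>\<^sup>+b. A a * B b \<partial>lborel \<partial>lborel)"
  proof (intro nn_integral_mono)
    fix a b
    have "ennreal ((norm (f (plane_pt (a, b))))\<^sup>2 * (norm (g (plane_pt (a, b))))\<^sup>2) =
        ennreal ((norm (f (plane_pt (a, b))))\<^sup>2) * ennreal ((norm (g (plane_pt (a, b))))\<^sup>2)"
      by (rule ennreal_mult) auto
    also have "\<dots> \<le> A a * B b" unfolding A_def B_def F_def G_def
      by (intro mult_mono C1c_line_bound f g) auto
    finally show "ennreal ((norm (f (plane_pt (a, b))))\<^sup>2 * (norm (g (plane_pt (a, b))))\<^sup>2) \<le> A a * B b" .
  qed
  also have "\<dots> = (\<integral>\<^sup>+a. A a \<partial>lborel) * (\<integral>\<^sup>+b. B b \<partial>lborel)"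
    using mA mB by (simp add: nn_integral_cmult nn_integral_multc)
  finally have le: "(\<integral>\<^sup>+x. ennreal ((norm (f x))\<^sup>2 * (norm (g x))\<^sup>2) \<partial>lborel) \<le>
      (\<integral>\<^sup>+a. A a \<partial>lborel) * (\<integral>\<^sup>+b. B b \<partial>lborel)" .
  have iA: "(\<integral>\<^sup>+a. A a \<partial>lborel) = (\<integral>\<^sup>+x. F x \<partial>lborel)"
    unfolding A_def by (rule nn_integral_plane(1)[OF mF, symmetric])
  have iB: "(\<integral>\<^sup>+b. B b \<partial>lborel) = (\<integral>\<^sup>+x. G x \<partial>lborel)"
    unfolding B_def by (rule nn_integral_plane(2)[OF mG, symmetric])
  obtain R where R: "\<And>x. R \<le> norm x \<Longrightarrow> f x = 0" "\<And>x h. R \<le> norm x \<Longrightarrow> frechet_derivative f (at x) h = 0"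
    by (rule C1c_bounds[OF f]) (rule that)
  have F_le: "(\<integral>\<^sup>+x. F x \<partial>lborel) \<le> ennreal (2 * (norm (abs_Lsq f) * norm (abs_Lsq (\<lambda>x. frechet_derivative f (at x) (axis 2 1)))))"
    unfolding F_def
    by (rule nn_integral_norm_mult_le[where f = f and R = R and g = "\<lambda>x. frechet_derivative f (at x) (axis 2 1)" and S = R])
       (rule C1c_continuous[OF f], erule R(1), rule C1c_derivative_continuous[OF f], erule R(2))
  obtain S where S: "\<And>x. S \<le> norm x \<Longrightarrow> g x = 0" "\<And>x h. S \<le> norm x \<Longrightarrow> frechet_derivative g (at x) h = 0"
    by (rule C1c_bounds[OF g]) (rule that)
  have G_le: "(\<integral>\<^sup>+x. G x \<partial>lborel) \<le> ennreal (2 * (norm (abs_Lsq g) * norm (abs_Lsq (\<lambda>x. frechet_derivative g (at x) (axis 1 1)))))"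
    unfolding G_def
    by (rule nn_integral_norm_mult_le[where f = g and R = S and g = "\<lambda>x. frechet_derivative g (at x) (axis 1 1)" and S = S])
       (rule C1c_continuous[OF g], erule S(1), rule C1c_derivative_continuous[OF g], erule S(2))
  have FG: "(\<integral>\<^sup>+x. F x \<partial>lborel) * (\<integral>\<^sup>+x. G x \<partial>lborel) \<le>
     ennreal (2 * (norm (abs_Lsq f) * norm (abs_Lsq (\<lambda>x. frechet_derivative f (at x) (axis 2 1))))) *
     ennreal (2 * (norm (abs_Lsq g) * norm (abs_Lsq (\<lambda>x. frechet_derivative g (at x) (axis 1 1)))))"
    using F_le G_le by (rule mult_mono) (rule zero_le)+
  have eq: "ennreal (2 * (norm (abs_Lsq f) * norm (abs_Lsq (\<lambda>x. frechet_derivative f (at x) (axis 2 1))))) *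
     ennreal (2 * (norm (abs_Lsq g) * norm (abs_Lsq (\<lambda>x. frechet_derivative g (at x) (axis 1 1))))) =
     ennreal (4 * (norm (abs_Lsq f) * norm (abs_Lsq (\<lambda>x. frechet_derivative f (at x) (axis 2 1))) *
      (norm (abs_Lsq g) * norm (abs_Lsq (\<lambda>x. frechet_derivative g (at x) (axis 1 1))))))"
    by (subst ennreal_mult[symmetric]) (simp_all add: mult_ac)
  show ?thesis
    using le FG unfolding iA iB eq by (rule order_trans)
qed

section \<open>Weak gradients\<close>

text \<open>This map turns equality almost everywhere on \<open>D\<close> and convergence in \<open>L\<^sup>2(D)\<close> into equality and convergence of points
of a Hilbert space.\<close>

definition L2_class :: "(real^2) set \<Rightarrow> (real^2 \<Rightarrow> 'b::euclidean_space) \<Rightarrow> (real^2, 'b) Lsq" where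
  "L2_class D u = abs_Lsq (\<lambda>x. indicator D x *\<^sub>R u x)"

lemma L2_iff_sq_integrable:
  assumes "D \<in> sets lebesgue"
  shows "u \<in> L2 D \<longleftrightarrow> sq_integrable (\<lambda>x. indicator D x *\<^sub>R u x)"
proof -
  have "(\<lambda>x. (norm (indicator D x *\<^sub>R u x))\<^sup>2) = (\<lambda>x. indicator D x *\<^sub>R (norm (u x))\<^sup>2)"
    by (auto simp: indicator_def fun_eq_iff)
  then show ?thesis using assms
    by (simp add: L2_def sq_integrable_def borel_measurable_restrict_space_iff integrable_restrict_space)
qed

lemma sq_integrable_indicator: "D \<in> sets lebesgue \<Longrightarrow> sq_integrable f \<Longrightarrow> sq_integrable (\<lambda>x. indicator D x *\<^sub>R f x)"
proof (rule sq_integrable_bound[where g = "\<lambda>x. (norm (f x))\<^sup>2"])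
  assume *: "D \<in> sets lebesgue" "sq_integrable f"
  show "integrable lebesgue (\<lambda>x. (norm (f x))\<^sup>2)" using * by (intro sq_integrable_integrable)
  show "(\<lambda>x. indicator D x *\<^sub>R f x) \<in> borel_measurable lebesgue"
    using * by (intro borel_measurable_scaleR borel_measurable_indicator sq_integrable_measurable[OF *(2)]) auto
qed (auto simp: indicator_def)

lemma L2_of_sq_integrable: "D \<in> sets lebesgue \<Longrightarrow> sq_integrable f \<Longrightarrow> f \<in> L2 D"
  by (simp add: L2_iff_sq_integrable sq_integrable_indicator)

lemma L2_diff: "D \<in> sets lebesgue \<Longrightarrow> u \<in> L2 D \<Longrightarrow> w \<in> L2 D \<Longrightarrow> (\<lambda>x. u x - w x) \<in> L2 D"
  using sq_integrable_diff[of "\<lambda>x. indicator D x *\<^sub>R u x" "\<lambda>x. indicator D x *\<^sub>R w x"]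
  by (simp add: L2_iff_sq_integrable scaleR_diff_right)

lemma L2_class_diff: "D \<in> sets lebesgue \<Longrightarrow> u \<in> L2 D \<Longrightarrow> w \<in> L2 D \<Longrightarrow> L2_class D (\<lambda>x. u x - w x) = L2_class D u - L2_class D w"
  unfolding L2_class_def by (subst abs_diff) (auto simp: L2_iff_sq_integrable scaleR_diff_right)

lemma L2_inner_L2_class:
  assumes "D \<in> sets lebesgue" "u \<in> L2 D" "w \<in> L2 D"
  shows "L2_inner D u w = L2_class D u \<bullet> L2_class D w"
proof -
  have "L2_class D u \<bullet> L2_class D w = (\<integral>x. (indicator D x *\<^sub>R u x) \<bullet> (indicator D x *\<^sub>R w x) \<partial>lebesgue)"
    unfolding L2_class_def using assms by (intro inner_abs) (auto simp: L2_iff_sq_integrable)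
  also have "\<dots> = (\<integral>x. indicator D x *\<^sub>R (u x \<bullet> w x) \<partial>lebesgue)"
    by (intro Bochner_Integration.integral_cong) (auto simp: indicator_def)
  finally show ?thesis unfolding L2_inner_def using assms(1) by (simp add: integral_restrict_space)
qed

lemma L2_norm_L2_class: "D \<in> sets lebesgue \<Longrightarrow> u \<in> L2 D \<Longrightarrow> L2_norm D u = norm (L2_class D u)"
  by (simp add: L2_norm_def L2_inner_L2_class norm_eq_sqrt_inner)

lemma L2_class_eqI: "D \<in> sets lebesgue \<Longrightarrow> u \<in> L2 D \<Longrightarrow> w \<in> L2 D \<Longrightarrow> (AE x in lebesgue_on D. u x = w x) \<Longrightarrow> L2_class D u = L2_class D w"
  unfolding L2_class_def by (subst abs_Lsq_eq_iff) (auto simp: L2_iff_sq_integrable AE_restrict_space_iff indicator_def elim!: eventually_mono)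

lemma L2_class_supported: "(\<And>x. x \<notin> D \<Longrightarrow> f x = 0) \<Longrightarrow> L2_class D f = abs_Lsq f"
  unfolding L2_class_def by (rule arg_cong[where f = abs_Lsq]) (auto simp: indicator_def fun_eq_iff)

text \<open>Restriction to \<open>D\<close> does not increase the norm. So the elements that vanish outside \<open>D\<close>, which are those that restriction to
\<open>D\<close> leaves fixed, form a closed set.\<close>

lemma L2_class_repr_closed:
  assumes D: "D \<in> sets lebesgue"
  shows "closed {U :: (real^2, 'b::euclidean_space) Lsq. L2_class D (repr U) = U}"
proof -
  have lip: "norm (L2_class D (repr U) - L2_class D (repr V)) \<le> norm (U - V)" for U V :: "(real^2, 'b) Lsq"
  proof -
    have s: "sq_integrable (\<lambda>x. repr U x - repr V x)" by (intro sq_integrable_diff sq_integrable_repr)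
    have s': "sq_integrable (\<lambda>x. indicator D x *\<^sub>R (repr U x - repr V x))" by (rule sq_integrable_indicator[OF D s])
    have "L2_class D (repr U) - L2_class D (repr V) = abs_Lsq (\<lambda>x. indicator D x *\<^sub>R (repr U x - repr V x))"
      using L2_class_diff[OF D L2_of_sq_integrable[OF D sq_integrable_repr] L2_of_sq_integrable[OF D sq_integrable_repr], of U V] by (simp add: L2_class_def)
    moreover have "(norm (abs_Lsq (\<lambda>x. indicator D x *\<^sub>R (repr U x - repr V x))))\<^sup>2 \<le> (norm (abs_Lsq (\<lambda>x. repr U x - repr V x)))\<^sup>2"
      unfolding norm_abs[OF s] norm_abs[OF s']
      by (intro integral_mono sq_integrable_integrable s s') (auto simp: indicator_def)
    moreover have "abs_Lsq (\<lambda>x. repr U x - repr V x) = U - V"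
      using abs_diff[OF sq_integrable_repr sq_integrable_repr, of U V] by (simp add: abs_repr)
    ultimately have "(norm (L2_class D (repr U) - L2_class D (repr V)))\<^sup>2 \<le> (norm (U - V))\<^sup>2" by simp
    then show ?thesis by (rule power2_le_imp_le) simp
  qed
  have "continuous_on UNIV (\<lambda>U :: (real^2, 'b) Lsq. L2_class D (repr U))"
    unfolding continuous_on_iff
  proof (intro ballI allI impI)
    fix U :: "(real^2, 'b) Lsq" and e :: real assume "0 < e"
    then show "\<exists>d>0. \<forall>V\<in>UNIV. dist V U < d \<longrightarrow> dist (L2_class D (repr V)) (L2_class D (repr U)) < e"
      using lip by (intro exI[of _ e]) (auto simp: dist_norm intro: le_less_trans)
  qed
  then show ?thesis by (intro closed_Collect_eq continuous_on_id)
qed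

lemma L2_class_repr_supported:
  assumes "D \<in> sets lebesgue" "sq_integrable f" "\<And>x. x \<notin> D \<Longrightarrow> f x = 0"
  shows "L2_class D (repr (abs_Lsq f)) = abs_Lsq f"
proof -
  have "L2_class D (repr (abs_Lsq f)) = L2_class D f"
    unfolding L2_class_def
  proof (subst abs_Lsq_eq_iff)
    show "AE x in lebesgue. indicator D x *\<^sub>R repr (abs_Lsq f) x = indicator D x *\<^sub>R f x"
      using repr_abs[OF assms(2)] by eventually_elim simp
  qed (intro sq_integrable_indicator assms sq_integrable_repr)+
  also have "L2_class D f = abs_Lsq f" by (rule L2_class_supported[OF assms(3)])
  finally show ?thesis .
qed

abbreviation jac :: "(real^2 \<Rightarrow> real^2) \<Rightarrow> real^2 \<Rightarrow> real^2^2" where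
  "jac f \<equiv> \<lambda>x. jacobian f (at x)"

lemma jac_nth: "jac f x $ i $ j = frechet_derivative f (at x) (axis j 1) $ i"
  by (simp add: jacobian_def matrix_def)

lemma test_C1c:
  assumes "f \<in> test_functions D" shows "C1c f"
proof -
  obtain K where K: "compact K" "\<And>x. x \<notin> K \<Longrightarrow> f x = 0" and C: "class_C 1 f"
    using assms unfolding test_functions_def by blast
  obtain R where R: "\<And>x. x \<in> K \<Longrightarrow> norm x \<le> R"
    using compact_imp_bounded[OF K(1)] unfolding bounded_iff by blast
  have "f x = 0" if "R + 1 \<le> norm x" for x using K(2)[of x] R[of x] that by (cases "x \<in> K") auto
  then show ?thesis unfolding C1c_def using C by blast
qed

lemma test_outside:
  assumes "f \<in> test_functions D" "x \<notin> D"
  shows "f x = 0" "frechet_derivative f (at x) h = 0"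
proof -
  obtain K where K: "compact K" "K \<subseteq> D" "\<And>x. x \<notin> K \<Longrightarrow> f x = 0"
    using assms unfolding test_functions_def by blast
  have xK: "x \<notin> K" using K(2) assms(2) by blast
  then show "f x = 0" by (rule K(3))
  have "((\<lambda>_. 0) has_derivative frechet_derivative f (at x)) (at x)"
    by (rule has_derivative_transform_within_open[OF C1c_has_derivative[OF test_C1c[OF assms(1)]], of "- K"])
       (use K xK compact_imp_closed in \<open>auto simp: open_Compl\<close>)
  then have "frechet_derivative f (at x) = (\<lambda>_. 0)" by (rule has_derivative_unique[OF _ has_derivative_const])
  then show "frechet_derivative f (at x) h = 0" by simp
qed

lemma jac_outside: "f \<in> test_functions D \<Longrightarrow> x \<notin> D \<Longrightarrow> jac f x = 0"
  by (simp add: vec_eq_iff jac_nth test_outside)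

lemma sq_integrable_jac: "C1c f \<Longrightarrow> sq_integrable (jac f)"
proof -
  assume f: "C1c f"
  obtain R where R: "\<And>x h. R \<le> norm x \<Longrightarrow> frechet_derivative f (at x) h = 0"
    by (rule C1c_bounds[OF f]) (rule that)
  show ?thesis
  proof (rule sq_integrable_continuous)
    show "continuous_on UNIV (jac f)" unfolding jacobian_def matrix_def
      by (intro continuous_on_vec_lambda continuous_on_component C1c_derivative_continuous f)
    show "jac f x = 0" if "R \<le> norm x" for x using R[OF that] by (simp add: vec_eq_iff jac_nth)
  qed
qed

lemma norm_matrix_vector_le: "norm (A *v x) \<le> norm A * norm x" for A :: "real^'n^'m"
proof -
  have "(norm (A *v x))\<^sup>2 = (\<Sum>i\<in>UNIV. ((A *v x) $ i)\<^sup>2)"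
    unfolding power2_norm_eq_inner inner_vec_def by (simp add: power2_eq_square)
  also have "\<dots> = (\<Sum>i\<in>UNIV. (A $ i \<bullet> x)\<^sup>2)" by (simp only: matrix_vector_mul_component)
  also have "\<dots> \<le> (\<Sum>i\<in>UNIV. (norm (A $ i))\<^sup>2 * (norm x)\<^sup>2)"
  proof (rule sum_mono)
    fix i
    have "\<bar>A $ i \<bullet> x\<bar>\<^sup>2 \<le> (norm (A $ i) * norm x)\<^sup>2" by (intro power_mono Cauchy_Schwarz_ineq2) simp
    then show "(A $ i \<bullet> x)\<^sup>2 \<le> (norm (A $ i))\<^sup>2 * (norm x)\<^sup>2" by (simp add: power_mult_distrib)
  qed
  also have "\<dots> = (norm A)\<^sup>2 * (norm x)\<^sup>2"
    by (simp add: power2_norm_eq_inner inner_vec_def sum_distrib_right)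
  finally have "(norm (A *v x))\<^sup>2 \<le> (norm A * norm x)\<^sup>2" by (simp add: power_mult_distrib)
  then show ?thesis by (rule power2_le_imp_le) simp
qed

lemma frechet_eq_jac: "C1c f \<Longrightarrow> frechet_derivative f (at x) h = jac f x *v h"
proof -
  assume "C1c f"
  then have "f differentiable (at x)" using C1c_has_derivative differentiable_def by blast
  then have "(f has_derivative (*v) (jac f x)) (at x)" by (simp add: jacobian_works)
  then show ?thesis by (rule fun_cong[OF frechet_derivative_at[symmetric]])
qed

lemma norm_directional_le: "C1c f \<Longrightarrow> norm (abs_Lsq (\<lambda>x. frechet_derivative f (at x) h)) \<le> norm h * norm (abs_Lsq (jac f))"
proof -
  assume f: "C1c f"
  have "(norm (abs_Lsq (\<lambda>x. frechet_derivative f (at x) h)))\<^sup>2 \<le> (\<integral>x. (norm h)\<^sup>2 * (norm (jac f x))\<^sup>2 \<partial>lebesgue)"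
    unfolding norm_abs[OF sq_integrable_C1c_derivative[OF f]]
  proof (intro integral_mono integrable_mult_right sq_integrable_integrable sq_integrable_C1c_derivative sq_integrable_jac f)
    fix x
    have "norm (frechet_derivative f (at x) h) \<le> norm (jac f x) * norm h"
      unfolding frechet_eq_jac[OF f] by (rule norm_matrix_vector_le)
    from power_mono[OF this norm_ge_zero, of 2]
    show "(norm (frechet_derivative f (at x) h))\<^sup>2 \<le> (norm h)\<^sup>2 * (norm (jac f x))\<^sup>2"
      by (simp add: power_mult_distrib mult.commute)
  qed
  also have "\<dots> = (norm h * norm (abs_Lsq (jac f)))\<^sup>2" by (simp add: power_mult_distrib norm_abs[OF sq_integrable_jac[OF f]])
  finally show ?thesis by (rule power2_le_imp_le) simp
qed

lemma test_L2: "D \<in> sets lebesgue \<Longrightarrow> f \<in> test_functions D \<Longrightarrow> f \<in> L2 D \<and> L2_class D f = abs_Lsq f"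
  using L2_of_sq_integrable[OF _ sq_integrable_C1c[OF test_C1c]] L2_class_supported[of D f] test_outside(1) by blast

lemma jac_L2: "D \<in> sets lebesgue \<Longrightarrow> f \<in> test_functions D \<Longrightarrow> jac f \<in> L2 D \<and> L2_class D (jac f) = abs_Lsq (jac f)"
  using L2_of_sq_integrable[OF _ sq_integrable_jac[OF test_C1c]] L2_class_supported[of D "jac f"] jac_outside by blast

text \<open>With this element, \<open>div_test \<psi> i j\<close>, and the following one, \<open>mat_test \<psi> i j\<close>, the definition of the weak
gradient becomes a family of equations between inner products, and such equations survive limits.\<close>

definition div_test :: "(real^2 \<Rightarrow> real) \<Rightarrow> 2 \<Rightarrow> 2 \<Rightarrow> (real^2, real^2) Lsq" where
  "div_test \<psi> i j = abs_Lsq (\<lambda>x. frechet_derivative \<psi> (at x) (axis j 1) *\<^sub>R axis i 1)"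

definition mat_test :: "(real^2 \<Rightarrow> real) \<Rightarrow> 2 \<Rightarrow> 2 \<Rightarrow> (real^2, real^2^2) Lsq" where
  "mat_test \<psi> i j = abs_Lsq (\<lambda>x. \<psi> x *\<^sub>R axis i (axis j 1))"

lemma sq_integrable_scaleR_const: "sq_integrable f \<Longrightarrow> sq_integrable (\<lambda>x. f x *\<^sub>R c)" for f :: "'a::euclidean_space \<Rightarrow> real"
proof (rule sq_integrable_bound[where g = "\<lambda>x. (norm (f x))\<^sup>2 * (norm c)\<^sup>2"])
  assume *: "sq_integrable f"
  show "integrable lebesgue (\<lambda>x. (norm (f x))\<^sup>2 * (norm c)\<^sup>2)" using * by (intro integrable_mult_left sq_integrable_integrable)
  show "(\<lambda>x. f x *\<^sub>R c) \<in> borel_measurable lebesgue" using sq_integrable_measurable[OF *] by (intro borel_measurable_scaleR) auto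
qed (simp add: power_mult_distrib)

lemma has_weak_gradient_iff:
  assumes D: "D \<in> sets lebesgue" and u: "u \<in> L2 D"
  shows "has_weak_gradient D u G \<longleftrightarrow> G \<in> L2 D \<and>
    (\<forall>\<psi>\<in>test_functions D. \<forall>i j. L2_class D u \<bullet> div_test \<psi> i j = - (L2_class D G \<bullet> mat_test \<psi> i j))"
proof -
  have 1: "(\<integral>x. u x $ i * frechet_derivative \<psi> (at x) (axis j 1) \<partial>lebesgue_on D) = L2_class D u \<bullet> div_test \<psi> i j"
    if "\<psi> \<in> test_functions D" for \<psi> i j
  proof -
    have s: "sq_integrable (\<lambda>x. frechet_derivative \<psi> (at x) (axis j 1) *\<^sub>R axis i (1::real))"
      by (intro sq_integrable_scaleR_const sq_integrable_C1c_derivative test_C1c[OF that])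
    have "L2_class D u \<bullet> div_test \<psi> i j = (\<integral>x. (indicator D x *\<^sub>R u x) \<bullet> (frechet_derivative \<psi> (at x) (axis j 1) *\<^sub>R axis i 1) \<partial>lebesgue)"
      unfolding L2_class_def div_test_def using u D by (intro inner_abs s) (simp add: L2_iff_sq_integrable)
    also have "\<dots> = (\<integral>x. indicator D x *\<^sub>R (u x $ i * frechet_derivative \<psi> (at x) (axis j 1)) \<partial>lebesgue)"
      by (simp add: inner_axis mult_ac)
    finally show ?thesis using D by (simp add: integral_restrict_space)
  qed
  have 2: "(\<integral>x. G x $ i $ j * \<psi> x \<partial>lebesgue_on D) = L2_class D G \<bullet> mat_test \<psi> i j"
    if "\<psi> \<in> test_functions D" "G \<in> L2 D" for \<psi> i j
  proof -
    have s: "sq_integrable (\<lambda>x. \<psi> x *\<^sub>R axis i (axis j (1::real)))"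
      by (intro sq_integrable_scaleR_const sq_integrable_C1c test_C1c[OF that(1)])
    have "L2_class D G \<bullet> mat_test \<psi> i j = (\<integral>x. (indicator D x *\<^sub>R G x) \<bullet> (\<psi> x *\<^sub>R axis i (axis j 1)) \<partial>lebesgue)"
      unfolding L2_class_def mat_test_def using that D by (intro inner_abs s) (simp add: L2_iff_sq_integrable)
    also have "\<dots> = (\<integral>x. indicator D x *\<^sub>R (G x $ i $ j * \<psi> x) \<partial>lebesgue)"
      by (simp add: inner_axis mult_ac)
    finally show ?thesis using D by (simp add: integral_restrict_space)
  qed
  show ?thesis unfolding has_weak_gradient_def using 1 2 by auto
qed

text \<open>Integration by parts: the derivative of \<open>f\<^sub>i \<psi>\<close>, a compactly supported \<open>C\<^sup>1\<close> function, has integral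
zero.\<close>

lemma has_weak_gradient_test:
  assumes D: "D \<in> sets lebesgue" and f: "f \<in> test_functions D"
  shows "has_weak_gradient D f (jac f)"
  unfolding has_weak_gradient_def
proof (intro conjI allI impI)
  show "jac f \<in> L2 D" using jac_L2[OF D f] by blast
  fix \<psi> :: "real^2 \<Rightarrow> real" and i j :: 2
  assume p: "\<psi> \<in> test_functions D"
  note cf = test_C1c[OF f] and cp = test_C1c[OF p]
  define g where "g x = f x $ i * \<psi> x" for x
  have dg: "(g has_derivative (\<lambda>h. f x $ i * frechet_derivative \<psi> (at x) h + frechet_derivative f (at x) h $ i * \<psi> x)) (at x)" for x
    unfolding g_def
    by (intro has_derivative_mult C1c_has_derivative[OF cp]
        bounded_linear.has_derivative[OF bounded_linear_vec_nth] C1c_has_derivative[OF cf])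
  have fd: "frechet_derivative g (at x) h = f x $ i * frechet_derivative \<psi> (at x) h + frechet_derivative f (at x) h $ i * \<psi> x" for x h
    by (rule fun_cong[OF frechet_derivative_at[OF dg, symmetric]])
  have "class_C (Suc 0) g"
  proof (rule class_C_SucI[OF dg])
    show "class_C 0 (\<lambda>x. f x $ i * frechet_derivative \<psi> (at x) b + frechet_derivative f (at x) b $ i * \<psi> x)" for b
      unfolding class_C.simps by (intro continuous_intros C1c_continuous C1c_derivative_continuous cf cp)
  qed
  moreover obtain R where R: "\<And>x. R \<le> norm x \<Longrightarrow> f x = 0" using cf unfolding C1c_def by blast
  ultimately have cg: "C1c g" unfolding C1c_def g_def by (intro conjI exI[of _ R] allI impI) simp_all
  have s1: "integrable lebesgue (\<lambda>x. f x $ i * frechet_derivative \<psi> (at x) (axis j 1))"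
    using sq_integrable_inner_integrable[OF sq_integrable_C1c[OF cf] sq_integrable_scaleR_const[where c = "axis i 1", OF sq_integrable_C1c_derivative[where h = "axis j 1", OF cp]]]
    by (simp add: inner_axis mult.commute)
  have s2: "integrable lebesgue (\<lambda>x. jac f x $ i $ j * \<psi> x)"
    using sq_integrable_inner_integrable[OF sq_integrable_jac[OF cf] sq_integrable_scaleR_const[OF sq_integrable_C1c[OF cp], of "axis i (axis j 1)"]]
    by (simp add: inner_axis mult.commute)
  have "0 = (\<integral>x. f x $ i * frechet_derivative \<psi> (at x) (axis j 1) + jac f x $ i $ j * \<psi> x \<partial>lebesgue)"
    using integral_derivative_zero[OF cg, of "axis j 1"] unfolding fd jac_nth by simp
  also have "\<dots> = (\<integral>x. f x $ i * frechet_derivative \<psi> (at x) (axis j 1) \<partial>lebesgue) + (\<integral>x. jac f x $ i $ j * \<psi> x \<partial>lebesgue)"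
    by (rule Bochner_Integration.integral_add[OF s1 s2])
  finally have e: "(\<integral>x. f x $ i * frechet_derivative \<psi> (at x) (axis j 1) \<partial>lebesgue) = - (\<integral>x. jac f x $ i $ j * \<psi> x \<partial>lebesgue)"
    by simp
  have "(\<integral>x. f x $ i * frechet_derivative \<psi> (at x) (axis j 1) \<partial>lebesgue_on D) = (\<integral>x. f x $ i * frechet_derivative \<psi> (at x) (axis j 1) \<partial>lebesgue)"
    using D test_outside(1)[OF f]
    by (simp add: integral_restrict_space, intro Bochner_Integration.integral_cong) (auto simp: indicator_def)
  moreover have "(\<integral>x. jac f x $ i $ j * \<psi> x \<partial>lebesgue_on D) = (\<integral>x. jac f x $ i $ j * \<psi> x \<partial>lebesgue)"
    using D jac_outside[OF f]
    by (simp add: integral_restrict_space, intro Bochner_Integration.integral_cong) (auto simp: indicator_def)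
  ultimately show "(\<integral>x. f x $ i * frechet_derivative \<psi> (at x) (axis j 1) \<partial>lebesgue_on D) = - (\<integral>x. jac f x $ i $ j * \<psi> x \<partial>lebesgue_on D)"
    using e by simp
qed

lemma has_weak_gradient_diff:
  assumes D: "D \<in> sets lebesgue" and "u \<in> L2 D" "w \<in> L2 D" "has_weak_gradient D u G" "has_weak_gradient D w G'"
  shows "has_weak_gradient D (\<lambda>x. u x - w x) (\<lambda>x. G x - G' x)"
  using assms
  by (simp add: has_weak_gradient_iff L2_diff L2_class_diff inner_diff_left)

text \<open>The difference of two weak gradients is orthogonal to all test functions, and the fundamental lemma applies to each of
its entries. These are integrable because \<open>D\<close> has finite measure.\<close>

lemma has_weak_gradient_unique:
  assumes D: "open D" "bounded D" and u: "u \<in> L2 D" and G: "has_weak_gradient D u G" "has_weak_gradient D u G'"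
  shows "L2_class D G = L2_class D G'"
proof -
  have DL: "D \<in> sets lebesgue" using D(1) by (simp add: lborelD)
  have GL: "G \<in> L2 D" "G' \<in> L2 D" using G unfolding has_weak_gradient_def by auto
  define E where "E x = G x - G' x" for x
  have EL: "E \<in> L2 D" unfolding E_def by (rule L2_diff[OF DL GL])
  have zero: "L2_class D E \<bullet> mat_test \<psi> i j = 0" if "\<psi> \<in> test_functions D" for \<psi> i j
    using G that unfolding E_def has_weak_gradient_iff[OF DL u] by (simp add: L2_class_diff[OF DL GL] inner_diff_left)
  obtain R where R: "\<And>x. x \<in> D \<Longrightarrow> norm x \<le> R" using D(2) unfolding bounded_iff by blast
  have one: "sq_integrable (\<lambda>x. indicator D x :: real)"
    unfolding sq_integrable_def
  proof
    show "(\<lambda>x. indicator D x :: real) \<in> borel_measurable lebesgue" using DL by simp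
    have "emeasure lebesgue D < \<infinity>" using emeasure_bounded_finite[OF D(2)] D(1) by simp
    then have "integrable lebesgue (\<lambda>x. indicator D x :: real)" using DL by (intro integrable_real_indicator)
    moreover have "(\<lambda>x. (norm (indicator D x :: real))\<^sup>2) = (\<lambda>x. indicator D x :: real)"
      by (auto simp: indicator_def fun_eq_iff)
    ultimately show "integrable lebesgue (\<lambda>x. (norm (indicator D x :: real))\<^sup>2)" by simp
  qed
  have comp: "AE x in lebesgue_on D. E x $ i $ j = 0" for i j
  proof (rule fundamental_lemma[OF D(1)])
    have "sq_integrable (\<lambda>x. indicator D x *\<^sub>R E x)" using EL DL by (simp add: L2_iff_sq_integrable)
    from sq_integrable_inner_integrable[OF this sq_integrable_scaleR_const[OF one, of "axis i (axis j 1)"]]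
    have "integrable lebesgue (\<lambda>x. indicator D x * (indicator D x * E x $ i $ j))"
      by (simp add: inner_axis mult_ac)
    moreover have "(\<lambda>x. indicator D x * (indicator D x * E x $ i $ j)) = (\<lambda>x. indicator D x *\<^sub>R E x $ i $ j)"
      by (auto simp: indicator_def fun_eq_iff)
    ultimately show "integrable (lebesgue_on D) (\<lambda>x. E x $ i $ j)" using DL by (simp add: integrable_restrict_space)
    fix \<psi> :: "real^2 \<Rightarrow> real" assume p: "\<psi> \<in> test_functions D"
    have s: "sq_integrable (\<lambda>x. \<psi> x *\<^sub>R axis i (axis j (1::real)))"
      by (intro sq_integrable_scaleR_const sq_integrable_C1c test_C1c[OF p])
    have "L2_class D E \<bullet> mat_test \<psi> i j = (\<integral>x. (indicator D x *\<^sub>R E x) \<bullet> (\<psi> x *\<^sub>R axis i (axis j 1)) \<partial>lebesgue)"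
      unfolding L2_class_def mat_test_def using EL DL by (intro inner_abs s) (simp add: L2_iff_sq_integrable)
    also have "\<dots> = (\<integral>x. indicator D x *\<^sub>R (E x $ i $ j * \<psi> x) \<partial>lebesgue)"
      by (simp add: inner_axis mult_ac)
    finally show "(\<integral>x. E x $ i $ j * \<psi> x \<partial>lebesgue_on D) = 0"
      using zero[OF p, of i j] DL by (simp add: integral_restrict_space)
  qed
  have "AE x in lebesgue_on D. \<forall>i\<in>UNIV. \<forall>j\<in>UNIV. E x $ i $ j = 0"
    by (intro AE_finite_allI comp) auto
  then have "AE x in lebesgue_on D. G x = G' x"
    by eventually_elim (simp add: vec_eq_iff E_def)
  then show ?thesis by (rule L2_class_eqI[OF DL GL])
qed

section \<open>The graph of the gradient on V\<close>

lemma subspace_closure_normed: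
  fixes S :: "'a::real_normed_vector set"
  assumes "subspace S" shows "subspace (closure S)"
proof (rule subspaceI)
  show "0 \<in> closure S" using subspace_0[OF assms] closure_subset by blast
  show "x + y \<in> closure S" if xy: "x \<in> closure S" "y \<in> closure S" for x y
  proof -
    obtain a b where ab: "\<And>n. a n \<in> S" "a \<longlonglongrightarrow> x" "\<And>n. b n \<in> S" "b \<longlonglongrightarrow> y"
      using xy unfolding closure_sequential by blast
    have "\<forall>n. a n + b n \<in> S" using ab subspace_add[OF assms] by blast
    moreover have "(\<lambda>n. a n + b n) \<longlonglongrightarrow> x + y" by (rule tendsto_add[OF ab(2,4)])
    ultimately show ?thesis unfolding closure_sequential by (intro exI[of _ "\<lambda>n. a n + b n"] conjI)
  qed
  show "c *\<^sub>R x \<in> closure S" if x: "x \<in> closure S" for c x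
  proof -
    obtain a where a: "\<And>n. a n \<in> S" "a \<longlonglongrightarrow> x" using x unfolding closure_sequential by blast
    have "\<forall>n. c *\<^sub>R a n \<in> S" using a subspace_scale[OF assms] by blast
    moreover have "(\<lambda>n. c *\<^sub>R a n) \<longlonglongrightarrow> c *\<^sub>R x" by (rule tendsto_scaleR[OF tendsto_const a(2)])
    ultimately show ?thesis unfolding closure_sequential by (intro exI[of _ "\<lambda>n. c *\<^sub>R a n"] conjI)
  qed
qed

definition test_graph :: "(real^2 \<Rightarrow> real^2) set \<Rightarrow> ((real^2, real^2) Lsq \<times> (real^2, real^2^2) Lsq) set" where
  "test_graph T = (\<lambda>f. (abs_Lsq f, abs_Lsq (jac f))) ` T"

text \<open>The graph of the weak gradient on \<open>V\<close>, as a set of pairs of elements of \<open>L\<^sup>2\<close>: the first components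
are the classes of the elements of \<open>V_space D\<close> (\<open>V_spaceD\<close>, \<open>V_spaceI\<close>).\<close>

definition V_graph :: "(real^2) set \<Rightarrow> ((real^2, real^2) Lsq \<times> (real^2, real^2^2) Lsq) set" where
  "V_graph D = closure (test_graph (solenoidal_tests D))"

lemma solenoidal_test: "f \<in> solenoidal_tests D \<Longrightarrow> f \<in> test_functions D"
  by (simp add: solenoidal_tests_def)

lemma test_linear:
  assumes f: "f \<in> test_functions D" and g: "g \<in> test_functions D"
  shows "(\<lambda>x. a *\<^sub>R f x + g x) \<in> test_functions D"
proof -
  obtain K L where K: "compact K" "K \<subseteq> D" "\<And>x. x \<notin> K \<Longrightarrow> f x = 0"
    and L: "compact L" "L \<subseteq> D" "\<And>x. x \<notin> L \<Longrightarrow> g x = 0"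
    using f g unfolding test_functions_def by blast
  have "class_C k (\<lambda>x. a *\<^sub>R f x + g x)" for k
    using f g unfolding test_functions_def by (intro class_C_add class_C_scaleR class_C_const) auto
  moreover have "compact (K \<union> L)" "K \<union> L \<subseteq> D" using K L by auto
  moreover have "a *\<^sub>R f x + g x = 0" if "x \<notin> K \<union> L" for x using K(3) L(3) that by simp
  ultimately show ?thesis unfolding test_functions_def by blast
qed

lemma jac_linear:
  assumes f: "C1c f" and g: "C1c g"
  shows "jac (\<lambda>x. a *\<^sub>R f x + g x) x = a *\<^sub>R jac f x + jac g x"
proof -
  have "((\<lambda>x. a *\<^sub>R f x + g x) has_derivative (\<lambda>h. a *\<^sub>R frechet_derivative f (at x) h + frechet_derivative g (at x) h)) (at x)"
    by (intro has_derivative_add has_derivative_scaleR_right C1c_has_derivative f g)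
  from frechet_derivative_at[OF this, symmetric] show ?thesis
    by (simp add: vec_eq_iff jac_nth)
qed

lemma abs_linear: "sq_integrable f \<Longrightarrow> sq_integrable g \<Longrightarrow> abs_Lsq (\<lambda>x. a *\<^sub>R f x + g x) = a *\<^sub>R abs_Lsq f + abs_Lsq g"
  by (simp add: abs_scaleR abs_add sq_integrable_scaleR)

lemma subspace_test_graph: "subspace (test_graph (solenoidal_tests D))"
proof -
  have zero: "(\<lambda>_. 0) \<in> solenoidal_tests D"
  proof -
    have "(\<lambda>_. 0) \<in> test_functions D" unfolding test_functions_def
      by (auto intro!: class_C_const exI[of _ "{}"])
    moreover have "jac (\<lambda>_. 0) x = 0" for x
      by (simp add: vec_eq_iff jac_nth frechet_derivative_const)
    ultimately show ?thesis by (simp add: solenoidal_tests_def trace_def)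
  qed
  have lin: "a *\<^sub>R p + q \<in> test_graph (solenoidal_tests D)"
    if pq: "p \<in> test_graph (solenoidal_tests D)" "q \<in> test_graph (solenoidal_tests D)" for a p q
  proof -
    obtain f g where fg: "f \<in> solenoidal_tests D" "g \<in> solenoidal_tests D"
      "p = (abs_Lsq f, abs_Lsq (jac f))" "q = (abs_Lsq g, abs_Lsq (jac g))"
      using pq unfolding test_graph_def by blast
    note tf = solenoidal_test[OF fg(1)] and tg = solenoidal_test[OF fg(2)]
    note cf = test_C1c[OF tf] and cg = test_C1c[OF tg]
    have "trace (jac (\<lambda>x. a *\<^sub>R f x + g x) x) = a * trace (jac f x) + trace (jac g x)" for x
      unfolding jac_linear[OF cf cg] by (simp add: trace_def sum.distrib sum_distrib_left)
    then have "(\<lambda>x. a *\<^sub>R f x + g x) \<in> solenoidal_tests D"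
      using fg test_linear[OF tf tg, of a] by (simp add: solenoidal_tests_def)
    moreover have "abs_Lsq (\<lambda>x. a *\<^sub>R f x + g x) = a *\<^sub>R abs_Lsq f + abs_Lsq g"
      by (rule abs_linear[OF sq_integrable_C1c[OF cf] sq_integrable_C1c[OF cg]])
    moreover have "abs_Lsq (jac (\<lambda>x. a *\<^sub>R f x + g x)) = a *\<^sub>R abs_Lsq (jac f) + abs_Lsq (jac g)"
      unfolding jac_linear[OF cf cg] by (rule abs_linear[OF sq_integrable_jac[OF cf] sq_integrable_jac[OF cg]])
    ultimately show ?thesis unfolding test_graph_def fg(3,4) by (intro image_eqI) simp_all
  qed
  have z: "0 \<in> test_graph (solenoidal_tests D)"
  proof -
    have "jac (\<lambda>_. 0) = (\<lambda>_. 0)"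
      by (simp add: fun_eq_iff vec_eq_iff jac_nth frechet_derivative_const)
    then have "(0, 0) = (abs_Lsq (\<lambda>_. 0), abs_Lsq (jac (\<lambda>_. 0)))" by (simp add: abs_0)
    then show ?thesis unfolding test_graph_def using zero by (simp add: zero_prod_def image_iff) blast
  qed
  show ?thesis
  proof (rule subspaceI[OF z])
    show "p + q \<in> test_graph (solenoidal_tests D)" if "p \<in> test_graph (solenoidal_tests D)" "q \<in> test_graph (solenoidal_tests D)" for p q
      using lin[OF that, of 1] by simp
    show "c *\<^sub>R p \<in> test_graph (solenoidal_tests D)" if "p \<in> test_graph (solenoidal_tests D)" for c p
      using lin[OF that z, of c] by simp
  qed
qed

lemma subspace_V_graph: "subspace (V_graph D)"
  unfolding V_graph_def by (rule subspace_closure_normed[OF subspace_test_graph])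

lemma closed_V_graph: "closed (V_graph D)"
  unfolding V_graph_def by simp

text \<open>The norm is defined by a chosen weak gradient, but any weak gradient computes it.\<close>

lemma H1_norm_L2_class:
  assumes D: "open D" "bounded D" and u: "u \<in> L2 D" and G: "has_weak_gradient D u G"
  shows "H1_norm D u = norm (L2_class D u, L2_class D G)" "L2_class D (weak_gradient D u) = L2_class D G"
    "has_weak_gradient D u (weak_gradient D u)" "u \<in> H1 D"
proof -
  have DL: "D \<in> sets lebesgue" using D(1) by (simp add: lborelD)
  show wg: "has_weak_gradient D u (weak_gradient D u)" unfolding weak_gradient_def by (rule someI[of _ G]) (rule G)
  show e: "L2_class D (weak_gradient D u) = L2_class D G" by (rule has_weak_gradient_unique[OF D u wg G])
  have "weak_gradient D u \<in> L2 D" using wg unfolding has_weak_gradient_def by blast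
  then show "H1_norm D u = norm (L2_class D u, L2_class D G)"
    unfolding H1_norm_def by (simp add: L2_norm_L2_class[OF DL] u e norm_prod_def)
  show "u \<in> H1 D" unfolding H1_def using u G by blast
qed

text \<open>The \<open>H\<^sup>1\<close> norm of \<open>u - f\<close> is the distance of the two pairs of function and gradient. The definition of
that norm picks some weak gradient of \<open>u - f\<close>, so the uniqueness of weak gradients up to null sets enters here.\<close>

lemma closure_test_graph_iff:
  assumes D: "open D" "bounded D" and T: "T \<subseteq> test_functions D"
    and u: "u \<in> L2 D" and G: "has_weak_gradient D u G"
  shows "(L2_class D u, L2_class D G) \<in> closure (test_graph T) \<longleftrightarrow> (\<forall>e>0. \<exists>f\<in>T. H1_norm D (\<lambda>x. u x - f x) < e)"
proof -
  have DL: "D \<in> sets lebesgue" using D(1) by (simp add: lborelD)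
  have GL: "G \<in> L2 D" using G unfolding has_weak_gradient_def by blast
  have "H1_norm D (\<lambda>x. u x - f x) = dist (abs_Lsq f, abs_Lsq (jac f)) (L2_class D u, L2_class D G)" if f: "f \<in> T" for f
  proof -
    have ft: "f \<in> test_functions D" using f T by blast
    note fL = test_L2[OF DL ft] and jL = jac_L2[OF DL ft]
    have "H1_norm D (\<lambda>x. u x - f x) = norm (L2_class D (\<lambda>x. u x - f x), L2_class D (\<lambda>x. G x - jac f x))"
      by (rule H1_norm_L2_class(1)[OF D L2_diff[OF DL u conjunct1[OF fL]]
          has_weak_gradient_diff[OF DL u conjunct1[OF fL] G has_weak_gradient_test[OF DL ft]]])
    also have "\<dots> = norm ((L2_class D u, L2_class D G) - (abs_Lsq f, abs_Lsq (jac f)))"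
      using fL jL by (simp add: L2_class_diff[OF DL u] L2_class_diff[OF DL GL])
    finally have e: "H1_norm D (\<lambda>x. u x - f x) = norm ((L2_class D u, L2_class D G) - (abs_Lsq f, abs_Lsq (jac f)))" .
    show ?thesis unfolding dist_norm e by (rule norm_minus_commute)
  qed
  then show ?thesis unfolding closure_approachable test_graph_def by simp
qed

text \<open>Both properties are closed conditions on pairs and hold for test functions.\<close>

lemma closure_test_graph_gradient:
  assumes D: "open D" and T: "T \<subseteq> test_functions D"
    and u: "u \<in> L2 D" and G: "(L2_class D u, G') \<in> closure (test_graph T)"
  shows "has_weak_gradient D u (repr G')" "L2_class D (repr G') = G'"
proof -
  have DL: "D \<in> sets lebesgue" using D by (simp add: lborelD)
  have "closure (test_graph T) \<subseteq> {p. L2_class D (repr (snd p)) = snd p}"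
  proof (rule closure_minimal)
    show "test_graph T \<subseteq> {p. L2_class D (repr (snd p)) = snd p}"
      using T L2_class_repr_supported[OF DL sq_integrable_jac[OF test_C1c] jac_outside] unfolding test_graph_def by auto
    have "closed (snd -` {U :: (real^2, real^2^2) Lsq. L2_class D (repr U) = U})"
      by (intro closed_vimage L2_class_repr_closed[OF DL] continuous_on_snd continuous_on_id)
    then show "closed {p :: (real^2, real^2) Lsq \<times> (real^2, real^2^2) Lsq. L2_class D (repr (snd p)) = snd p}"
      by (simp add: vimage_def)
  qed
  then show e: "L2_class D (repr G') = G'" using G by auto
  have sub: "closure (test_graph T) \<subseteq> {p. fst p \<bullet> div_test \<psi> i j = - (snd p \<bullet> mat_test \<psi> i j)}"
    if p: "\<psi> \<in> test_functions D" for \<psi> i j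
  proof (rule closure_minimal)
    show "closed {p. fst p \<bullet> div_test \<psi> i j = - (snd p \<bullet> mat_test \<psi> i j)}"
      by (intro closed_Collect_eq continuous_intros)
    show "test_graph T \<subseteq> {p. fst p \<bullet> div_test \<psi> i j = - (snd p \<bullet> mat_test \<psi> i j)}"
    proof
      fix p assume "p \<in> test_graph T"
      then obtain f where f: "f \<in> T" "p = (abs_Lsq f, abs_Lsq (jac f))" unfolding test_graph_def by blast
      have ft: "f \<in> test_functions D" using f T by blast
      note fL = test_L2[OF DL ft] and jL = jac_L2[OF DL ft]
      have "L2_class D f \<bullet> div_test \<psi> i j = - (L2_class D (jac f) \<bullet> mat_test \<psi> i j)"
        using has_weak_gradient_test[OF DL ft] p unfolding has_weak_gradient_iff[OF DL conjunct1[OF fL]] by blast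
      then show "p \<in> {p. fst p \<bullet> div_test \<psi> i j = - (snd p \<bullet> mat_test \<psi> i j)}"
        using fL jL f(2) by simp
    qed
  qed
  have "L2_class D u \<bullet> div_test \<psi> i j = - (G' \<bullet> mat_test \<psi> i j)" if "\<psi> \<in> test_functions D" for \<psi> i j
    using subsetD[OF sub[OF that] G] by simp
  then show "has_weak_gradient D u (repr G')"
    unfolding has_weak_gradient_iff[OF DL u] e using L2_of_sq_integrable[OF DL sq_integrable_repr] by simp
qed

lemma V_spaceD:
  assumes D: "open D" "bounded D" and u: "u \<in> V_space D"
  shows "u \<in> L2 D" "weak_gradient D u \<in> L2 D" "(L2_class D u, L2_class D (weak_gradient D u)) \<in> V_graph D"
proof -
  obtain G where G: "has_weak_gradient D u G" and uL: "u \<in> L2 D"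
    using u unfolding V_space_def H10_def H1_def by blast
  note wg = H1_norm_L2_class[OF D uL G]
  show "u \<in> L2 D" by (rule uL)
  show "weak_gradient D u \<in> L2 D" using wg(3) unfolding has_weak_gradient_def by blast
  show "(L2_class D u, L2_class D (weak_gradient D u)) \<in> V_graph D"
    unfolding V_graph_def using u solenoidal_test
    by (subst closure_test_graph_iff[OF D _ uL wg(3)]) (auto simp: V_space_def)
qed

lemma V_spaceI:
  assumes D: "open D" "bounded D" and u: "u \<in> L2 D" and G: "(L2_class D u, G') \<in> V_graph D"
  shows "u \<in> V_space D" "L2_class D (weak_gradient D u) = G'"
proof -
  have T: "solenoidal_tests D \<subseteq> test_functions D" using solenoidal_test by blast
  note hg = closure_test_graph_gradient[OF D(1) T u G[unfolded V_graph_def]]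
  note wg = H1_norm_L2_class[OF D u hg(1)]
  show "L2_class D (weak_gradient D u) = G'" using wg(2) hg(2) by simp
  have "\<forall>e>0. \<exists>f\<in>solenoidal_tests D. H1_norm D (\<lambda>x. u x - f x) < e"
    using closure_test_graph_iff[OF D T u hg(1)] G unfolding hg(2) V_graph_def by blast
  then show "u \<in> V_space D" unfolding V_space_def H10_def using wg(4) T by blast
qed

lemma H1_norm_V:
  assumes D: "open D" "bounded D" and u: "u \<in> L2 D" and G: "(L2_class D u, G') \<in> V_graph D"
  shows "H1_norm D u = norm (L2_class D u, G')"
proof -
  have T: "solenoidal_tests D \<subseteq> test_functions D" using solenoidal_test by blast
  note hg = closure_test_graph_gradient[OF D(1) T u G[unfolded V_graph_def]]
  show ?thesis using H1_norm_L2_class(1)[OF D u hg(1)] hg(2) by simp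
qed

lemma H_space_iff:
  assumes D: "D \<in> sets lebesgue"
  shows "u \<in> H_space D \<longleftrightarrow> u \<in> L2 D \<and> L2_class D u \<in> closure (abs_Lsq ` solenoidal_tests D)"
proof -
  have "L2_norm D (\<lambda>x. u x - f x) = dist (abs_Lsq f) (L2_class D u)" if "u \<in> L2 D" "f \<in> solenoidal_tests D" for f
    using test_L2[OF D solenoidal_test[OF that(2)]] that(1)
    by (simp add: L2_norm_L2_class[OF D] L2_diff[OF D] L2_class_diff[OF D] dist_norm norm_minus_commute)
  then show ?thesis unfolding H_space_def closure_approachable by auto
qed

lemma V_graph_fst_supported:
  assumes D: "open D" and p: "(U, A) \<in> V_graph D"
  shows "L2_class D (repr U) = U" "U \<in> closure (abs_Lsq ` solenoidal_tests D)" "repr U \<in> L2 D"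
proof -
  have DL: "D \<in> sets lebesgue" using D by (simp add: lborelD)
  obtain q where q: "\<And>n. q n \<in> test_graph (solenoidal_tests D)" "q \<longlonglongrightarrow> (U, A)"
    using p unfolding V_graph_def closure_sequential by blast
  have "fst (q n) \<in> abs_Lsq ` solenoidal_tests D" for n using q(1)[of n] unfolding test_graph_def by auto
  moreover have "(\<lambda>n. fst (q n)) \<longlonglongrightarrow> U" using tendsto_fst[OF q(2)] by simp
  ultimately show c: "U \<in> closure (abs_Lsq ` solenoidal_tests D)"
    unfolding closure_sequential by (intro exI[of _ "\<lambda>n. fst (q n)"] conjI allI)
  have "closure (abs_Lsq ` solenoidal_tests D) \<subseteq> {U. L2_class D (repr U) = U}"
  proof (rule closure_minimal[OF _ L2_class_repr_closed[OF DL]])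
    show "abs_Lsq ` solenoidal_tests D \<subseteq> {U. L2_class D (repr U) = U}"
      using L2_class_repr_supported[OF DL sq_integrable_C1c[OF test_C1c[OF solenoidal_test]] test_outside(1)[OF solenoidal_test]] by auto
  qed
  then show "L2_class D (repr U) = U" using c by auto
  show "repr U \<in> L2 D" by (rule L2_of_sq_integrable[OF DL sq_integrable_repr])
qed

section \<open>The convection term\<close>

text \<open>The matrix \<open>w \<otimes> u\<close>. Its order of factors matches \<open>inner_outer\<close>, which turns the convection term into an
inner product with the gradient.\<close>

definition outer :: "real^2 \<Rightarrow> real^2 \<Rightarrow> real^2^2" where "outer w u = (\<chi> i j. w $ i * u $ j)"

lemma norm_outer: "(norm (outer w u))\<^sup>2 = (norm w)\<^sup>2 * (norm u)\<^sup>2"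
  by (simp add: outer_def power2_norm_eq_inner inner_vec_def UNIV_2 algebra_simps)

lemma inner_outer: "G \<bullet> outer w u = (G *v u) \<bullet> w"
  by (simp add: outer_def inner_vec_def matrix_vector_mult_def UNIV_2 algebra_simps)

lemma outer_diff: "outer w (u - v) = outer w u - outer w v"
  by (simp add: outer_def vec_eq_iff algebra_simps)

lemma continuous_outer: "continuous_on UNIV (\<lambda>p. outer (fst p) (snd p))"
  unfolding outer_def by (intro continuous_on_vec_lambda continuous_intros)

lemma measurable_outer:
  assumes "f \<in> borel_measurable M" "g \<in> borel_measurable M"
  shows "(\<lambda>x. outer (f x) (g x)) \<in> borel_measurable M"
  by (rule borel_measurable_continuous_Pair[OF assms continuous_outer])

definition outer_class :: "(real^2, real^2) Lsq \<Rightarrow> (real^2, real^2) Lsq \<Rightarrow> (real^2, real^2^2) Lsq" where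
  "outer_class U W = abs_Lsq (\<lambda>x. outer (repr W x) (repr U x))"

text \<open>The directional derivatives in Ladyzhenskaya's inequality are bounded by the full gradient.\<close>

lemma outer_C1c:
  fixes f g :: "real^2 \<Rightarrow> real^2"
  assumes f: "C1c f" and g: "C1c g"
  shows "sq_integrable (\<lambda>x. outer (g x) (f x))"
    "(norm (abs_Lsq (\<lambda>x. outer (g x) (f x))))\<^sup>2 \<le>
      4 * norm (abs_Lsq f) * norm (abs_Lsq (jac f)) * (norm (abs_Lsq g) * norm (abs_Lsq (jac g)))"
proof -
  obtain R where R: "\<And>x. R \<le> norm x \<Longrightarrow> f x = 0" using f unfolding C1c_def by blast
  show s: "sq_integrable (\<lambda>x. outer (g x) (f x))"
  proof (rule sq_integrable_continuous)
    show "continuous_on UNIV (\<lambda>x. outer (g x) (f x))"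
      unfolding outer_def by (intro continuous_on_vec_lambda continuous_intros C1c_continuous f g)
    show "outer (g x) (f x) = 0" if "R \<le> norm x" for x using R[OF that] by (simp add: outer_def vec_eq_iff)
  qed
  define a where "a = norm (abs_Lsq f) * norm (abs_Lsq (\<lambda>x. frechet_derivative f (at x) (axis 2 1))) *
      (norm (abs_Lsq g) * norm (abs_Lsq (\<lambda>x. frechet_derivative g (at x) (axis 1 1))))"
  have "ennreal ((norm (abs_Lsq (\<lambda>x. outer (g x) (f x))))\<^sup>2) = (\<integral>\<^sup>+x. ennreal ((norm (outer (g x) (f x)))\<^sup>2) \<partial>lebesgue)"
    unfolding norm_abs[OF s] by (rule nn_integral_eq_integral[symmetric, OF sq_integrable_integrable[OF s]]) simp
  also have "\<dots> = (\<integral>\<^sup>+x. ennreal ((norm (f x))\<^sup>2 * (norm (g x))\<^sup>2) \<partial>lborel)"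
    unfolding norm_outer nn_integral_completion by (simp add: mult.commute)
  also have "\<dots> \<le> ennreal (4 * a)" unfolding a_def by (rule ladyzhenskaya_C1c[OF f g])
  finally have le: "ennreal ((norm (abs_Lsq (\<lambda>x. outer (g x) (f x))))\<^sup>2) \<le> ennreal (4 * a)" .
  have a0: "0 \<le> 4 * a" unfolding a_def by simp
  have d: "norm (abs_Lsq (\<lambda>x. frechet_derivative h (at x) (axis j 1))) \<le> norm (abs_Lsq (jac h))" if "C1c h" for h and j :: 2
    using norm_directional_le[OF that, of "axis j 1"] by simp
  have "a \<le> norm (abs_Lsq f) * norm (abs_Lsq (jac f)) * (norm (abs_Lsq g) * norm (abs_Lsq (jac g)))"
    unfolding a_def by (intro mult_mono mult_left_mono d f g mult_nonneg_nonneg norm_ge_zero)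
  moreover have "(norm (abs_Lsq (\<lambda>x. outer (g x) (f x))))\<^sup>2 \<le> 4 * a" using le a0 by (simp add: ennreal_le_iff)
  ultimately show "(norm (abs_Lsq (\<lambda>x. outer (g x) (f x))))\<^sup>2 \<le>
      4 * norm (abs_Lsq f) * norm (abs_Lsq (jac f)) * (norm (abs_Lsq g) * norm (abs_Lsq (jac g)))"
    by (simp add: mult.assoc)
qed

text \<open>The product of two elements of \<open>L\<^sup>2\<close> is square-integrable when both have a gradient. The bound is inherited
from test functions by Fatou's lemma along a subsequence on which both approximating sequences converge almost everywhere.\<close>

lemma outer_class_bound:
  assumes p: "(U, A) \<in> V_graph D" and q: "(W, B) \<in> V_graph D"
  shows "sq_integrable (\<lambda>x. outer (repr W x) (repr U x))" "(norm (outer_class U W))\<^sup>2 \<le> 4 * norm U * norm A * (norm W * norm B)"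
proof -
  have seq: "\<exists>f. (\<forall>n. C1c (f n)) \<and> (\<lambda>n. abs_Lsq (f n)) \<longlonglongrightarrow> U' \<and> (\<lambda>n. abs_Lsq (jac (f n))) \<longlonglongrightarrow> A'"
    if mem: "(U', A') \<in> V_graph D" for U' A'
  proof -
    obtain r :: "nat \<Rightarrow> (real^2, real^2) Lsq \<times> (real^2, real^2^2) Lsq"
      where r: "\<And>n. r n \<in> test_graph (solenoidal_tests D)" "r \<longlonglongrightarrow> (U', A')"
      using mem unfolding V_graph_def closure_sequential by blast
    have "\<forall>n. \<exists>f. f \<in> solenoidal_tests D \<and> r n = (abs_Lsq f, abs_Lsq (jac f))"
      using r(1) unfolding test_graph_def by blast
    then obtain f where f: "\<And>n. f n \<in> solenoidal_tests D" "\<And>n. r n = (abs_Lsq (f n), abs_Lsq (jac (f n)))" by metis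
    have "C1c (f n)" for n by (rule test_C1c[OF solenoidal_test[OF f(1)]])
    moreover have "(\<lambda>n. abs_Lsq (f n)) \<longlonglongrightarrow> U'" using tendsto_fst[OF r(2)] by (simp add: f(2))
    moreover have "(\<lambda>n. abs_Lsq (jac (f n))) \<longlonglongrightarrow> A'" using tendsto_snd[OF r(2)] by (simp add: f(2))
    ultimately show ?thesis by blast
  qed
  obtain f where f: "\<And>n. C1c (f n)" "(\<lambda>n. abs_Lsq (f n)) \<longlonglongrightarrow> U" "(\<lambda>n. abs_Lsq (jac (f n))) \<longlonglongrightarrow> A"
    using seq[OF p] by blast
  obtain g where g: "\<And>n. C1c (g n)" "(\<lambda>n. abs_Lsq (g n)) \<longlonglongrightarrow> W" "(\<lambda>n. abs_Lsq (jac (g n))) \<longlonglongrightarrow> B"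
    using seq[OF q] by blast
  obtain r where r: "strict_mono (r :: nat \<Rightarrow> nat)" "AE x in lebesgue. (\<lambda>n. repr (abs_Lsq (f (r n))) x) \<longlonglongrightarrow> repr U x"
    using Lsq_AE_subseq[OF f(2)] by blast
  have g': "(\<lambda>n. abs_Lsq (g (r n))) \<longlonglongrightarrow> W" using LIMSEQ_subseq_LIMSEQ[OF g(2) r(1)] by (simp add: o_def)
  obtain s where s: "strict_mono (s :: nat \<Rightarrow> nat)" "AE x in lebesgue. (\<lambda>n. repr (abs_Lsq (g (r (s n)))) x) \<longlonglongrightarrow> repr W x"
    using Lsq_AE_subseq[OF g'] by blast
  define k where "k n = r (s n)" for n
  have k: "strict_mono k" unfolding k_def using r(1) s(1) by (simp add: strict_mono_def)
  have eqf: "AE x in lebesgue. \<forall>n. repr (abs_Lsq (f n)) x = f n x"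
    by (intro AE_all_countable[THEN iffD2] allI repr_abs sq_integrable_C1c f)
  have eqg: "AE x in lebesgue. \<forall>n. repr (abs_Lsq (g n)) x = g n x"
    by (intro AE_all_countable[THEN iffD2] allI repr_abs sq_integrable_C1c g)
  have lim: "AE x in lebesgue. (\<lambda>n. outer (g (k n) x) (f (k n) x)) \<longlonglongrightarrow> outer (repr W x) (repr U x)"
    using r(2) s(2) eqf eqg
  proof eventually_elim
    case (elim x)
    have "(\<lambda>n. f (k n) x) \<longlonglongrightarrow> repr U x"
      using LIMSEQ_subseq_LIMSEQ[OF elim(1) s(1)] elim(3) by (simp add: o_def k_def)
    moreover have "(\<lambda>n. g (k n) x) \<longlonglongrightarrow> repr W x" using elim(2,4) by (simp add: k_def)
    ultimately show ?case unfolding outer_def by (intro tendsto_vec_lambda tendsto_intros)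
  qed
  have m: "(\<lambda>x. outer (repr W x) (repr U x)) \<in> borel_measurable lebesgue"
    by (intro measurable_outer sq_integrable_measurable sq_integrable_repr)
  define K where "K n = 4 * norm (abs_Lsq (f (k n))) * norm (abs_Lsq (jac (f (k n)))) *
      (norm (abs_Lsq (g (k n))) * norm (abs_Lsq (jac (g (k n)))))" for n
  have sub: "(\<lambda>n. X (k n)) \<longlonglongrightarrow> l" if "X \<longlonglongrightarrow> l" for X :: "nat \<Rightarrow> 'z::topological_space" and l
    using LIMSEQ_subseq_LIMSEQ[OF that k] by (simp add: o_def)
  have Kl: "K \<longlonglongrightarrow> 4 * norm U * norm A * (norm W * norm B)"
    unfolding K_def
    by (intro tendsto_mult tendsto_norm tendsto_const sub[OF f(2)] sub[OF f(3)] sub[OF g(2)] sub[OF g(3)])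
  have "sq_integrable (\<lambda>x. outer (repr W x) (repr U x)) \<and> (norm (abs_Lsq (\<lambda>x. outer (repr W x) (repr U x))))\<^sup>2 \<le> 4 * norm U * norm A * (norm W * norm B)"
  proof (rule sq_integrable_fatou[OF _ m lim _ Kl])
    show "sq_integrable (\<lambda>x. outer (g (k n) x) (f (k n) x))" for n by (rule outer_C1c(1)[OF f(1) g(1)])
    show "(norm (abs_Lsq (\<lambda>x. outer (g (k n) x) (f (k n) x))))\<^sup>2 \<le> K n" for n
      unfolding K_def by (rule outer_C1c(2)[OF f(1) g(1)])
  qed
  then show "sq_integrable (\<lambda>x. outer (repr W x) (repr U x))" "(norm (outer_class U W))\<^sup>2 \<le> 4 * norm U * norm A * (norm W * norm B)"
    unfolding outer_class_def by auto
qed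

lemma outer_class_diff:
  assumes "(U, A) \<in> V_graph D" "(U', A') \<in> V_graph D" "(W, B) \<in> V_graph D"
  shows "outer_class (U - U') W = outer_class U W - outer_class U' W"
proof -
  have d: "(U - U', A - A') \<in> V_graph D" using subspace_diff[OF subspace_V_graph assms(1,2)] by simp
  note s = outer_class_bound(1)[OF assms(1,3)] outer_class_bound(1)[OF assms(2,3)] outer_class_bound(1)[OF d assms(3)]
  have "outer_class U W - outer_class U' W = abs_Lsq (\<lambda>x. outer (repr W x) (repr U x) - outer (repr W x) (repr U' x))"
    unfolding outer_class_def by (rule abs_diff[OF s(1,2)])
  also have "\<dots> = outer_class (U - U') W" unfolding outer_class_def
  proof (subst abs_Lsq_eq_iff[OF sq_integrable_diff[OF s(1,2)] s(3)])
    show "AE x in lebesgue. outer (repr W x) (repr U x) - outer (repr W x) (repr U' x) = outer (repr W x) (repr (U - U') x)"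
      using repr_diff[of U U'] by eventually_elim (simp add: outer_diff)
  qed
  finally show ?thesis by simp
qed

text \<open>The pair \<open>(0, b)\<close> makes a representative of \<open>b\<close> a weak gradient of zero.\<close>

lemma V_graph_single_0:
  assumes D: "open D" "bounded D" and b: "(0, b) \<in> V_graph D"
  shows "b = 0"
proof -
  have DL: "D \<in> sets lebesgue" using D(1) by (simp add: lborelD)
  have z: "(\<lambda>_. 0 :: 'b::euclidean_space) \<in> L2 D" by (rule L2_of_sq_integrable[OF DL sq_integrable_zero])
  have c: "L2_class D (\<lambda>_. 0 :: 'b::euclidean_space) = 0" by (simp add: L2_class_def abs_0)
  have u: "(\<lambda>_. 0 :: real^2) \<in> L2 D" by (rule L2_of_sq_integrable[OF DL sq_integrable_zero])
  have G: "(\<lambda>_. 0 :: real^2^2) \<in> L2 D" by (rule L2_of_sq_integrable[OF DL sq_integrable_zero])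
  have cu: "L2_class D (\<lambda>_. 0 :: real^2) = 0" and cG: "L2_class D (\<lambda>_. 0 :: real^2^2) = 0" by (simp_all add: L2_class_def abs_0)
  have "has_weak_gradient D (\<lambda>_. 0) (\<lambda>_. 0)"
    by (simp add: has_weak_gradient_iff[OF DL u] G cu cG)
  moreover have "solenoidal_tests D \<subseteq> test_functions D" using solenoidal_test by blast
  from closure_test_graph_gradient[OF D(1) this u] b
  have "has_weak_gradient D (\<lambda>_. 0) (repr b)" "L2_class D (repr b) = b" unfolding cu V_graph_def by auto
  ultimately show ?thesis using has_weak_gradient_unique[OF D u] cG by metis
qed

section \<open>Rellich's theorem\<close>

lemma measure_cball_pos: "0 < r \<Longrightarrow> 0 < measure lebesgue (cball (0 :: real^2) r)"
  using content_cball_pos[of r "0 :: real^2"] by simp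

lemma sq_integrable_indicator_cball: "sq_integrable (\<lambda>x::real^2. indicator (cball 0 r) x :: real)"
proof -
  have "(\<lambda>x::real^2. (norm (indicator (cball 0 r) x :: real))\<^sup>2) = (\<lambda>x. 1 * indicator (cball 0 r) x)"
    by (auto simp: indicator_def fun_eq_iff)
  then show ?thesis unfolding sq_integrable_def
    using integrable_indicator_cball[where 'a = "real^2" and c = 1 and R = r] by simp
qed

text \<open>The Cauchy-Schwarz inequality with the indicator of the disc.\<close>

lemma norm_integral_square_le:
  fixes g :: "real^2 \<Rightarrow> 'b::euclidean_space"
  assumes g: "sq_integrable g" and out: "\<And>x. x \<notin> cball 0 r \<Longrightarrow> g x = 0"
  shows "integrable lebesgue g"
    "(norm (\<integral>x. g x \<partial>lebesgue))\<^sup>2 \<le> measure lebesgue (cball (0 :: real^2) r) * (\<integral>x. (norm (g x))\<^sup>2 \<partial>lebesgue)"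
proof -
  define n where "n x = norm (g x)" for x
  have n2: "(\<lambda>x. (norm (n x))\<^sup>2) = (\<lambda>x. (norm (g x))\<^sup>2)" by (simp add: n_def)
  have nm: "n \<in> borel_measurable lebesgue" unfolding n_def
    by (rule measurable_compose[OF sq_integrable_measurable[OF g] borel_measurable_norm])
  have sn: "sq_integrable n" using g nm unfolding sq_integrable_def n2 by simp
  note one = sq_integrable_indicator_cball[of r]
  have eq: "(\<lambda>x. indicator (cball 0 r) x \<bullet> n x) = n"
    using out by (auto simp: fun_eq_iff n_def indicator_def)
  have ni: "integrable lebesgue n" using sq_integrable_inner_integrable[OF one sn] unfolding eq .
  show gi: "integrable lebesgue g"
    by (rule Bochner_Integration.integrable_bound[OF ni sq_integrable_measurable[OF g]]) (simp add: n_def)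
  have "norm (\<integral>x. g x \<partial>lebesgue) \<le> (\<integral>x. n x \<partial>lebesgue)" unfolding n_def by (rule integral_norm_bound)
  also have "\<dots> = abs_Lsq (\<lambda>x. indicator (cball 0 r) x :: real) \<bullet> abs_Lsq n"
    unfolding inner_abs[OF one sn] eq ..
  also have "\<dots> \<le> norm (abs_Lsq (\<lambda>x::real^2. indicator (cball 0 r) x :: real)) * norm (abs_Lsq n)"
    by (rule norm_cauchy_schwarz)
  finally have "(norm (\<integral>x. g x \<partial>lebesgue))\<^sup>2 \<le> (norm (abs_Lsq (\<lambda>x::real^2. indicator (cball 0 r) x :: real)) * norm (abs_Lsq n))\<^sup>2"
    by (intro power_mono) auto
  also have "\<dots> = (\<integral>x. (norm (indicator (cball (0::real^2) r) x :: real))\<^sup>2 \<partial>lebesgue) * (\<integral>x. (norm (g x))\<^sup>2 \<partial>lebesgue)"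
    unfolding power_mult_distrib norm_abs[OF one] norm_abs[OF sn] n2 ..
  also have "(\<integral>x. (norm (indicator (cball (0::real^2) r) x :: real))\<^sup>2 \<partial>lebesgue) = measure lebesgue (cball (0 :: real^2) r)"
  proof -
    have "(\<lambda>x::real^2. (norm (indicator (cball 0 r) x :: real))\<^sup>2) = indicator (cball 0 r)"
      by (auto simp: indicator_def fun_eq_iff)
    then show ?thesis by simp
  qed
  finally show "(norm (\<integral>x. g x \<partial>lebesgue))\<^sup>2 \<le> measure lebesgue (cball (0 :: real^2) r) * (\<integral>x. (norm (g x))\<^sup>2 \<partial>lebesgue)" .
qed

definition ball_avg :: "real \<Rightarrow> (real^2 \<Rightarrow> real^2) \<Rightarrow> real^2 \<Rightarrow> real^2" where
  "ball_avg r f x = (\<integral>h. indicator (cball 0 r) h *\<^sub>R f (x + h) \<partial>lebesgue) /\<^sub>R measure lebesgue (cball (0 :: real^2) r)"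

lemma sq_integrable_ball_cont:
  fixes f :: "real^2 \<Rightarrow> 'b::euclidean_space"
  assumes "continuous_on UNIV f"
  shows "sq_integrable (\<lambda>h. indicator (cball 0 r) h *\<^sub>R f h)"
proof -
  have fm: "f \<in> borel_measurable borel" by (rule borel_measurable_continuous_onI[OF assms])
  have m: "(\<lambda>h. indicator (cball 0 r) h *\<^sub>R f h) \<in> borel_measurable borel"
    using fm by (intro borel_measurable_scaleR borel_measurable_indicator) auto
  have "integrable lborel (\<lambda>x. indicator (cball 0 r) x *\<^sub>R (norm (f x))\<^sup>2)"
    by (rule borel_integrable_compact) (auto intro!: continuous_intros continuous_on_subset[OF assms])
  moreover have "(\<lambda>x. (norm (indicator (cball 0 r) x *\<^sub>R f x))\<^sup>2) = (\<lambda>x. indicator (cball 0 r) x *\<^sub>R (norm (f x))\<^sup>2)"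
    by (auto simp: indicator_def fun_eq_iff)
  ultimately have "integrable lborel (\<lambda>x. (norm (indicator (cball 0 r) x *\<^sub>R f x))\<^sup>2)" by simp
  then show ?thesis unfolding sq_integrable_def using m norm_square_measurable[OF m]
    by (simp add: integrable_completion measurable_completion)
qed

lemma C1c_shift_continuous: "C1c f \<Longrightarrow> continuous_on UNIV (\<lambda>h. f (x + h))"
  by (rule continuous_on_compose2[OF C1c_continuous]) (auto intro!: continuous_intros)

lemma ball_avg_diff_bound:
  assumes r: "0 < r" and fg: "continuous_on UNIV (\<lambda>h. f (x + h))" "continuous_on UNIV (\<lambda>h. g (y + h))"
  shows "(norm (ball_avg r f x - ball_avg r g y))\<^sup>2 \<le>
    (\<integral>h. indicator (cball 0 r) h *\<^sub>R (norm (f (x + h) - g (y + h)))\<^sup>2 \<partial>lebesgue) / measure lebesgue (cball (0 :: real^2) r)"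
proof -
  define m where "m = measure lebesgue (cball (0 :: real^2) r)"
  have m: "0 < m" unfolding m_def by (rule measure_cball_pos[OF r])
  define d where "d h = indicator (cball 0 r) h *\<^sub>R (f (x + h) - g (y + h))" for h
  have sd: "sq_integrable d" unfolding d_def by (intro sq_integrable_ball_cont continuous_on_diff fg)
  have int: "integrable lebesgue (\<lambda>h. indicator (cball 0 r) h *\<^sub>R f (x + h))" "integrable lebesgue (\<lambda>h. indicator (cball 0 r) h *\<^sub>R g (y + h))"
    by (rule norm_integral_square_le(1)[of _ r], intro sq_integrable_ball_cont fg, simp)+
  have "ball_avg r f x - ball_avg r g y = (\<integral>h. d h \<partial>lebesgue) /\<^sub>R m"
    unfolding ball_avg_def m_def[symmetric] d_def scaleR_diff_right
    by (subst Bochner_Integration.integral_diff[OF int]) (simp add: scaleR_diff_right)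
  then have "(norm (ball_avg r f x - ball_avg r g y))\<^sup>2 = (norm (\<integral>h. d h \<partial>lebesgue))\<^sup>2 / m\<^sup>2"
    using m by (simp add: power_divide divide_inverse power_mult_distrib power_inverse)
  also have "\<dots> \<le> (m * (\<integral>h. (norm (d h))\<^sup>2 \<partial>lebesgue)) / m\<^sup>2"
    unfolding m_def by (intro divide_right_mono norm_integral_square_le(2)[OF sd]) (auto simp: d_def)
  also have "\<dots> = (\<integral>h. (norm (d h))\<^sup>2 \<partial>lebesgue) / m" using m by (simp add: power2_eq_square)
  also have "(\<lambda>h. (norm (d h))\<^sup>2) = (\<lambda>h. indicator (cball 0 r) h *\<^sub>R (norm (f (x + h) - g (y + h)))\<^sup>2)"
    by (auto simp: d_def indicator_def fun_eq_iff)
  finally show ?thesis unfolding m_def .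
qed

lemma ball_avg_const: "0 < r \<Longrightarrow> ball_avg r (\<lambda>_. c) x = c"
  using measure_cball_pos[of r] integrable_indicator_cball[where 'a = "real^2" and c = 1 and R = r] unfolding ball_avg_def
  by (subst integral_scaleR_left) auto

text \<open>The averages of a family that is bounded in \<open>H\<^sup>1\<close> are equi-Lipschitz, with a constant that depends on \<open>r\<close>. This is the
equicontinuity required by the Arzela-Ascoli theorem.\<close>

lemma ball_avg_lipschitz:
  assumes r: "0 < r" and f: "C1c f"
  shows "norm (ball_avg r f x - ball_avg r f y) \<le> norm (x - y) * norm (abs_Lsq (jac f)) / sqrt (measure lebesgue (cball (0 :: real^2) r))"
proof -
  define m where "m = measure lebesgue (cball (0 :: real^2) r)"
  have m: "0 < m" unfolding m_def by (rule measure_cball_pos[OF r])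
  obtain R where R: "\<And>x. R \<le> norm x \<Longrightarrow> f x = 0" using f unfolding C1c_def by blast
  define k where "k = x - y"
  have sf: "sq_integrable (\<lambda>h. f (h + z))" for z by (rule norm_translation(1)[OF C1c_continuous[OF f] R])
  have s: "sq_integrable (\<lambda>h. f (h + k) - f h)" using sq_integrable_diff[OF sf[of k] sf[of 0]] by simp
  have le1: "(\<integral>h. indicator (cball 0 r) h *\<^sub>R (norm (f (x + h) - f (y + h)))\<^sup>2 \<partial>lebesgue) \<le> (\<integral>h. (norm (f (x + h) - f (y + h)))\<^sup>2 \<partial>lebesgue)"
  proof (rule integral_mono)
    have "sq_integrable (\<lambda>h. f (x + h) - f (y + h))" using sq_integrable_diff[OF sf[of x] sf[of y]] by (simp add: add.commute)
    then show i: "integrable lebesgue (\<lambda>h. (norm (f (x + h) - f (y + h)))\<^sup>2)" by (rule sq_integrable_integrable)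
    show "integrable lebesgue (\<lambda>h. indicator (cball 0 r) h *\<^sub>R (norm (f (x + h) - f (y + h)))\<^sup>2)"
      by (rule integrable_mult_indicator[OF _ i]) simp
  qed (auto simp: indicator_def)
  also have "(\<integral>h. (norm (f (x + h) - f (y + h)))\<^sup>2 \<partial>lebesgue) = (\<integral>h. (norm (f ((h + y) + k) - f (h + y)))\<^sup>2 \<partial>lebesgue)"
    by (simp add: k_def algebra_simps)
  also have "\<dots> = (\<integral>h. (norm (f (h + k) - f h))\<^sup>2 \<partial>lebesgue)"
    by (rule integral_translation[where g = "\<lambda>h. (norm (f (h + k) - f h))\<^sup>2"])
       (intro norm_square_measurable borel_measurable_continuous_onI continuous_on_diff C1c_continuous[OF f]
         continuous_on_compose2[OF C1c_continuous[OF f]] continuous_intros, auto)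
  also have "\<dots> = (norm (abs_Lsq (\<lambda>h. f (h + k) - f h)))\<^sup>2" by (rule norm_abs[OF s, symmetric])
  also have "\<dots> \<le> (norm k * norm (abs_Lsq (jac f)))\<^sup>2"
    by (intro power_mono order_trans[OF C1c_translation_estimate[OF f] norm_directional_le[OF f]]) auto
  finally have "(\<integral>h. indicator (cball 0 r) h *\<^sub>R (norm (f (x + h) - f (y + h)))\<^sup>2 \<partial>lebesgue) / m \<le> (norm k * norm (abs_Lsq (jac f)))\<^sup>2 / m"
    using m by (intro divide_right_mono) auto
  with ball_avg_diff_bound[OF r C1c_shift_continuous[OF f, of x] C1c_shift_continuous[OF f, of y]]
  have "(norm (ball_avg r f x - ball_avg r f y))\<^sup>2 \<le> (norm k * norm (abs_Lsq (jac f)))\<^sup>2 / m" unfolding m_def by linarith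
  also have "\<dots> = (norm k * norm (abs_Lsq (jac f)) / sqrt m)\<^sup>2" using m by (simp add: power_divide)
  finally show ?thesis unfolding m_def k_def by (rule power2_le_imp_le) simp
qed

lemma ball_avg_bound:
  assumes r: "0 < r" and f: "C1c f"
  shows "norm (ball_avg r f x) \<le> norm (abs_Lsq f) / sqrt (measure lebesgue (cball (0 :: real^2) r))"
proof -
  define m where "m = measure lebesgue (cball (0 :: real^2) r)"
  have m: "0 < m" unfolding m_def by (rule measure_cball_pos[OF r])
  obtain R where R: "\<And>x. R \<le> norm x \<Longrightarrow> f x = 0" using f unfolding C1c_def by blast
  have sf: "sq_integrable (\<lambda>h. f (h + x))" by (rule norm_translation(1)[OF C1c_continuous[OF f] R])
  have i: "integrable lebesgue (\<lambda>h. (norm (f (x + h)))\<^sup>2)" using sq_integrable_integrable[OF sf] by (simp add: add.commute)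
  have "(\<integral>h. indicator (cball 0 r) h *\<^sub>R (norm (f (x + h) - 0))\<^sup>2 \<partial>lebesgue) \<le> (\<integral>h. (norm (f (x + h)))\<^sup>2 \<partial>lebesgue)"
  proof (rule integral_mono)
    show "integrable lebesgue (\<lambda>h. (norm (f (x + h)))\<^sup>2)" by (rule i)
    show "integrable lebesgue (\<lambda>h. indicator (cball 0 r) h *\<^sub>R (norm (f (x + h) - 0))\<^sup>2)"
      using integrable_mult_indicator[OF _ i, of "cball 0 r"] by simp
  qed (auto simp: indicator_def)
  also have "\<dots> = (norm (abs_Lsq (\<lambda>h. f (h + x))))\<^sup>2" unfolding norm_abs[OF sf] by (simp add: add.commute)
  also have "\<dots> = (norm (abs_Lsq f))\<^sup>2" by (simp add: norm_translation(2)[OF C1c_continuous[OF f] R])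
  finally have "(\<integral>h. indicator (cball 0 r) h *\<^sub>R (norm (f (x + h) - 0))\<^sup>2 \<partial>lebesgue) / m \<le> (norm (abs_Lsq f))\<^sup>2 / m"
    using m by (intro divide_right_mono) auto
  with ball_avg_diff_bound[OF r C1c_shift_continuous[OF f, of x] continuous_on_const[where c = 0], of x]
  have "(norm (ball_avg r f x - ball_avg r (\<lambda>_. 0) x))\<^sup>2 \<le> (norm (abs_Lsq f))\<^sup>2 / m" unfolding m_def by linarith
  also have "\<dots> = (norm (abs_Lsq f) / sqrt m)\<^sup>2" using m by (simp add: power_divide)
  finally show ?thesis unfolding m_def ball_avg_const[OF r] by (intro power2_le_imp_le[of "norm (ball_avg r f x)"]) auto
qed

lemma ball_avg_outside:
  assumes f: "\<And>x. R \<le> norm x \<Longrightarrow> f x = 0" and x: "R + r \<le> norm x"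
  shows "ball_avg r f x = 0"
proof -
  have "(\<lambda>h. indicator (cball 0 r) h *\<^sub>R f (x + h)) = (\<lambda>_. 0)"
  proof
    fix h
    show "indicator (cball 0 r) h *\<^sub>R f (x + h) = 0"
    proof (cases "h \<in> cball 0 r")
      case True
      then have "R \<le> norm (x + h)" using x norm_triangle_ineq2[of x "- h"] by simp
      then show ?thesis using f by simp
    qed simp
  qed
  then show ?thesis unfolding ball_avg_def by simp
qed

lemma sq_integrable_ball_avg:
  assumes r: "0 < r" and f: "C1c f"
  shows "sq_integrable (ball_avg r f)"
proof -
  obtain R where R: "\<And>x. R \<le> norm x \<Longrightarrow> f x = 0" using f unfolding C1c_def by blast
  define L where "L = norm (abs_Lsq (jac f)) / sqrt (measure lebesgue (cball (0 :: real^2) r))"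
  have "L-lipschitz_on UNIV (ball_avg r f)"
  proof (rule lipschitz_onI)
    show "0 \<le> L" unfolding L_def by simp
    show "dist (ball_avg r f x) (ball_avg r f y) \<le> L * dist x y" for x y
      using ball_avg_lipschitz[OF r f, of x y] unfolding L_def dist_norm by (simp add: mult.commute)
  qed
  then have "continuous_on UNIV (ball_avg r f)" by (rule lipschitz_on_continuous_on)
  then show ?thesis by (rule sq_integrable_continuous) (rule ball_avg_outside[OF R])
qed

text \<open>The square of a mean is at most the mean of the squares. After an interchange of the integrals,
what remains is the mean over \<open>h\<close> of the squared norms of \<open>f(\<cdot> + h) - f\<close>, each bounded by the translation
estimate.\<close>

lemma ball_avg_close:
  assumes r: "0 < r" and f: "C1c f"
  shows "norm (abs_Lsq (ball_avg r f) - abs_Lsq f) \<le> r * norm (abs_Lsq (jac f))"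
proof -
  define m where "m = measure lebesgue (cball (0 :: real^2) r)"
  have m: "0 < m" unfolding m_def by (rule measure_cball_pos[OF r])
  define c where "c = (r * norm (abs_Lsq (jac f)))\<^sup>2"
  have c: "0 \<le> c" unfolding c_def by simp
  have s: "sq_integrable (\<lambda>x. ball_avg r f x - f x)" by (rule sq_integrable_diff[OF sq_integrable_ball_avg[OF r f] sq_integrable_C1c[OF f]])
  obtain R where R: "\<And>x. R \<le> norm x \<Longrightarrow> f x = 0" using f unfolding C1c_def by blast
  have st: "sq_integrable (\<lambda>x. f (x + h) - f x)" for h
    by (rule sq_integrable_diff[OF norm_translation(1)[OF C1c_continuous[OF f] R] sq_integrable_C1c[OF f]])
  define K where "K x h = ennreal (indicator (cball 0 r) h *\<^sub>R (norm (f (x + h) - f x))\<^sup>2)" for x h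
  have fm: "f \<in> borel_measurable borel" by (rule borel_measurable_continuous_onI[OF C1c_continuous[OF f]])
  have Km: "(\<lambda>(x, h). K x h) \<in> borel_measurable (lborel \<Otimes>\<^sub>M lborel)"
  proof -
    have m1: "fst \<in> borel_measurable ((lborel :: (real^2) measure) \<Otimes>\<^sub>M (lborel :: (real^2) measure))"
      using measurable_fst[of "lborel :: (real^2) measure" "lborel :: (real^2) measure"] by simp
    have m2: "snd \<in> borel_measurable ((lborel :: (real^2) measure) \<Otimes>\<^sub>M (lborel :: (real^2) measure))"
      using measurable_snd[of "lborel :: (real^2) measure" "lborel :: (real^2) measure"] by simp
    have "(\<lambda>p. indicator (cball 0 r) (snd p) *\<^sub>R (norm (f (fst p + snd p) - f (fst p)))\<^sup>2)
        \<in> borel_measurable ((lborel :: (real^2) measure) \<Otimes>\<^sub>M (lborel :: (real^2) measure))"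
      by (intro borel_measurable_scaleR norm_square_measurable borel_measurable_diff
          measurable_compose[OF m2 borel_measurable_indicator] measurable_compose[OF m1 fm]
          measurable_compose[OF borel_measurable_add[OF m1 m2] fm]) simp
    then show ?thesis unfolding K_def by (simp add: case_prod_unfold)
  qed
  have ptw: "ennreal ((norm (ball_avg r f x - f x))\<^sup>2) \<le> ennreal (1 / m) * (\<integral>\<^sup>+h. K x h \<partial>lborel)" for x
  proof -
    have si: "sq_integrable (\<lambda>h. indicator (cball 0 r) h *\<^sub>R (f (x + h) - f x))"
      by (intro sq_integrable_ball_cont continuous_on_diff C1c_shift_continuous f continuous_on_const)
    have e: "(\<lambda>h. (norm (indicator (cball 0 r) h *\<^sub>R (f (x + h) - f x)))\<^sup>2) = (\<lambda>h. indicator (cball 0 r) h *\<^sub>R (norm (f (x + h) - f x))\<^sup>2)"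
      by (auto simp: indicator_def fun_eq_iff)
    have int: "integrable lebesgue (\<lambda>h. indicator (cball 0 r) h *\<^sub>R (norm (f (x + h) - f x))\<^sup>2)"
      using sq_integrable_integrable[OF si] unfolding e .
    have "(norm (ball_avg r f x - ball_avg r (\<lambda>_. f x) x))\<^sup>2 \<le> (\<integral>h. indicator (cball 0 r) h *\<^sub>R (norm (f (x + h) - f x))\<^sup>2 \<partial>lebesgue) / m"
      unfolding m_def by (rule ball_avg_diff_bound[OF r C1c_shift_continuous[OF f] continuous_on_const])
    then have "ennreal ((norm (ball_avg r f x - f x))\<^sup>2) \<le> ennreal ((1 / m) * (\<integral>h. indicator (cball 0 r) h *\<^sub>R (norm (f (x + h) - f x))\<^sup>2 \<partial>lebesgue))"
      unfolding ball_avg_const[OF r] by (intro ennreal_leI) simp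
    also have "\<dots> = ennreal (1 / m) * ennreal (\<integral>h. indicator (cball 0 r) h *\<^sub>R (norm (f (x + h) - f x))\<^sup>2 \<partial>lebesgue)"
      using m by (intro ennreal_mult integral_nonneg_AE AE_I2) auto
    also have "ennreal (\<integral>h. indicator (cball 0 r) h *\<^sub>R (norm (f (x + h) - f x))\<^sup>2 \<partial>lebesgue) = (\<integral>\<^sup>+h. K x h \<partial>lebesgue)"
      unfolding K_def by (rule nn_integral_eq_integral[OF int, symmetric]) simp
    finally show ?thesis by (simp add: nn_integral_completion)
  qed
  have inner: "(\<integral>\<^sup>+x. K x h \<partial>lborel) \<le> ennreal c * indicator (cball 0 r) h" for h
  proof (cases "h \<in> cball 0 r")
    case True
    have "(\<integral>\<^sup>+x. K x h \<partial>lborel) = (\<integral>\<^sup>+x. ennreal ((norm (f (x + h) - f x))\<^sup>2) \<partial>lebesgue)"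
      unfolding K_def using True by (simp add: nn_integral_completion)
    also have "\<dots> = ennreal ((norm (abs_Lsq (\<lambda>x. f (x + h) - f x)))\<^sup>2)"
      unfolding norm_abs[OF st] by (rule nn_integral_eq_integral[OF sq_integrable_integrable[OF st]]) simp
    also have "\<dots> \<le> ennreal c"
    proof (rule ennreal_leI)
      have "norm (abs_Lsq (\<lambda>x. f (x + h) - f x)) \<le> norm h * norm (abs_Lsq (jac f))"
        by (rule order_trans[OF C1c_translation_estimate[OF f] norm_directional_le[OF f]])
      also have "\<dots> \<le> r * norm (abs_Lsq (jac f))" using True by (intro mult_right_mono) auto
      finally show "(norm (abs_Lsq (\<lambda>x. f (x + h) - f x)))\<^sup>2 \<le> c" unfolding c_def by (intro power_mono) auto
    qed
    finally show ?thesis using True by simp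
  next
    case False
    then show ?thesis unfolding K_def by simp
  qed
  have "ennreal ((norm (abs_Lsq (\<lambda>x. ball_avg r f x - f x)))\<^sup>2) = (\<integral>\<^sup>+x. ennreal ((norm (ball_avg r f x - f x))\<^sup>2) \<partial>lebesgue)"
    unfolding norm_abs[OF s] by (rule nn_integral_eq_integral[symmetric, OF sq_integrable_integrable[OF s]]) simp
  also have "\<dots> \<le> (\<integral>\<^sup>+x. ennreal (1 / m) * (\<integral>\<^sup>+h. K x h \<partial>lborel) \<partial>lborel)"
    unfolding nn_integral_completion by (intro nn_integral_mono ptw)
  also have "\<dots> = ennreal (1 / m) * (\<integral>\<^sup>+x. \<integral>\<^sup>+h. K x h \<partial>lborel \<partial>lborel)"
    by (rule nn_integral_cmult) (use lborel.borel_measurable_nn_integral[OF Km] in simp)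
  also have "(\<integral>\<^sup>+x. \<integral>\<^sup>+h. K x h \<partial>lborel \<partial>lborel) = (\<integral>\<^sup>+h. \<integral>\<^sup>+x. K x h \<partial>lborel \<partial>lborel)"
    by (rule lborel_pair.Fubini'[OF Km, symmetric])
  also have "ennreal (1 / m) * \<dots> \<le> ennreal (1 / m) * (\<integral>\<^sup>+h. ennreal c * indicator (cball (0 :: real^2) r) h \<partial>lborel)"
    by (intro mult_left_mono nn_integral_mono inner) simp
  also have "(\<integral>\<^sup>+h. ennreal c * indicator (cball (0 :: real^2) r) h \<partial>lborel) = ennreal c * ennreal m"
  proof -
    have "emeasure lborel (cball (0 :: real^2) r) = ennreal m"
      unfolding m_def using emeasure_bounded_finite[OF bounded_cball, of "0 :: real^2" r]
      by (simp add: emeasure_eq_ennreal_measure)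
    then show ?thesis by (simp add: nn_integral_cmult_indicator)
  qed
  also have "ennreal (1 / m) * (ennreal c * ennreal m) = ennreal c"
    using m c by (simp add: ennreal_mult[symmetric])
  finally have "(norm (abs_Lsq (\<lambda>x. ball_avg r f x - f x)))\<^sup>2 \<le> c" using c by (simp add: ennreal_le_iff)
  then have "norm (abs_Lsq (\<lambda>x. ball_avg r f x - f x)) \<le> r * norm (abs_Lsq (jac f))"
    unfolding c_def by (rule power2_le_imp_le) (use r in simp)
  then show ?thesis by (simp add: abs_diff[OF sq_integrable_ball_avg[OF r f] sq_integrable_C1c[OF f]])
qed

lemma norm_sup_bound:
  fixes g :: "real^2 \<Rightarrow> real^2"
  assumes g: "sq_integrable g" and out: "\<And>x. x \<notin> cball 0 R \<Longrightarrow> g x = 0" and b: "\<And>x. x \<in> cball 0 R \<Longrightarrow> norm (g x) \<le> \<eta>" and "0 \<le> \<eta>"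
  shows "norm (abs_Lsq g) \<le> \<eta> * sqrt (measure lebesgue (cball (0 :: real^2) R))"
proof -
  have "(norm (abs_Lsq g))\<^sup>2 \<le> (\<integral>x. \<eta>\<^sup>2 * indicator (cball (0 :: real^2) R) x \<partial>lebesgue)"
    unfolding norm_abs[OF g]
  proof (rule integral_mono[OF sq_integrable_integrable[OF g] integrable_indicator_cball])
    fix x
    show "(norm (g x))\<^sup>2 \<le> \<eta>\<^sup>2 * indicator (cball 0 R) x"
      using power_mono[OF b[of x] norm_ge_zero, of 2] out[of x] by (cases "x \<in> cball 0 R") auto
  qed
  also have "\<dots> = (\<eta> * sqrt (measure lebesgue (cball (0 :: real^2) R)))\<^sup>2"
    by (simp add: power_mult_distrib)
  finally show ?thesis by (rule power2_le_imp_le) (use assms(4) in simp)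
qed

text \<open>Averages over a small radius are uniformly close to \<open>f n\<close> in \<open>L\<^sup>2\<close>, and for this fixed radius they have a
uniformly convergent subsequence. Uniform convergence on one ball that contains all supports implies convergence in
\<open>L\<^sup>2\<close>.\<close>

lemma rellich_eps:
  fixes f :: "nat \<Rightarrow> real^2 \<Rightarrow> real^2"
  assumes f: "\<And>n. C1c (f n)" and R: "\<And>n x. R \<le> norm x \<Longrightarrow> f n x = 0"
    and M: "\<And>n. norm (abs_Lsq (f n)) \<le> M" "\<And>n. norm (abs_Lsq (jac (f n))) \<le> M" and e: "0 < e"
  shows "\<exists>k::nat \<Rightarrow> nat. strict_mono k \<and> (\<exists>N. \<forall>m\<ge>N. \<forall>n\<ge>N. norm (abs_Lsq (f (k m)) - abs_Lsq (f (k n))) < e)"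
proof -
  have M0: "0 \<le> M" using order_trans[OF norm_ge_zero M(1)] .
  \<comment> \<open>The radius is chosen such that averaging costs at most \<open>e / 4\<close> for each function.\<close>
  define r where "r = e / (4 * (M + 1))"
  have r: "0 < r" unfolding r_def using e M0 by simp
  have rM: "r * M < e / 4" unfolding r_def using e M0 by (simp add: field_simps)
  define S where "S = cball (0 :: real^2) (R + r)"
  define m where "m = measure lebesgue (cball (0 :: real^2) r)"
  have m: "0 < m" unfolding m_def by (rule measure_cball_pos[OF r])
  define L where "L = M / sqrt m"
  have L: "0 \<le> L" unfolding L_def using M0 m by simp
  have bd: "norm (ball_avg r (f n) x) \<le> L" for n x
    using ball_avg_bound[OF r f, of n x] divide_right_mono[OF M(1)[of n], of "sqrt m"] m unfolding L_def m_def by simp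
  have lip: "norm (ball_avg r (f n) x - ball_avg r (f n) y) \<le> norm (x - y) * L" for n x y
  proof -
    have "norm (ball_avg r (f n) x - ball_avg r (f n) y) \<le> norm (x - y) * norm (abs_Lsq (jac (f n))) / sqrt m"
      using ball_avg_lipschitz[OF r f, of n x y] unfolding m_def .
    also have "\<dots> \<le> norm (x - y) * M / sqrt m"
      using m M(2)[of n] by (intro divide_right_mono mult_left_mono) auto
    finally show ?thesis unfolding L_def by simp
  qed
  obtain g k where k: "strict_mono (k :: nat \<Rightarrow> nat)"
    and lim: "\<And>e. 0 < e \<Longrightarrow> \<exists>N. \<forall>n x. n \<ge> N \<and> x \<in> S \<longrightarrow> norm (ball_avg r (f (k n)) x - g x) < e"
  proof (rule Arzela_Ascoli[of S "\<lambda>n. ball_avg r (f n)" L])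
    show "compact S" unfolding S_def by simp
    show "norm (ball_avg r (f n) x) \<le> L" for n x by (rule bd)
    fix x and e :: real assume "x \<in> S" "0 < e"
    have "\<forall>n y. y \<in> S \<and> norm (x - y) < e / (L + 1) \<longrightarrow> norm (ball_avg r (f n) x - ball_avg r (f n) y) < e"
    proof (intro allI impI)
      fix n y assume y: "y \<in> S \<and> norm (x - y) < e / (L + 1)"
      have "norm (ball_avg r (f n) x - ball_avg r (f n) y) \<le> norm (x - y) * (L + 1)"
        by (rule order_trans[OF lip mult_left_mono]) auto
      also have "\<dots> < e" using y L by (simp add: pos_less_divide_eq)
      finally show "norm (ball_avg r (f n) x - ball_avg r (f n) y) < e" .
    qed
    moreover have "0 < e / (L + 1)" using \<open>0 < e\<close> L by simp
    ultimately show "\<exists>d. 0 < d \<and> (\<forall>n y. y \<in> S \<and> norm (x - y) < d \<longrightarrow> norm (ball_avg r (f n) x - ball_avg r (f n) y) < e)" by blast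
  qed (use that in blast)
  define v where "v = sqrt (measure lebesgue S)"
  have v: "0 \<le> v" unfolding v_def by simp
  define \<eta> where "\<eta> = e / (4 * (v + 1))"
  have \<eta>: "0 < \<eta>" "\<eta> * v < e / 4" unfolding \<eta>_def using e v by (simp_all add: field_simps)
  then have "0 < \<eta> / 2" by simp
  from lim[OF this] obtain N where N: "\<And>n x. n \<ge> N \<Longrightarrow> x \<in> S \<Longrightarrow> norm (ball_avg r (f (k n)) x - g x) < \<eta> / 2" by blast
  have "norm (abs_Lsq (f (k i)) - abs_Lsq (f (k j))) < e" if ij: "i \<ge> N" "j \<ge> N" for i j
  proof -
    define A where "A n = abs_Lsq (ball_avg r (f n))" for n
    have cl: "norm (A n - abs_Lsq (f n)) < e / 4" for n
    proof -
      have "norm (A n - abs_Lsq (f n)) \<le> r * norm (abs_Lsq (jac (f n)))" unfolding A_def by (rule ball_avg_close[OF r f])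
      also have "\<dots> \<le> r * M" by (rule mult_left_mono[OF M(2)]) (use r in simp)
      finally show ?thesis using rM by linarith
    qed
    have s: "sq_integrable (\<lambda>x. ball_avg r (f (k i)) x - ball_avg r (f (k j)) x)" by (intro sq_integrable_diff sq_integrable_ball_avg r f)
    have "norm (abs_Lsq (\<lambda>x. ball_avg r (f (k i)) x - ball_avg r (f (k j)) x)) \<le> \<eta> * v" unfolding v_def S_def
    proof (rule norm_sup_bound[OF s])
      fix x :: "real^2"
      show "ball_avg r (f (k i)) x - ball_avg r (f (k j)) x = 0" if "x \<notin> cball 0 (R + r)"
        using ball_avg_outside[of R "f (k i)" r x] ball_avg_outside[of R "f (k j)" r x] R that by simp
      show "norm (ball_avg r (f (k i)) x - ball_avg r (f (k j)) x) \<le> \<eta>" if "x \<in> cball 0 (R + r)"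
      proof -
        have xS: "x \<in> S" unfolding S_def by (rule that)
        have "norm (ball_avg r (f (k i)) x - ball_avg r (f (k j)) x) \<le> norm (ball_avg r (f (k i)) x - g x) + norm (ball_avg r (f (k j)) x - g x)"
          using norm_triangle_ineq4[of "ball_avg r (f (k i)) x - g x" "ball_avg r (f (k j)) x - g x"] by simp
        then show ?thesis using N[OF ij(1) xS] N[OF ij(2) xS] by linarith
      qed
    qed (use \<eta> in simp)
    then have "norm (A (k i) - A (k j)) < e / 4"
      using \<eta>(2) abs_diff[OF sq_integrable_ball_avg[OF r f] sq_integrable_ball_avg[OF r f], of "k i" "k j"] unfolding A_def by simp
    moreover have "norm (abs_Lsq (f (k i)) - abs_Lsq (f (k j))) \<le>
        norm (A (k i) - A (k j)) + norm (A (k j) - abs_Lsq (f (k j))) + norm (A (k i) - abs_Lsq (f (k i)))"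
    proof -
      have "abs_Lsq (f (k i)) - abs_Lsq (f (k j)) =
        ((A (k i) - A (k j)) + (A (k j) - abs_Lsq (f (k j)))) - (A (k i) - abs_Lsq (f (k i)))" by simp
      then show ?thesis
        by (simp only:) (rule order_trans[OF norm_triangle_ineq4 add_right_mono[OF norm_triangle_ineq]])
    qed
    ultimately show ?thesis using cl[of "k i"] cl[of "k j"] e by linarith
  qed
  then show ?thesis using k by blast
qed

text \<open>The precisions \<open>1/(j+1)\<close> are combined by a diagonal sequence.\<close>

lemma rellich_sequence:
  fixes f :: "nat \<Rightarrow> real^2 \<Rightarrow> real^2"
  assumes f: "\<And>n. C1c (f n)" and R: "\<And>n x. R \<le> norm x \<Longrightarrow> f n x = 0"
    and M: "\<And>n. norm (abs_Lsq (f n)) \<le> M" "\<And>n. norm (abs_Lsq (jac (f n))) \<le> M"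
  shows "\<exists>k::nat \<Rightarrow> nat. strict_mono k \<and> convergent (\<lambda>n. abs_Lsq (f (k n)))"
proof -
  define P where "P j \<sigma> \<longleftrightarrow> (\<exists>N. \<forall>m\<ge>N. \<forall>n\<ge>N. norm (abs_Lsq (f (\<sigma> m)) - abs_Lsq (f (\<sigma> n))) < 1 / (real j + 1))"
    for j and \<sigma> :: "nat \<Rightarrow> nat"
  interpret subseqs P
  proof
    fix j and \<sigma> :: "nat \<Rightarrow> nat" assume "strict_mono \<sigma>"
    show "\<exists>r'. strict_mono r' \<and> P j (\<sigma> \<circ> r')"
      using rellich_eps[of "\<lambda>n. f (\<sigma> n)" R M "1 / (real j + 1)", OF f R M] unfolding P_def by simp
  qed
  have "Cauchy (\<lambda>n. abs_Lsq (f (diagseq n)))"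
  proof (rule metric_CauchyI)
    fix e :: real assume e: "0 < e"
    obtain j where j: "1 / (real j + 1) < e"
      using reals_Archimedean[OF e] by (auto simp: inverse_eq_divide add.commute)
    have "P j (diagseq \<circ> (+) (Suc j))"
    proof (rule diagseq_holds)
      fix r s :: "nat \<Rightarrow> nat" and n assume r: "strict_mono r" and "P n s"
      then obtain N where N: "\<And>l m. l \<ge> N \<Longrightarrow> m \<ge> N \<Longrightarrow> norm (abs_Lsq (f (s l)) - abs_Lsq (f (s m))) < 1 / (real n + 1)"
        unfolding P_def by blast
      have "l \<le> r l" for l by (rule seq_suble[OF r])
      then have "norm (abs_Lsq (f ((s \<circ> r) l)) - abs_Lsq (f ((s \<circ> r) m))) < 1 / (real n + 1)" if "l \<ge> N" "m \<ge> N" for l m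
        using N[of "r l" "r m"] that order_trans[of N l "r l"] order_trans[of N m "r m"] by simp
      then show "P n (s \<circ> r)" unfolding P_def by blast
    qed
    then obtain N where N: "\<And>l m. l \<ge> N \<Longrightarrow> m \<ge> N \<Longrightarrow>
        norm (abs_Lsq (f (diagseq (Suc j + l))) - abs_Lsq (f (diagseq (Suc j + m)))) < 1 / (real j + 1)"
      unfolding P_def by auto
    have "dist (abs_Lsq (f (diagseq l))) (abs_Lsq (f (diagseq m))) < e" if "l \<ge> Suc j + N" "m \<ge> Suc j + N" for l m
    proof -
      have "N \<le> l - Suc j" "N \<le> m - Suc j" using that by auto
      from N[OF this] show ?thesis using that j unfolding dist_norm by simp
    qed
    then show "\<exists>M. \<forall>m\<ge>M. \<forall>n\<ge>M. dist (abs_Lsq (f (diagseq m))) (abs_Lsq (f (diagseq n))) < e" by blast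
  qed
  then have "convergent (\<lambda>n. abs_Lsq (f (diagseq n)))" by (rule Cauchy_convergent)
  then show ?thesis using subseq_diagseq by blast
qed

text \<open>Every element of the closure is close to a solenoidal test function with nearly the same bounds, and all these functions
vanish outside one ball because \<open>D\<close> is bounded. A convergent subsequence of the test functions carries the given sequence with it.\<close>

theorem rellich_V_graph:
  assumes D: "bounded D"
  shows "compact (closure {U. \<exists>A. (U, A) \<in> V_graph D \<and> norm U \<le> M \<and> norm A \<le> M})"
proof -
  define S where "S = {U. \<exists>A. (U, A) \<in> V_graph D \<and> norm U \<le> M \<and> norm A \<le> M}"
  have "bounded D" by (rule D)
  then obtain R where R: "\<And>x. x \<in> D \<Longrightarrow> norm x \<le> R" unfolding bounded_iff by blast
  have approx: "\<exists>f. f \<in> solenoidal_tests D \<and> dist (abs_Lsq f) U < e \<and> norm (abs_Lsq f) \<le> M + e \<and> norm (abs_Lsq (jac f)) \<le> M + e"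
    if U: "U \<in> closure S" and e: "0 < e" for U e
  proof -
    have e2: "0 < e / 2" using e by simp
    obtain V where V: "V \<in> S" "dist V U < e / 2" using U e2 unfolding closure_approachable by blast
    obtain A where A: "(V, A) \<in> V_graph D" "norm V \<le> M" "norm A \<le> M" using V(1) unfolding S_def by blast
    obtain p where p: "p \<in> test_graph (solenoidal_tests D)" "dist p (V, A) < e / 2"
      using A(1) e2 unfolding V_graph_def closure_approachable by blast
    obtain f where f: "f \<in> solenoidal_tests D" "p = (abs_Lsq f, abs_Lsq (jac f))" using p(1) unfolding test_graph_def by blast
    have d1: "dist (abs_Lsq f) V < e / 2" using p(2) dist_fst_le[of p "(V, A)"] f(2) by simp
    have d2: "dist (abs_Lsq (jac f)) A < e / 2" using p(2) dist_snd_le[of p "(V, A)"] f(2) by simp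
    have "dist (abs_Lsq f) U < e" using d1 V(2) dist_triangle[of "abs_Lsq f" U V] by linarith
    moreover have "norm (abs_Lsq f) \<le> M + e"
      using d1 A(2) norm_triangle_sub[of "abs_Lsq f" V] e unfolding dist_norm by linarith
    moreover have "norm (abs_Lsq (jac f)) \<le> M + e"
      using d2 A(3) norm_triangle_sub[of "abs_Lsq (jac f)" A] e unfolding dist_norm by linarith
    ultimately show ?thesis using f(1) by blast
  qed
  have "seq_compact (closure S)"
  proof (rule seq_compactI)
    fix U :: "nat \<Rightarrow> (real^2, real^2) Lsq" assume U: "\<forall>n. U n \<in> closure S"
    have "\<forall>n. \<exists>f. f \<in> solenoidal_tests D \<and> dist (abs_Lsq f) (U n) < 1 / (real n + 1) \<and>
        norm (abs_Lsq f) \<le> M + 1 / (real n + 1) \<and> norm (abs_Lsq (jac f)) \<le> M + 1 / (real n + 1)"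
      using U by (intro allI approx) auto
    then obtain f where f: "\<And>n. f n \<in> solenoidal_tests D" "\<And>n. dist (abs_Lsq (f n)) (U n) < 1 / (real n + 1)"
        "\<And>n. norm (abs_Lsq (f n)) \<le> M + 1 / (real n + 1)" "\<And>n. norm (abs_Lsq (jac (f n))) \<le> M + 1 / (real n + 1)"
      by metis
    have small: "M + 1 / (real n + 1) \<le> M + 1" for n by simp
    have "\<exists>k::nat \<Rightarrow> nat. strict_mono k \<and> convergent (\<lambda>n. abs_Lsq (f (k n)))"
    proof (rule rellich_sequence)
      show "C1c (f n)" for n by (rule test_C1c[OF solenoidal_test[OF f(1)]])
      show "f n x = 0" if x: "R + 1 \<le> norm x" for n x
      proof (rule test_outside(1)[OF solenoidal_test[OF f(1)]])
        show "x \<notin> D" using R[of x] x by auto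
      qed
      show "norm (abs_Lsq (f n)) \<le> M + 1" for n by (rule order_trans[OF f(3) small])
      show "norm (abs_Lsq (jac (f n))) \<le> M + 1" for n by (rule order_trans[OF f(4) small])
    qed
    then obtain k l where k: "strict_mono (k :: nat \<Rightarrow> nat)" and l: "(\<lambda>n. abs_Lsq (f (k n))) \<longlonglongrightarrow> l"
      unfolding convergent_def by blast
    have "(\<lambda>n. 1 / (real n + 1)) \<longlonglongrightarrow> 0" by real_asymp
    from LIMSEQ_subseq_LIMSEQ[OF this k] have z: "(\<lambda>n. 1 / (real (k n) + 1)) \<longlonglongrightarrow> 0" by (simp add: o_def)
    have "(\<lambda>n. dist (abs_Lsq (f (k n))) (U (k n))) \<longlonglongrightarrow> 0"
      by (rule tendsto_sandwich[OF _ _ tendsto_const z]) (use f(2) in \<open>auto intro!: always_eventually less_imp_le\<close>)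
    then have "(\<lambda>n. abs_Lsq (f (k n)) - U (k n)) \<longlonglongrightarrow> 0"
      unfolding dist_norm by (rule tendsto_norm_zero_cancel)
    from tendsto_diff[OF l this] have Ul: "(\<lambda>n. U (k n)) \<longlonglongrightarrow> l" by simp
    moreover have "l \<in> closure S"
      by (rule closed_sequentially[OF closed_closure _ Ul]) (use U in blast)
    ultimately show "\<exists>l\<in>closure S. \<exists>r. strict_mono r \<and> (U \<circ> r) \<longlonglongrightarrow> l" using k by (auto simp: o_def)
  qed
  then show ?thesis unfolding S_def compact_eq_seq_compact_metric .
qed

section \<open>Poisson stable solutions\<close>

lemma navier_stokes_form_V_graph:
  assumes D: "open D" "bounded D"
  shows "navier_stokes_form (V_graph D) outer_class 4"
proof
  show "closed (V_graph D)" by (rule closed_V_graph)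
  show "subspace (V_graph D)" by (rule subspace_V_graph)
  show "b = 0" if "(0, b) \<in> V_graph D" for b by (rule V_graph_single_0[OF D that])
  show "compact (closure {u. \<exists>a. (u, a) \<in> V_graph D \<and> norm u \<le> M \<and> norm a \<le> M})" for M
    by (rule rellich_V_graph[OF D(2)])
  show "outer_class (u - u') w = outer_class u w - outer_class u' w"
    if "(u, a) \<in> V_graph D" "(u', a') \<in> V_graph D" "(w, b) \<in> V_graph D" for u u' w a a' b
    by (rule outer_class_diff[OF that])
  show "(norm (outer_class u w))\<^sup>2 \<le> 4 * norm u * norm a * (norm w * norm b)"
    if "(u, a) \<in> V_graph D" "(w, b) \<in> V_graph D" for u a w b
    by (rule outer_class_bound(2)[OF that])
qed simp

text \<open>The trilinear form is the inner product of the gradient with \<open>w \<otimes> u\<close>. The functions may be exchanged for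
representatives of their classes, which agree with them almost everywhere.\<close>

lemma convection_B_L2_class:
  assumes D: "open D" "bounded D" and u: "u \<in> V_space D" and w: "w \<in> V_space D"
  shows "convection_B D u u w = L2_class D (weak_gradient D u) \<bullet> outer_class (L2_class D u) (L2_class D w)"
proof -
  have DL: "D \<in> sets lebesgue" using D(1) by (simp add: lborelD)
  note uV = V_spaceD[OF D u] and wV = V_spaceD[OF D w]
  define G where "G x = indicator D x *\<^sub>R weak_gradient D u x" for x
  define u0 where "u0 x = indicator D x *\<^sub>R u x" for x
  define w0 where "w0 x = indicator D x *\<^sub>R w x" for x
  have sG: "sq_integrable G" using uV(2) DL unfolding G_def[abs_def] by (simp add: L2_iff_sq_integrable)
  have su: "sq_integrable u0" using uV(1) DL unfolding u0_def[abs_def] by (simp add: L2_iff_sq_integrable)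
  have sw: "sq_integrable w0" using wV(1) DL unfolding w0_def[abs_def] by (simp add: L2_iff_sq_integrable)
  have cG: "L2_class D (weak_gradient D u) = abs_Lsq G" and cu: "L2_class D u = abs_Lsq u0" and cw: "L2_class D w = abs_Lsq w0"
    unfolding L2_class_def G_def[abs_def] u0_def[abs_def] w0_def[abs_def] by auto
  have sT: "sq_integrable (\<lambda>x. outer (repr (L2_class D w) x) (repr (L2_class D u) x))" by (rule outer_class_bound(1)[OF uV(3) wV(3)])
  have "L2_class D (weak_gradient D u) \<bullet> outer_class (L2_class D u) (L2_class D w) = (\<integral>x. G x \<bullet> outer (repr (L2_class D w) x) (repr (L2_class D u) x) \<partial>lebesgue)"
    unfolding cG outer_class_def by (rule inner_abs[OF sG sT])
  also have "\<dots> = (\<integral>x. G x \<bullet> outer (w0 x) (u0 x) \<partial>lebesgue)"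
  proof (rule integral_cong_AE)
    show "(\<lambda>x. G x \<bullet> outer (repr (L2_class D w) x) (repr (L2_class D u) x)) \<in> borel_measurable lebesgue"
      by (rule borel_measurable_inner[OF sq_integrable_measurable[OF sG] sq_integrable_measurable[OF sT]])
    show "(\<lambda>x. G x \<bullet> outer (w0 x) (u0 x)) \<in> borel_measurable lebesgue"
      by (rule borel_measurable_inner[OF sq_integrable_measurable[OF sG] measurable_outer[OF sq_integrable_measurable[OF sw] sq_integrable_measurable[OF su]]])
    show "AE x in lebesgue. G x \<bullet> outer (repr (L2_class D w) x) (repr (L2_class D u) x) = G x \<bullet> outer (w0 x) (u0 x)"
      using repr_abs[OF su] repr_abs[OF sw] unfolding cu cw by eventually_elim simp
  qed
  also have "\<dots> = (\<integral>x. indicator D x *\<^sub>R ((weak_gradient D u x *v u x) \<bullet> w x) \<partial>lebesgue)"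
    unfolding inner_outer
    by (intro Bochner_Integration.integral_cong) (auto simp: G_def u0_def w0_def indicator_def)
  finally show ?thesis unfolding convection_B_def L2_inner_def using DL by (simp add: integral_restrict_space)
qed

lemma C_H_iff_continuous:
  assumes D: "D \<in> sets lebesgue" and u: "\<And>t. t \<in> S \<Longrightarrow> u t \<in> H_space D"
  shows "u \<in> C_H S D \<longleftrightarrow> continuous_on S (\<lambda>t. L2_class D (u t))"
proof -
  have uL: "u t \<in> L2 D" if "t \<in> S" for t using u[OF that] unfolding H_space_def by blast
  have "((\<lambda>r. L2_norm D (\<lambda>x. u r x - u t x)) \<longlongrightarrow> 0) (at t within S) \<longleftrightarrow> ((\<lambda>t. L2_class D (u t)) \<longlongrightarrow> L2_class D (u t)) (at t within S)"
    if t: "t \<in> S" for t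
  proof -
    have "\<forall>\<^sub>F r in at t within S. L2_norm D (\<lambda>x. u r x - u t x) = norm (L2_class D (u r) - L2_class D (u t))"
      unfolding eventually_at_filter using uL t
      by (intro always_eventually) (auto simp: L2_norm_L2_class[OF D] L2_diff[OF D] L2_class_diff[OF D])
    then have "((\<lambda>r. L2_norm D (\<lambda>x. u r x - u t x)) \<longlongrightarrow> 0) (at t within S) \<longleftrightarrow>
        ((\<lambda>r. norm (L2_class D (u r) - L2_class D (u t))) \<longlongrightarrow> 0) (at t within S)"
      by (rule tendsto_cong)
    then show ?thesis by (simp add: tendsto_norm_zero_iff LIM_zero_iff)
  qed
  then show ?thesis unfolding C_H_def continuous_on_def using u by auto
qed

text \<open>Otherwise the interval would be a null set.\<close>

lemma AE_half_line_dense: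
  assumes "AE t in lebesgue_on {0..}. P t" and ab: "0 \<le> a" "a < (b :: real)"
  shows "\<exists>t. a < t \<and> t < b \<and> P t"
proof (rule ccontr)
  assume neg: "\<not> ?thesis"
  have "AE t in lebesgue. t \<in> {0..} \<longrightarrow> P t" using assms(1) by (simp add: AE_restrict_space_iff)
  then have "AE t in lebesgue. t \<notin> {a<..<b}"
    by eventually_elim (use neg ab in auto)
  then have "{a<..<b} \<in> null_sets lebesgue" by (subst AE_iff_null_sets) auto
  then have "negligible {a<..<b}" by (simp only: negligible_iff_null_sets)
  moreover have "\<not> negligible {a<..<b}" by (rule open_not_negligible) (use ab in auto)
  ultimately show False by blast
qed

context
  fixes D :: "(real^2) set" and \<nu> :: real
  assumes D: "open D" "bounded D"
begin

interpretation navier_stokes_form "V_graph D" outer_class 4 \<nu>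
  by (rule navier_stokes_form_V_graph[OF D])

lemma D_sets: "D \<in> sets lebesgue"
  using D(1) by (simp add: lborelD)

lemma grad_L2_class: "u \<in> V_space D \<Longrightarrow> grad (L2_class D u) = L2_class D (weak_gradient D u)"
  by (rule grad_eq[OF V_spaceD(3)[OF D]])

lemma rhs_L2_class:
  assumes u: "u \<in> V_space D" and w: "w \<in> V_space D" and f: "f \<in> L2 D"
  shows "L2_inner D f w - stokes_A D \<nu> u w - convection_B D u u w = rhs (L2_class D f) (L2_class D u) (L2_class D w)"
  unfolding rhs_def grad_L2_class[OF u] grad_L2_class[OF w] stokes_A_def convection_B_L2_class[OF D u w]
  by (simp add: L2_inner_L2_class[OF D_sets] f V_spaceD[OF D u] V_spaceD[OF D w])

lemma repr_in_V_space:
  assumes "(U, A) \<in> V_graph D"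
  shows "repr U \<in> V_space D" "L2_class D (repr U) = U" "repr U \<in> H_space D"
proof -
  note s = V_graph_fst_supported[OF D(1) assms]
  show "L2_class D (repr U) = U" by (rule s(1))
  show "repr U \<in> V_space D" by (rule V_spaceI(1)[OF D s(3)]) (use assms s(1) in simp)
  show "repr U \<in> H_space D" using s by (simp add: H_space_iff[OF D_sets])
qed

lemma forcing_recurrent:
  assumes F: "F \<in> C_H UNIV D" and P: "Poisson_stable_forcing D F"
  shows "recurrent 1 (\<lambda>t. L2_class D (F t))" "recurrent (-1) (\<lambda>t. L2_class D (F t))"
proof -
  have FL: "F t \<in> L2 D" for t using F unfolding C_H_def H_space_def by blast
  have dist: "dist (L2_class D (F s)) (L2_class D (F t)) = L2_norm D (\<lambda>x. F s x - F t x)" for s t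
    by (simp add: dist_norm L2_norm_L2_class[OF D_sets] L2_diff[OF D_sets] L2_class_diff[OF D_sets] FL)
  have main: "recurrent \<sigma> (\<lambda>t. L2_class D (F t))"
    if conv: "conv_compact_open D (\<lambda>n. translate (t n) F) (translate 0 F)"
      and lim: "filterlim (\<lambda>n. \<sigma> * t n) at_top sequentially" for \<sigma> t
    unfolding recurrent_def
  proof (intro allI impI)
    fix R e :: real assume e: "0 < e"
    have "\<forall>\<^sub>F n in sequentially. \<forall>r\<in>{-R..R}. L2_norm D (\<lambda>x. translate (t n) F r x - translate 0 F r x) < e"
      using conv e unfolding conv_compact_open_def by blast
    moreover have "\<forall>\<^sub>F n in sequentially. R \<le> \<sigma> * t n" using lim unfolding filterlim_at_top by blast
    ultimately have "\<forall>\<^sub>F n in sequentially. R \<le> \<sigma> * t n \<and> (\<forall>r\<in>{-R..R}. dist (L2_class D (F (r + t n))) (L2_class D (F r)) < e)"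
      by eventually_elim (simp add: dist translate_def)
    then show "\<exists>t. R \<le> \<sigma> * t \<and> (\<forall>r\<in>{-R..R}. dist (L2_class D (F (r + t))) (L2_class D (F r)) < e)"
      using eventually_happens'[OF sequentially_bot] by blast
  qed
  obtain t where t: "filterlim t at_top sequentially" "conv_compact_open D (\<lambda>n. translate (t n) F) (translate 0 F)"
    using P unfolding Poisson_stable_forcing_def Poisson_stable_def omega_limit_set_def by blast
  show "recurrent 1 (\<lambda>t. L2_class D (F t))" by (rule main[OF t(2)]) (use t(1) in simp)
  obtain s where s: "filterlim s at_bot sequentially" "conv_compact_open D (\<lambda>n. translate (s n) F) (translate 0 F)"
    using P unfolding Poisson_stable_forcing_def Poisson_stable_def alpha_limit_set_def by blast
  show "recurrent (-1) (\<lambda>t. L2_class D (F t))" by (rule main[OF s(2)]) (use s(1) in \<open>simp add: filterlim_uminus_at_top\<close>)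
qed

text \<open>The definition of a solution places \<open>v t\<close> in \<open>V\<close> at almost every time. Every time is a limit of such times, so continuity in \<open>H\<close>
and the closedness of balls of \<open>V\<close> give \<open>v t \<in> V\<close>, with the bound \<open>M\<close>, at all times.\<close>

lemma bdd_sol_of_NS_solution:
  assumes F: "F \<in> C_H UNIV D" and v: "NS_solution_from D \<nu> F 0 v"
    and bd: "\<And>t. 0 < t \<Longrightarrow> H1_norm D (v t) \<le> M"
  shows "bdd_sol M (\<lambda>t. L2_class D (F t)) 0 (\<lambda>t. L2_class D (v t))"
proof -
  have FL: "F t \<in> L2 D" for t using F unfolding C_H_def H_space_def by blast
  note v' = v[unfolded NS_solution_from_def]
  have vC: "v \<in> C_H {0..} D" by (rule conjunct1[OF v'])
  have vV: "AE t in lebesgue_on {0..}. v t \<in> V_space D" by (rule conjunct1[OF conjunct2[OF v']])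
  have eq: "has_bochner_integral (lebesgue_on {a..b})
      (\<lambda>t. L2_inner D (F t) w - stokes_A D \<nu> (v t) w - convection_B D (v t) (v t) w)
      (L2_inner D (v b) w - L2_inner D (v a) w)" if "w \<in> V_space D" "0 \<le> a" "a \<le> b" for w a b
    using bspec[OF conjunct2[OF conjunct2[OF conjunct2[OF v']]] that(1)] that(2,3) by simp
  have vH: "v t \<in> H_space D" if "t \<in> {0..}" for t using vC that unfolding C_H_def by blast
  have vL: "v t \<in> L2 D" if "0 \<le> t" for t using vH[of t] that unfolding H_space_def by auto
  have cont: "continuous_on {0..} (\<lambda>t. L2_class D (v t))" by (rule iffD1[OF C_H_iff_continuous[OF D_sets vH] vC])
  have bV: "V_bdd M (L2_class D (v t))" if t: "0 < t" "v t \<in> V_space D" for t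
  proof -
    note vt = V_spaceD[OF D t(2)]
    have "norm (L2_class D (v t), L2_class D (weak_gradient D (v t))) \<le> M"
      using bd[OF t(1)] H1_norm_V[OF D vt(1,3)] by simp
    then show ?thesis unfolding V_bdd_def grad_L2_class[OF t(2)]
      using vt(3) norm_fst_le[of "L2_class D (v t)" "L2_class D (weak_gradient D (v t))"]
        norm_snd_le[of "L2_class D (weak_gradient D (v t))" "L2_class D (v t)"] by auto
  qed
  have V_bdd: "V_bdd M (L2_class D (v t))" if t: "0 \<le> t" for t
  proof -
    have "\<exists>s. t < s \<and> s < t + 1 / (real n + 1) \<and> v s \<in> V_space D" for n
      by (rule AE_half_line_dense[OF vV t]) simp
    then obtain s where s: "\<And>n. t < s n" "\<And>n. s n < t + 1 / (real n + 1)" "\<And>n. v (s n) \<in> V_space D" by metis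
    have z: "(\<lambda>n. t + 1 / (real n + 1)) \<longlonglongrightarrow> t" by real_asymp
    have st: "s \<longlonglongrightarrow> t"
      by (rule tendsto_sandwich[OF _ _ tendsto_const z]) (auto intro!: always_eventually less_imp_le s)
    have lim: "(\<lambda>n. L2_class D (v (s n))) \<longlonglongrightarrow> L2_class D (v t)"
    proof (rule continuous_on_tendsto_compose[OF cont st])
      show "t \<in> {0..}" using t by simp
      have "s n \<in> {0..}" for n using s(1)[of n] t by simp
      then show "\<forall>\<^sub>F n in sequentially. s n \<in> {0..}" by simp
    qed
    have "V_bdd M (L2_class D (v (s n)))" for n by (rule bV) (use s(1)[of n] s(3)[of n] t in auto)
    then show ?thesis by (rule V_bdd_limit(1)[OF _ lim])
  qed
  have vV': "v t \<in> V_space D" if "0 \<le> t" for t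
    by (rule V_spaceI(1)[OF D vL[OF that], of "grad (L2_class D (v t))"]) (use V_bdd[OF that] in \<open>simp add: V_bdd_def\<close>)
  show ?thesis unfolding bdd_sol_def
  proof (intro conjI allI impI cont)
    show "V_bdd M (L2_class D (v t))" if "0 \<le> t" for t by (rule V_bdd[OF that])
    fix W and a b :: real assume W: "(W, grad W) \<in> V_graph D" and ab: "0 \<le> a" "a \<le> b"
    note w = repr_in_V_space[OF W]
    have wL: "repr W \<in> L2 D" by (rule V_spaceD(1)[OF D w(1)])
    have "has_bochner_integral (lebesgue_on {a..b})
          (\<lambda>t. L2_inner D (F t) (repr W) - stokes_A D \<nu> (v t) (repr W) - convection_B D (v t) (v t) (repr W))
          (L2_class D (v b) \<bullet> W - L2_class D (v a) \<bullet> W)"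
      using eq[OF w(1) ab] ab by (simp add: L2_inner_L2_class[OF D_sets] vL wL w(2))
    then show "has_bochner_integral (lebesgue_on {a..b}) (\<lambda>t. rhs (L2_class D (F t)) (L2_class D (v t)) W)
          (L2_class D (v b) \<bullet> W - L2_class D (v a) \<bullet> W)"
    proof (rule has_bochner_integral_cong[THEN iffD1, rotated -1])
      fix t assume "t \<in> space (lebesgue_on {a..b})"
      then have "0 \<le> t" using ab by simp
      then show "L2_inner D (F t) (repr W) - stokes_A D \<nu> (v t) (repr W) - convection_B D (v t) (v t) (repr W) = rhs (L2_class D (F t)) (L2_class D (v t)) W"
        using rhs_L2_class[OF vV' w(1) FL, of t t] w(2) by simp
    qed auto
  qed
qed

text \<open>The norm of the gradient is lower semicontinuous along a continuous curve in \<open>H\<close>: weak limits of gradients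
keep norm bounds. This makes the \<open>H\<^sup>1\<close> norm of an entire bounded solution a measurable function of time, as the
definition of a solution asks.\<close>

lemma measurable_norm_grad:
  assumes c: "continuous_on UNIV u" and V: "\<And>t. (u t, grad (u t)) \<in> V_graph D"
  shows "(\<lambda>t::real. norm (grad (u t))) \<in> borel_measurable borel"
proof (rule borel_measurableI_le)
  fix y
  have "closed {t. norm (grad (u t)) \<le> y}"
    unfolding closed_sequential_limits
  proof (intro allI impI)
    fix s t assume st: "(\<forall>n. s n \<in> {t. norm (grad (u t)) \<le> y}) \<and> s \<longlonglongrightarrow> t"
    have "(\<lambda>n. u (s n)) \<longlonglongrightarrow> u t"
      using st by (intro continuous_on_tendsto_compose[OF c]) auto
    have "\<exists>g0. (u t, g0) \<in> V_graph D \<and> norm g0 \<le> y \<and> (\<forall>h. (\<lambda>n. grad (u (s n)) \<bullet> h) \<longlonglongrightarrow> g0 \<bullet> h)"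
    proof (rule graph_weak_limit[OF closed_V_graph subspace_imp_convex[OF subspace_V_graph]])
      show "a = b" if "(w, a) \<in> V_graph D" "(w, b) \<in> V_graph D" for w a b by (rule graph_single[OF that])
      show "(u (s n), grad (u (s n))) \<in> V_graph D" for n by (rule V)
      show "norm (grad (u (s n))) \<le> y" for n using st by blast
      show "(\<lambda>n. u (s n)) \<longlonglongrightarrow> u t" by fact
    qed
    then show "t \<in> {t. norm (grad (u t)) \<le> y}" using grad_eq by auto
  qed
  then show "{t \<in> space borel. norm (grad (u t)) \<le> y} \<in> sets borel" by simp
qed

lemma NS_solution_of_bdd_sol:
  assumes F: "F \<in> C_H UNIV D" and u: "\<And>s. bdd_sol M (\<lambda>t. L2_class D (F t)) s u"
  shows "NS_entire_solution D \<nu> F (\<lambda>t. repr (u t))"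
proof -
  have FL: "F t \<in> L2 D" for t using F unfolding C_H_def H_space_def by blast
  have bu: "V_bdd M (u t)" for t using u[of t] unfolding bdd_sol_def by blast
  then have V: "(u t, grad (u t)) \<in> V_graph D" for t unfolding V_bdd_def by blast
  note f = repr_in_V_space[OF V]
  have fL: "repr (u t) \<in> L2 D" for t by (rule V_spaceD(1)[OF D f(1)])
  have cont: "continuous_on UNIV u" by (rule bdd_sol_continuous[OF u])
  have CH: "(\<lambda>t. repr (u t)) \<in> C_H S D" for S
    using continuous_on_subset[OF cont, of S] by (simp add: C_H_iff_continuous[OF D_sets] f(2,3))
  have H1: "(H1_norm D (repr (u t)))\<^sup>2 = (norm (u t))\<^sup>2 + (norm (grad (u t)))\<^sup>2" for t
  proof -
    have "H1_norm D (repr (u t)) = norm (u t, grad (u t))"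
      using H1_norm_V[OF D fL, of t "grad (u t)"] V by (simp add: f(2))
    then show ?thesis by (simp add: norm_prod_def)
  qed
  have "NS_solution_from D \<nu> F s (\<lambda>t. repr (u t))" for s
    unfolding NS_solution_from_def
  proof (intro conjI allI ballI impI CH)
    show "AE t in lebesgue_on {s..}. repr (u t) \<in> V_space D" by (intro AE_I2 f(1))
    show "integrable (lebesgue_on {s..T}) (\<lambda>t. (H1_norm D (repr (u t)))\<^sup>2)" for T
    proof (rule finite_measure.integrable_const_bound[where B = "M\<^sup>2 + M\<^sup>2"])
      show "finite_measure (lebesgue_on {s..T})" by (rule finite_measure_lebesgue_on) simp
      have m1: "(\<lambda>t. norm (u t)) \<in> borel_measurable borel"
        by (intro borel_measurable_continuous_onI continuous_on_norm cont)
      have m2: "(\<lambda>t. norm (grad (u t))) \<in> borel_measurable borel" by (rule measurable_norm_grad[OF cont V])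
      have "(\<lambda>t. (norm (u t))\<^sup>2 + (norm (grad (u t)))\<^sup>2) \<in> borel_measurable borel"
        using m1 m2 by measurable
      then have "(\<lambda>t. (norm (u t))\<^sup>2 + (norm (grad (u t)))\<^sup>2) \<in> borel_measurable lebesgue"
        by (simp add: measurable_completion)
      then show "(\<lambda>t. (H1_norm D (repr (u t)))\<^sup>2) \<in> borel_measurable (lebesgue_on {s..T})"
        unfolding H1 by (rule measurable_restrict_space1)
      have "(norm (u t))\<^sup>2 + (norm (grad (u t)))\<^sup>2 \<le> M\<^sup>2 + M\<^sup>2" for t
        using bu[of t] by (intro add_mono power_mono) (auto simp: V_bdd_def)
      then show "AE t in lebesgue_on {s..T}. norm ((H1_norm D (repr (u t)))\<^sup>2) \<le> M\<^sup>2 + M\<^sup>2"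
        unfolding H1 by (intro AE_I2) simp
    qed
    fix w and a b :: real assume w: "w \<in> V_space D" and ab: "s \<le> a \<and> a \<le> b"
    note wV = V_spaceD[OF D w]
    have "(L2_class D w, grad (L2_class D w)) \<in> V_graph D" unfolding grad_L2_class[OF w] by (rule wV(3))
    then have "has_bochner_integral (lebesgue_on {a..b}) (\<lambda>t. rhs (L2_class D (F t)) (u t) (L2_class D w)) (u b \<bullet> L2_class D w - u a \<bullet> L2_class D w)"
      using u[of s] ab unfolding bdd_sol_def by blast
    then show "has_bochner_integral (lebesgue_on {a..b})
          (\<lambda>t. L2_inner D (F t) w - stokes_A D \<nu> (repr (u t)) w - convection_B D (repr (u t)) (repr (u t)) w)
          (L2_inner D (repr (u b)) w - L2_inner D (repr (u a)) w)"
      unfolding rhs_L2_class[OF f(1) w FL] by (simp add: L2_inner_L2_class[OF D_sets fL wV(1)] f(2))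
  qed
  then show ?thesis unfolding NS_entire_solution_def using CH by blast
qed

text \<open>Returns with \<open>R = n\<close> and \<open>e = 1/(n+1)\<close> give the sequences of times in the definition of the limit sets.\<close>

lemma Poisson_stable_of_returns:
  assumes F: "F \<in> C_H UNIV D" and u: "\<And>s. bdd_sol M (\<lambda>t. L2_class D (F t)) s u"
    and ret: "u \<in> returns M 1 (\<lambda>t. L2_class D (F t)) u" "u \<in> returns M (-1) (\<lambda>t. L2_class D (F t)) u"
  shows "Poisson_stable_solution D F (\<lambda>t. repr (u t))"
proof -
  have FL: "F t \<in> L2 D" for t using F unfolding C_H_def H_space_def by blast
  have "V_bdd M (u t)" for t using u[of t] unfolding bdd_sol_def by blast
  then have V: "(u t, grad (u t)) \<in> V_graph D" for t unfolding V_bdd_def by blast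
  note f = repr_in_V_space[OF V]
  have fL: "repr (u t) \<in> L2 D" for t by (rule V_spaceD(1)[OF D f(1)])
  have distF: "L2_norm D (\<lambda>x. F s x - F t x) = dist (L2_class D (F s)) (L2_class D (F t))" for s t
    by (simp add: dist_norm L2_norm_L2_class[OF D_sets] L2_diff[OF D_sets] L2_class_diff[OF D_sets] FL)
  have distu: "L2_norm D (\<lambda>x. repr (u s) x - repr (u t) x) = dist (u s) (u t)" for s t
    by (simp add: dist_norm L2_norm_L2_class[OF D_sets] L2_diff[OF D_sets] L2_class_diff[OF D_sets] fL f(2))
  have main: "\<exists>t. (\<forall>n. real n \<le> \<sigma> * t n) \<and> conv_skew D (\<lambda>n. (repr (u (t n)), translate (t n) F)) (repr (u 0), translate 0 F)"
    if r: "u \<in> returns M \<sigma> (\<lambda>t. L2_class D (F t)) u" for \<sigma>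
  proof -
    have "\<exists>t. real n \<le> \<sigma> * t \<and> (\<forall>r\<in>{-real n..real n}. dist (u (r + t)) (u r) < 1 / (real n + 1) \<and>
        dist (L2_class D (F (r + t))) (L2_class D (F r)) < 1 / (real n + 1))" for n :: nat
    proof -
      have "0 < 1 / (real n + 1)" by simp
      then show ?thesis using r unfolding returns_def by blast
    qed
    then obtain t where t: "\<And>n. real n \<le> \<sigma> * t n"
      "\<And>n r. r \<in> {-real n..real n} \<Longrightarrow> dist (u (r + t n)) (u r) < 1 / (real n + 1)"
      "\<And>n r. r \<in> {-real n..real n} \<Longrightarrow> dist (L2_class D (F (r + t n))) (L2_class D (F r)) < 1 / (real n + 1)" by metis
    have z: "(\<lambda>n. 1 / (real n + 1)) \<longlonglongrightarrow> 0" by real_asymp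
    have "(\<lambda>n. dist (u (t n)) (u 0)) \<longlonglongrightarrow> 0"
    proof (rule tendsto_sandwich[OF _ _ tendsto_const z])
      have "dist (u (t n)) (u 0) \<le> 1 / (real n + 1)" for n using t(2)[of 0 n] by simp
      then show "\<forall>\<^sub>F n in sequentially. dist (u (t n)) (u 0) \<le> 1 / (real n + 1)" by simp
    qed simp
    then have 1: "conv_H D (\<lambda>n. repr (u (t n))) (repr (u 0))" unfolding conv_H_def distu .
    have 2: "conv_compact_open D (\<lambda>n. translate (t n) F) (translate 0 F)"
      unfolding conv_compact_open_def
    proof (intro allI impI, elim conjE)
      fix K :: "real set" and e :: real assume K: "compact K" and e: "0 < e"
      obtain R where R: "\<And>r. r \<in> K \<Longrightarrow> \<bar>r\<bar> \<le> R"
        using compact_imp_bounded[OF K] unfolding bounded_iff real_norm_def by blast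
      have "\<forall>\<^sub>F n in sequentially. R \<le> real n" by real_asymp
      moreover have "\<forall>\<^sub>F n in sequentially. 1 / (real n + 1) < e" using e by real_asymp
      ultimately show "\<forall>\<^sub>F n in sequentially. \<forall>r\<in>K. L2_norm D (\<lambda>x. translate (t n) F r x - translate 0 F r x) < e"
      proof eventually_elim
        case (elim n)
        show ?case
        proof
          fix r assume "r \<in> K"
          then have "r \<in> {-real n..real n}" using R[of r] elim(1) by auto
          then show "L2_norm D (\<lambda>x. translate (t n) F r x - translate 0 F r x) < e"
            using t(3)[of r n] elim(2) by (simp add: translate_def distF)
        qed
      qed
    qed
    show ?thesis unfolding conv_skew_def using t(1) 1 2 by auto
  qed
  have hull: "translate 0 F \<in> hull_of D F"
  proof -
    have e: "translate 0 F = F" by (simp add: translate_def)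
    have "conv_compact_open D (\<lambda>n. translate 0 F) (translate 0 F)"
      unfolding conv_compact_open_def translate_def distF by simp
    then have "\<exists>\<tau>. conv_compact_open D (\<lambda>n. translate (\<tau> n) F) (translate 0 F)"
      by (intro exI[of _ "\<lambda>_. 0"])
    moreover have "translate 0 F \<in> C_H UNIV D" unfolding e by (rule F)
    ultimately show ?thesis unfolding hull_of_def by blast
  qed
  obtain t where t: "\<And>n. real n \<le> 1 * t n" "conv_skew D (\<lambda>n. (repr (u (t n)), translate (t n) F)) (repr (u 0), translate 0 F)"
    using main[OF ret(1)] by blast
  have tl: "filterlim t at_top sequentially"
    by (rule filterlim_at_top_mono[OF filterlim_real_sequentially]) (use t(1) in auto)
  obtain s where s: "\<And>n. real n \<le> -1 * s n" "conv_skew D (\<lambda>n. (repr (u (s n)), translate (s n) F)) (repr (u 0), translate 0 F)"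
    using main[OF ret(2)] by blast
  have sl: "filterlim s at_bot sequentially"
  proof -
    have "filterlim (\<lambda>n. - s n) at_top sequentially"
      by (rule filterlim_at_top_mono[OF filterlim_real_sequentially]) (use s(1) in auto)
    then show ?thesis by (simp add: filterlim_uminus_at_top)
  qed
  show ?thesis
    unfolding Poisson_stable_solution_def Poisson_stable_def omega_limit_set_def alpha_limit_set_def
    using hull f(3) t(2) tl s(2) sl by auto
qed

end

theorem theorem3p4:
  fixes D :: "(real^2) set" and \<nu> :: real
    and F :: "real \<Rightarrow> real^2 \<Rightarrow> real^2"
  assumes "bounded D" and "open D" and "C2_boundary D"
    and "\<nu> > 0"
    and "F \<in> C_H UNIV D"
    and "Poisson_stable_forcing D F"
    and "\<exists>v. NS_solution_from D \<nu> F 0 v \<and>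
           (\<forall>t>0. v t \<in> H10 D \<inter> H_space D) \<and>
           bdd_above ((\<lambda>t. H1_norm D (v t)) ` {0<..})"
  shows "\<exists>u. NS_entire_solution D \<nu> F u \<and> Poisson_stable_solution D F u"
proof -
  note D = \<open>open D\<close> \<open>bounded D\<close>
  have DL: "D \<in> sets lebesgue" using D(1) by (simp add: lborelD)
  interpret navier_stokes_form "V_graph D" outer_class 4 \<nu> by (rule navier_stokes_form_V_graph[OF D])
  obtain v where v: "NS_solution_from D \<nu> F 0 v" and bd: "bdd_above ((\<lambda>t. H1_norm D (v t)) ` {0<..})"
    using assms(7) by blast
  obtain M where M: "\<And>t. 0 < t \<Longrightarrow> H1_norm D (v t) \<le> M" using bd unfolding bdd_above_def by auto
  have "bdd_sol M (\<lambda>t. L2_class D (F t)) 0 (\<lambda>t. L2_class D (v t))"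
    by (rule bdd_sol_of_NS_solution[OF D assms(5) v M])
  moreover have "continuous_on UNIV (\<lambda>t. L2_class D (F t))"
  proof (rule iffD1[OF C_H_iff_continuous[OF DL] assms(5)])
    show "F t \<in> H_space D" for t using assms(5) unfolding C_H_def by blast
  qed
  ultimately obtain u where u: "\<And>s. bdd_sol M (\<lambda>t. L2_class D (F t)) s u"
    "u \<in> returns M 1 (\<lambda>t. L2_class D (F t)) u" "u \<in> returns M (-1) (\<lambda>t. L2_class D (F t)) u"
    using ex_recurrent_solution[OF _ forcing_recurrent[OF D assms(5,6)]] by blast
  have "NS_entire_solution D \<nu> F (\<lambda>t. repr (u t))" by (rule NS_solution_of_bdd_sol[OF D assms(5) u(1)])
  moreover have "Poisson_stable_solution D F (\<lambda>t. repr (u t))"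
    by (rule Poisson_stable_of_returns[OF D assms(5) u])
  ultimately show ?thesis by blast
qed

end
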